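(* Consider the stochastic approximation recursion $w_{k+1}=w_k+\gamma_{k+1}H(w_k,X_{k+1})$, $k\ge 0$, with filtration $(\mathcal F_k)$ described in the context. Assume that $(\gamma_k)$ is a non-increasing sequence of positive numbers with $\sum_k\gamma_k=\infty$ and $\sum_k\gamma_k^2<\infty$, that $h$ is Lipschitz continuous on $\mathbb R^d$, and: (i) $\mathbb E[\|H(w_k,X_{k+1})\|^2]<\infty$ for all $k\ge0$; there are $c_{h,0},c_{h,1}\in\mathbb R_+$ with $\|h(w)\|^2\le c_{h,0}+c_{h,1}W(w)$ for all $w\in\mathbb R^d$; for each $k\ge 0$ there are $\tau_{0,k},\tau_{1,k}\in\mathbb R_+$ with, a.s., $\|\mathbb E[H(w_k,X_{k+1})\mid\mathcal F_k]-h(w_k)\|^2\le\tau_{0,k}+\tau_{1,k}W(w_k)$; there are $\sigma_0^2,\sigma_1^2\in\mathbb R_+$ such that for all $k\ge 0$, a.s., $\mathbb E[\|H(w_k,X_{k+1})-\mathbb E[H(w_k,X_{k+1})\mid\mathcal F_k]\|^2\mid\mathcal F_k]\le\sigma_0^2+\sigma_1^2W(w_k)$; moreover $\lim_kc_V\tau_{0,k}=\lim_kc_V\tau_{1,k}=0$ and $\sum_k\gamma_kc_V\sqrt{\tau_{0,k}}<\infty$. (ii) There is a continuously differentiable $V:\mathbb R^d\to\mathbb R$ with $\inf V>-\infty$, with Lipschitz continuous gradient, and with $\langle\nabla V(w),h(w)\rangle\le-\rho W(w)$ for all $w\in\mathbb R^d$ for some $\rho>0$; moreover $\lim_{\|w\|\to\infty}V(w)=\infty$.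 Then, with probability one, the sequence $(w_k)$ converges, $\lim_{k\to\infty}V(w_k)$ exists, and the limit set $\mathrm{Lim}((w_k)_k)$ is a connected internally chain-recurrent set for the flow $\Phi^h$ of the vector field $h$. If in addition $\Lambda_V:=\{w\in\mathbb R^d:\langle\nabla V(w),h(w)\rangle=0\}$ is compact and invariant for $\Phi^h$ and $V(\Lambda_V)$ has empty interior, then with probability one $\mathrm{Lim}((w_k)_k)\subset\Lambda_V$. Finally, if $\mathbb E[V(w_0)]<\infty$, then $\sup_k\mathbb E[V(w_k)]<\infty$.
   Context: $h:\mathbb R^d\to\mathbb R^d$ (mean field), $H:\mathbb R^d\times\mathsf X\to\mathbb R^d$ (stochastic oracle) and $W:\mathbb R^d\to\mathbb R_+$ are Borel functions; $(X_k)_{k\ge1}$ are $\mathsf X$-valued random variables; $w_0$ is an $\mathbb R^d$-valued random variable. $\mathcal F_k:=\sigma(w_0,X_1,\dots,X_k)$. $c_V\in(0,+\infty]$ is a constant such that $\|\nabla V(w)\|\le c_V\sqrt{W(w)}$ for all $w$; $c_V=+\infty$ is allowed and means that no such bound is required (convention $0\cdot\infty=0$). $\Phi^h=(\Phi^h_t)_{t\in\mathbb R}$ is the flow of the ODE $\dot w=h(w)$. $\mathrm{Lim}((w_k)_k)$ is the set of limits of convergent subsequences of $(w_k)$. A set $\Lambda$ is invariant for a flow $\Phi$ if $\Phi_t(\Lambda)\subset\Lambda$ for all $t\in\mathbb R$. For $\delta,T>0$, a $(\delta,T)$-pseudo-orbit of $\Phi$ from $a$ to $b$ consists of an integer $N\ge1$,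 points $y_0,\dots,y_N$ and times $t_0,\dots,t_{N-1}\ge T$ with $\|y_0-a\|<\delta$, $\|\Phi_{t_j}(y_j)-y_{j+1}\|\le\delta$ for $0\le j\le N-1$, and $\|y_N-b\|\le\delta$. A point $a$ is chain-recurrent for $\Phi$ if for all $\delta,T>0$ there is a $(\delta,T)$-pseudo-orbit from $a$ to $a$. A set $\Lambda$ is internally chain-recurrent if it is nonempty, compact, invariant, and every point of $\Lambda$ is chain-recurrent for the flow restricted to $\Lambda$ (all points $y_j$ taken in $\Lambda$).
   Formalization: "The sequence (w_k) converges" is stated as: Lim((w_k)) is nonempty and the distance from w_k to it tends to 0; convergence to a point fails, e.g. for h(w)=H(w,x)=Jw/(1+|w|) in the plane (J a quarter turn), W=0, V=|w|^2, c_V=∞, γ_k=1/k, where Lim is a circle. *)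

theory Defs
  imports "HOL-Probability.Probability"
begin

definition history_algebra ::
  "'a measure \<Rightarrow> 'x measure \<Rightarrow> ('a \<Rightarrow> real ^ 'n) \<Rightarrow> (nat \<Rightarrow> 'a \<Rightarrow> 'x) \<Rightarrow> nat \<Rightarrow> 'a measure"
  where
  "history_algebra M S w0 X k =
     sigma (space M)
       ({w0 -` A \<inter> space M | A. A \<in> sets borel} \<union>
        (\<Union>i\<in>{1..k}. {X i -` A \<inter> space M | A. A \<in> sets S}))"

(* The library provides conditional expectations of real random variables only;
   for vectors they are taken coordinatewise. *)
definition vec_cond_exp ::
  "'a measure \<Rightarrow> 'a measure \<Rightarrow> ('a \<Rightarrow> real ^ 'n) \<Rightarrow> 'a \<Rightarrow> real ^ 'n"
  where
  "vec_cond_exp M F f = (\<lambda>\<omega>. \<chi> i. real_cond_exp M F (\<lambda>\<omega>'. f \<omega>' $ i) \<omega>)"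

(* For Lipschitz h the global solution through x exists and is unique, so the
   description denotes it; for other h the value may be unspecified. *)
definition ode_flow :: "('a \<Rightarrow> 'a) \<Rightarrow> real \<Rightarrow> 'a \<Rightarrow> 'a::real_normed_vector" where
  "ode_flow h t x =
     (THE u. u 0 = x \<and> (\<forall>s. (u has_vector_derivative h (u s)) (at s))) t"

definition flow_invariant :: "(real \<Rightarrow> 'a \<Rightarrow> 'a) \<Rightarrow> 'a set \<Rightarrow> bool" where
  "flow_invariant \<Phi> \<Lambda> \<longleftrightarrow> (\<forall>t. \<Phi> t ` \<Lambda> \<subseteq> \<Lambda>)"

(* Pseudo-orbits for the flow restricted to \<Lambda>; the whole flow is the case \<Lambda> = UNIV.
   The first inequality is strict, the others are not. *)
definition pseudo_orbit ::
  "(real \<Rightarrow> 'a \<Rightarrow> 'a::real_normed_vector) \<Rightarrow> 'a set \<Rightarrow> real \<Rightarrow> real \<Rightarrow> 'a \<Rightarrow> 'a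
    \<Rightarrow> nat \<Rightarrow> (nat \<Rightarrow> 'a) \<Rightarrow> (nat \<Rightarrow> real) \<Rightarrow> bool"
  where
  "pseudo_orbit \<Phi> \<Lambda> \<delta> T a b N y t \<longleftrightarrow>
     1 \<le> N \<and> (\<forall>j\<le>N. y j \<in> \<Lambda>) \<and> (\<forall>j<N. T \<le> t j) \<and>
     norm (y 0 - a) < \<delta> \<and>
     (\<forall>j<N. norm (\<Phi> (t j) (y j) - y (Suc j)) \<le> \<delta>) \<and>
     norm (y N - b) \<le> \<delta>"

definition chain_recurrent_on ::
  "(real \<Rightarrow> 'a \<Rightarrow> 'a::real_normed_vector) \<Rightarrow> 'a set \<Rightarrow> 'a \<Rightarrow> bool"
  where
  "chain_recurrent_on \<Phi> \<Lambda> a \<longleftrightarrow>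
     (\<forall>\<delta>>0. \<forall>T>0. \<exists>N y t. pseudo_orbit \<Phi> \<Lambda> \<delta> T a a N y t)"

definition internally_chain_recurrent ::
  "(real \<Rightarrow> 'a \<Rightarrow> 'a::real_normed_vector) \<Rightarrow> 'a set \<Rightarrow> bool"
  where
  "internally_chain_recurrent \<Phi> \<Lambda> \<longleftrightarrow>
     \<Lambda> \<noteq> {} \<and> compact \<Lambda> \<and> flow_invariant \<Phi> \<Lambda> \<and>
     (\<forall>a\<in>\<Lambda>. chain_recurrent_on \<Phi> \<Lambda> a)"

definition limit_set :: "(nat \<Rightarrow> 'a::topological_space) \<Rightarrow> 'a set" where
  "limit_set w = {l. \<exists>r. strict_mono r \<and> (w \<circ> r) \<longlonglongrightarrow> l}"

(* Nonemptiness is required because infdist to the empty set is 0.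
   Convergence to a point is the case of a singleton.  It is too strong for stochastic
   approximation: with V w = (norm w)^2, W = 0 and, in the plane, H(w,x) = h w =
   J w / (1 + norm w), J the rotation by a right angle, the iterates from w_0 \<noteq> 0
   accumulate at every point of a circle. *)
definition converges_to_set :: "(nat \<Rightarrow> 'a::metric_space) \<Rightarrow> 'a set \<Rightarrow> bool" where
  "converges_to_set w S \<longleftrightarrow> S \<noteq> {} \<and> (\<lambda>k. infdist (w k) S) \<longlonglongrightarrow> 0"

end

theory Submission
  imports Defs
begin

text \<open>
  The theorem combines a pathwise statement about perturbed Euler schemes with a supermartingale
  argument showing that almost every path is such a scheme.

  Write \<open>U = V - inf V\<close> and split the oracle into mean field, bias and noise, the noise being a
  martingale difference. Since the gradient of \<open>V\<close> is Lipschitz, one step changes \<open>U\<close> by the first-order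
  term plus \<open>O(\<gamma>\<^sup>2)\<close> times the squared oracle. In conditional expectation the mean field contributes
  \<open>- \<rho> \<gamma> W\<close>, while bias and second moments contribute small multiples of \<open>\<gamma> W\<close> and a summable
  deterministic sequence. Hence \<open>U (w k)\<close> is eventually a supermartingale up to a summable sequence
  (\<open>U_drift\<close>). This bounds the expectations (\<open>expectation_bounded\<close>) and, through a maximal inequality, the
  paths (\<open>U_at_bounded\<close>). On a path along which \<open>U\<close> is bounded, the conditional variance of the noise is
  bounded as well, because \<open>W \<le> 1 + C U\<close> (\<open>dissipation_le\<close>). As \<open>\<Sum> \<gamma>\<^sup>2\<close> converges, so do the noise series,
  both the vector series and the one along the gradient of \<open>V\<close>
  (\<open>square_integrable_martingale_converges\<close>); from the latter follows the convergence of \<open>V (w k)\<close>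
  (\<open>almost_sure_behaviour\<close>). Coercivity of \<open>V\<close> makes the path bounded.

  The rest is deterministic. A bounded scheme with vanishing bias and convergent noise series follows the
  flow over bounded stretches of time with an error tending to \<open>0\<close> (\<open>tracking\<close>). Hence its limit set is
  invariant, and jumping between limit points near the iterates gives pseudo-orbits inside the limit set
  from any of its points back to that point (\<open>pseudo_orbit_along\<close>). It is connected because the steps tend
  to \<open>0\<close> (\<open>limit_set_connected\<close>). The flow exists globally by Picard iteration (\<open>solution_exists\<close>).

  Finally, \<open>V\<close> has the value \<open>lim V (w k)\<close> at every limit point. By invariance it is constant along orbits in
  the limit set, so its derivative along the flow, the inner product of the gradient with \<open>h\<close>, vanishes
  there (\<open>limit_set_stationary\<close>): the limit set lies in \<open>\<Lambda>V\<close>.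
\<close>

section \<open>The flow of a Lipschitz vector field\<close>

lemma antiderivative_on_line:
  fixes f :: "real \<Rightarrow> 'a::euclidean_space"
  assumes "continuous_on UNIV f"
  shows "\<exists>F. F 0 = 0 \<and> (\<forall>t. (F has_vector_derivative f t) (at t))"
proof -
  have "\<exists>F. \<forall>x::real. -\<infinity> < ereal x \<longrightarrow> ereal x < \<infinity> \<longrightarrow> (F has_vector_derivative f x) (at x)"
    by (rule einterval_antiderivative)
       (use assms in \<open>auto simp: continuous_on_eq_continuous_at\<close>)
  then obtain F where F: "\<And>x. (F has_vector_derivative f x) (at x)"
    by auto
  show ?thesis
    by (rule exI[of _ "\<lambda>t. F t - F 0"]) (auto intro!: derivative_eq_intros F)
qed

lemma vector_derivative_reflect:
  assumes "(u has_vector_derivative D) (at (- s))"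
  shows "((\<lambda>t. u (- t)) has_vector_derivative - D) (at s)"
proof -
  have "((\<lambda>t::real. - t) has_vector_derivative - 1) (at s)"
    by (auto intro!: derivative_eq_intros)
  from vector_diff_chain_at[OF this, of u D] assms show ?thesis
    by (simp add: o_def)
qed

text \<open>In the norm weighted by \<open>exp (- c * \<bar>t\<bar>)\<close>, integration from \<open>0\<close> is a contraction with factor
  \<open>1 / c\<close>. This makes Picard iteration converge on the whole line at once, in both time directions.\<close>

lemma exp_weighted_mean_value:
  fixes f :: "real \<Rightarrow> 'a::real_normed_vector"
  assumes f: "\<And>s. (f has_vector_derivative f' s) (at s)" and f0: "f 0 = 0"
    and c: "0 < c" and B: "\<And>s. norm (f' s) \<le> B * c * exp (c * \<bar>s\<bar>)"
  shows "norm (f t) \<le> B * exp (c * \<bar>t\<bar>)"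
proof -
  have B0: "0 \<le> B"
    using order_trans[OF norm_ge_zero B[of 0]] c by (simp add: zero_le_mult_iff)
  have *: "norm (g t) \<le> B * exp (c * t)"
    if g: "\<And>s. (g has_vector_derivative g' s) (at s)" and g0: "g 0 = 0"
      and gB: "\<And>s. 0 < s \<Longrightarrow> norm (g' s) \<le> B * c * exp (c * s)" and t: "0 < t"
    for g :: "real \<Rightarrow> 'a" and g' t
  proof -
    have "norm (g t - g 0) \<le> B * exp (c * t) - B * exp (c * 0)"
    proof (rule differentiable_bound_general[where f'=g' and \<phi>'="\<lambda>s. B * (c * exp (c * s))"])
      show "continuous_on {0..t} g"
        using g has_vector_derivative_continuous continuous_at_imp_continuous_on by blast
      show "((\<lambda>s. B * exp (c * s)) has_vector_derivative B * (c * exp (c * s))) (at s)" for s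
        unfolding has_real_derivative_iff_has_vector_derivative[symmetric]
        by (auto intro!: derivative_eq_intros)
      show "norm (g' s) \<le> B * (c * exp (c * s))" if "0 < s" for s
        using gB[OF that] by (simp add: mult.assoc)
    qed (use t g in \<open>auto intro!: continuous_intros\<close>)
    then show ?thesis
      using B0 g0 by simp
  qed
  consider "t = 0" | "0 < t" | "t < 0" by linarith
  then show ?thesis
  proof cases
    case 1 then show ?thesis using f0 B0 by simp
  next
    case 2
    then show ?thesis using *[OF f f0, of t] B by (metis abs_of_pos)
  next
    case 3
    have "norm ((\<lambda>s. f (- s)) (- t)) \<le> B * exp (c * (- t))"
    proof (rule *)
      show "((\<lambda>s. f (- s)) has_vector_derivative - f' (- s)) (at s)" for s
        by (rule vector_derivative_reflect[OF f])
      show "norm (- f' (- s)) \<le> B * c * exp (c * s)" if "0 < s" for s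
        using B[of "- s"] that by simp
    qed (use f0 3 in auto)
    then show ?thesis using 3 by simp
  qed
qed

locale lipschitz_field =
  fixes h :: "'a::euclidean_space \<Rightarrow> 'a" and L :: real
  assumes lipschitz: "norm (h x - h y) \<le> L * norm (x - y)" and L_pos: "0 < L"
begin

lemma continuous_field: "continuous_on A h"
  by (rule lipschitz_on_continuous_on[of L])
     (use lipschitz L_pos in \<open>auto intro!: lipschitz_onI simp: dist_norm\<close>)

definition solves :: "(real \<Rightarrow> 'a) \<Rightarrow> bool" where
  "solves u \<longleftrightarrow> (\<forall>s. (u has_vector_derivative h (u s)) (at s))"

lemma solves_continuous: "solves u \<Longrightarrow> continuous_on A u"
  unfolding solves_def
  by (meson has_vector_derivative_continuous continuous_at_imp_continuous_on)

text \<open>Picard iteration. With weight rate \<open>c = 2 * L\<close> consecutive iterates get closer by a factor \<open>2\<close>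
  in the weighted norm, hence converge uniformly on bounded intervals; so do their derivatives
  \<open>h (u n t)\<close>, and the limit may be differentiated.\<close>

lemma solution_exists: "\<exists>u. u 0 = x \<and> solves u"
proof -
  have step: "\<exists>v. v 0 = x \<and> (\<forall>t. (v has_vector_derivative h (u t)) (at t))"
    if u: "continuous_on UNIV u" for u :: "real \<Rightarrow> 'a"
  proof -
    have "continuous_on UNIV (\<lambda>t. h (u t))"
      using continuous_on_compose2[OF continuous_field u] by auto
    from antiderivative_on_line[OF this] obtain G
      where "G 0 = 0" "\<And>t. (G has_vector_derivative h (u t)) (at t)" by auto
    then show ?thesis
      by (intro exI[of _ "\<lambda>t. x + G t"]) (auto intro!: derivative_eq_intros)
  qed
  let ?Q = "\<lambda>n u. continuous_on UNIV u \<and> u 0 = x"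
  let ?R = "\<lambda>n u v. \<forall>t. (v has_vector_derivative h (u t)) (at t)"
  have cont: "continuous_on UNIV v" if "\<forall>t. (v has_vector_derivative g t) (at t)"
    for v :: "real \<Rightarrow> 'a" and g
    using that by (meson has_vector_derivative_continuous continuous_at_imp_continuous_on)
  have "\<exists>u. \<forall>n. (?Q n (u n) \<and> (n = 0 \<longrightarrow> u n = (\<lambda>_. x))) \<and> ?R n (u n) (u (Suc n))"
  proof (rule dependent_nat_choice)
    show "\<exists>v. ?Q 0 v \<and> (0 = (0::nat) \<longrightarrow> v = (\<lambda>_. x))" by auto
    fix u :: "real \<Rightarrow> 'a" and n :: nat
    assume "?Q n u \<and> (n = 0 \<longrightarrow> u = (\<lambda>_. x))"
    with step[of u] obtain v where v: "v 0 = x" "?R n u v" by auto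
    with cont[OF v(2)]
    show "\<exists>v. (?Q (Suc n) v \<and> (Suc n = 0 \<longrightarrow> v = (\<lambda>_. x))) \<and> ?R n u v" by auto
  qed
  then obtain u where u0: "u 0 = (\<lambda>_. x)" and ux: "\<And>n. u n 0 = x"
    and u': "\<And>n t. (u (Suc n) has_vector_derivative h (u n t)) (at t)"
    by metis
  define c where "c = 2 * L"
  have c: "0 < c" using L_pos by (simp add: c_def)
  define C where "C = norm (h x) / c"
  have C0: "0 \<le> C" using c by (simp add: C_def)
  have diff: "norm (u (Suc n) t - u n t) \<le> C / 2 ^ n * exp (c * \<bar>t\<bar>)" for n t
  proof (induction n arbitrary: t)
    case 0
    have "norm (u (Suc 0) t - u 0 t) \<le> C * exp (c * \<bar>t\<bar>)"
    proof (rule exp_weighted_mean_value[of "\<lambda>t. u (Suc 0) t - u 0 t" "\<lambda>_. h x"])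
      show "((\<lambda>t. u (Suc 0) t - u 0 t) has_vector_derivative h x) (at s)" for s
        using u'[of 0 s] u0 by (auto intro!: derivative_eq_intros)
      show "norm (h x) \<le> C * c * exp (c * \<bar>s\<bar>)" for s
        using c mult_left_mono[of 1 "exp (c * \<bar>s\<bar>)" "norm (h x)"] by (simp add: C_def)
    qed (use ux c in auto)
    then show ?case by simp
  next
    case (Suc n)
    show ?case
    proof (rule exp_weighted_mean_value[of "\<lambda>t. u (Suc (Suc n)) t - u (Suc n) t"
            "\<lambda>s. h (u (Suc n) s) - h (u n s)"])
      show "((\<lambda>t. u (Suc (Suc n)) t - u (Suc n) t) has_vector_derivative
              h (u (Suc n) s) - h (u n s)) (at s)" for s
        by (intro derivative_intros u')
      show "norm (h (u (Suc n) s) - h (u n s)) \<le> C / 2 ^ Suc n * c * exp (c * \<bar>s\<bar>)" for s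
      proof -
        have "norm (h (u (Suc n) s) - h (u n s)) \<le> L * norm (u (Suc n) s - u n s)"
          by (rule lipschitz)
        also have "\<dots> \<le> L * (C / 2 ^ n * exp (c * \<bar>s\<bar>))"
          using Suc.IH L_pos by (intro mult_left_mono) auto
        also have "\<dots> = C / 2 ^ Suc n * c * exp (c * \<bar>s\<bar>)"
          by (simp add: c_def)
        finally show ?thesis .
      qed
    qed (use ux c in auto)
  qed
  have tail: "norm (u (n + k) t - u n t) \<le> (2 - 2 / 2 ^ k) * (C / 2 ^ n * exp (c * \<bar>t\<bar>))" for n k t
  proof (induction k)
    case (Suc k)
    have "norm (u (n + Suc k) t - u n t)
        \<le> norm (u (Suc (n + k)) t - u (n + k) t) + norm (u (n + k) t - u n t)"
      by (metis add_Suc_right norm_triangle_ineq diff_add_cancel add_diff_eq)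
    also have "\<dots> \<le> C / 2 ^ (n + k) * exp (c * \<bar>t\<bar>)
        + (2 - 2 / 2 ^ k) * (C / 2 ^ n * exp (c * \<bar>t\<bar>))"
      using diff Suc.IH by (intro add_mono) auto
    also have "\<dots> = (2 - 2 / 2 ^ Suc k) * (C / 2 ^ n * exp (c * \<bar>t\<bar>))"
      by (simp add: power_add field_simps)
    finally show ?case .
  qed simp
  have tail': "norm (u m t - u n t) \<le> 2 * C * exp (c * \<bar>t\<bar>) / 2 ^ n" if "n \<le> m" for n m t
  proof -
    have "norm (u m t - u n t) \<le> (2 - 2 / 2 ^ (m - n)) * (C / 2 ^ n * exp (c * \<bar>t\<bar>))"
      using tail[of n "m - n" t] that by simp
    also have "\<dots> \<le> 2 * (C / 2 ^ n * exp (c * \<bar>t\<bar>))"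
      using C0 by (intro mult_right_mono) auto
    finally show ?thesis by simp
  qed
  have to0: "(\<lambda>n. K / 2 ^ n) \<longlonglongrightarrow> 0" for K :: real
    using tendsto_mult_right_zero[OF LIMSEQ_inverse_realpow_zero[of 2], of K] by (simp add: field_simps)
  have "Cauchy (\<lambda>n. u n t)" for t
    unfolding Cauchy_altdef2
  proof (intro allI impI)
    fix e :: real assume "0 < e"
    then obtain N where "2 * C * exp (c * \<bar>t\<bar>) / 2 ^ N < e"
      using order_tendstoD(2)[OF to0, of e] by (auto simp: eventually_sequentially)
    then show "\<exists>N. \<forall>n\<ge>N. dist (u n t) (u N t) < e"
      using tail' le_less_trans unfolding dist_norm by blast
  qed
  then have "\<forall>t. \<exists>l. (\<lambda>n. u n t) \<longlonglongrightarrow> l"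
    by (simp add: Cauchy_convergent_iff convergent_def)
  then obtain g where g: "\<And>t. (\<lambda>n. u n t) \<longlonglongrightarrow> g t"
    by metis
  have close: "norm (u n t - g t) \<le> 2 * C * exp (c * \<bar>t\<bar>) / 2 ^ n" for n t
  proof (rule LIMSEQ_le_const2)
    show "(\<lambda>m. norm (u n t - u m t)) \<longlonglongrightarrow> norm (u n t - g t)"
      by (intro tendsto_intros g)
    show "\<exists>N. \<forall>m\<ge>N. norm (u n t - u m t) \<le> 2 * C * exp (c * \<bar>t\<bar>) / 2 ^ n"
      by (intro exI[of _ n] allI impI) (metis norm_minus_commute tail')
  qed
  have "(g has_vector_derivative h (g t)) (at t)" for t
  proof -
    define T where "T = \<bar>t\<bar> + 1"
    define S where "S = {-T<..<T}"
    have tS: "t \<in> S" "0 \<in> S" "open S" "convex S" by (auto simp: S_def T_def)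
    have "\<exists>G. \<forall>s\<in>S. (\<lambda>n. u (Suc n) s) \<longlonglongrightarrow> G s \<and>
            (G has_derivative (\<lambda>r. r *\<^sub>R h (g s))) (at s within S)"
    proof (rule has_derivative_sequence[where f'="\<lambda>n s r. r *\<^sub>R h (u n s)"])
      show "(u (Suc n) has_derivative (\<lambda>r. r *\<^sub>R h (u n s))) (at s within S)" for n s
        using u'[of n s] unfolding has_vector_derivative_def by (rule has_derivative_at_withinI)
      show "(\<lambda>n. u (Suc n) 0) \<longlonglongrightarrow> x" using ux by simp
      fix e :: real assume e: "0 < e"
      have "\<forall>\<^sub>F n in sequentially. L * (2 * C * exp (c * T)) / 2 ^ n < e"
        using order_tendstoD(2)[OF to0 e] .
      then show "\<forall>\<^sub>F n in sequentially. \<forall>s\<in>S. \<forall>r. norm (r *\<^sub>R h (u n s) - r *\<^sub>R h (g s)) \<le> e * norm r"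
      proof eventually_elim
        case (elim n)
        show ?case
        proof (intro ballI allI)
          fix s r assume "s \<in> S"
          then have sT: "exp (c * \<bar>s\<bar>) \<le> exp (c * T)" using c by (auto simp: S_def)
          have "norm (h (u n s) - h (g s)) \<le> L * (2 * C * exp (c * \<bar>s\<bar>) / 2 ^ n)"
            using order_trans[OF lipschitz mult_left_mono[OF close]] L_pos by auto
          also have "\<dots> \<le> L * (2 * C * exp (c * T) / 2 ^ n)"
            using sT C0 L_pos by (intro mult_left_mono divide_right_mono) auto
          also have "\<dots> \<le> e" using elim by simp
          finally have "\<bar>r\<bar> * norm (h (u n s) - h (g s)) \<le> \<bar>r\<bar> * e"
            by (rule mult_left_mono) simp
          then show "norm (r *\<^sub>R h (u n s) - r *\<^sub>R h (g s)) \<le> e * norm r"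
            by (simp add: scaleR_diff_right[symmetric] mult.commute)
        qed
      qed
    qed (use tS in auto)
    then obtain G where G: "\<And>s. s \<in> S \<Longrightarrow> (\<lambda>n. u (Suc n) s) \<longlonglongrightarrow> G s"
      "\<And>s. s \<in> S \<Longrightarrow> (G has_vector_derivative h (g s)) (at s within S)"
      unfolding has_vector_derivative_def by blast
    have "G s = g s" if "s \<in> S" for s
      using LIMSEQ_unique[OF G(1)[OF that] LIMSEQ_Suc[OF g]] .
    then have "(g has_vector_derivative h (g t)) (at t within S)"
      using has_vector_derivative_transform[OF tS(1) _ G(2)[OF tS(1)]] by auto
    then show ?thesis
      using has_vector_derivative_within_open[OF tS(1) tS(3)] by blast
  qed
  moreover have "g 0 = x"
    using LIMSEQ_unique[OF g[of 0]] ux by simp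
  ultimately show ?thesis
    unfolding solves_def by blast
qed

lemma lipschitz_field_uminus: "lipschitz_field (\<lambda>x. - h x) L"
  by unfold_locales (use lipschitz L_pos in \<open>auto simp: norm_minus_commute\<close>)

text \<open>The Gronwall estimate: \<open>exp (- 2 * L * s) * (norm (u s - v s))\<^sup>2\<close> has a nonpositive derivative.\<close>

lemma solutions_separate_forward:
  assumes "solves u" "solves v" "0 \<le> t"
  shows "norm (u t - v t) \<le> exp (L * t) * norm (u 0 - v 0)"
proof -
  define q where "q s = exp (- (2 * L * s)) * ((u s - v s) \<bullet> (u s - v s))" for s
  have "q t \<le> q 0"
  proof (rule DERIV_nonpos_imp_nonincreasing[OF assms(3)])
    fix s
    define d where "d = u s - v s"
    define r where "r = h (u s) - h (v s)"
    have "((\<lambda>s. u s - v s) has_vector_derivative r) (at s)"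
      unfolding r_def using assms by (intro derivative_intros) (auto simp: solves_def)
    then have "((\<lambda>s. (u s - v s) \<bullet> (u s - v s)) has_derivative (\<lambda>x. d \<bullet> (x *\<^sub>R r) + (x *\<^sub>R r) \<bullet> d)) (at s)"
      unfolding has_vector_derivative_def d_def
      by (intro has_derivative_inner)
    moreover have "(\<lambda>x. d \<bullet> (x *\<^sub>R r) + (x *\<^sub>R r) \<bullet> d) = (*) (2 * (d \<bullet> r))"
      by (auto simp: inner_commute)
    ultimately have D: "((\<lambda>s. (u s - v s) \<bullet> (u s - v s)) has_real_derivative 2 * (d \<bullet> r)) (at s)"
      by (simp add: has_field_derivative_def)
    have "(q has_real_derivative exp (- (2 * L * s)) * (2 * (d \<bullet> r))
            + exp (- (2 * L * s)) * (- (2 * L)) * (d \<bullet> d)) (at s)"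
      unfolding q_def by (rule derivative_eq_intros D refl | simp add: d_def)+
    moreover have "d \<bullet> r \<le> L * (d \<bullet> d)"
    proof -
      have "d \<bullet> r \<le> norm d * norm r" by (rule norm_cauchy_schwarz)
      also have "\<dots> \<le> norm d * (L * norm d)"
        unfolding d_def r_def by (intro mult_left_mono lipschitz) auto
      also have "\<dots> = L * (d \<bullet> d)" by (simp add: dot_square_norm power2_eq_square)
      finally show ?thesis .
    qed
    then have "exp (- (2 * L * s)) * (2 * (d \<bullet> r) - 2 * L * (d \<bullet> d)) \<le> 0"
      by (intro mult_nonneg_nonpos) auto
    ultimately show "\<exists>y. (q has_real_derivative y) (at s) \<and> y \<le> 0"
      by (intro exI[of _ "exp (- (2 * L * s)) * (2 * (d \<bullet> r))
            + exp (- (2 * L * s)) * (- (2 * L)) * (d \<bullet> d)"]) (simp add: algebra_simps)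
  qed
  then have "exp (2 * L * t) * q t \<le> exp (2 * L * t) * q 0"
    by (intro mult_left_mono) auto
  then have "(norm (u t - v t))\<^sup>2 \<le> exp (2 * L * t) * (norm (u 0 - v 0))\<^sup>2"
    by (simp add: q_def dot_square_norm mult.assoc[symmetric] exp_add[symmetric])
  also have "exp (2 * L * t) = (exp (L * t))\<^sup>2"
    by (simp add: power2_eq_square exp_add[symmetric])
  finally have "(norm (u t - v t))\<^sup>2 \<le> (exp (L * t) * norm (u 0 - v 0))\<^sup>2"
    by (simp add: power_mult_distrib)
  then show ?thesis
    by (rule power2_le_imp_le) simp
qed

lemma solutions_separate:
  assumes "solves u" "solves v"
  shows "norm (u t - v t) \<le> exp (L * \<bar>t\<bar>) * norm (u 0 - v 0)"
proof (cases "0 \<le> t")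
  case True
  then show ?thesis using solutions_separate_forward[OF assms] by simp
next
  case False
  interpret rev: lipschitz_field "\<lambda>x. - h x" L by (rule lipschitz_field_uminus)
  have "rev.solves (\<lambda>s. z (- s))" if "solves z" for z
    using that vector_derivative_reflect unfolding solves_def rev.solves_def by blast
  from rev.solutions_separate_forward[OF this this, OF assms, of "- t"] False
  show ?thesis by simp
qed

lemma solution_unique: "solves u \<Longrightarrow> solves v \<Longrightarrow> u 0 = v 0 \<Longrightarrow> u = v"
  using solutions_separate by (intro ext) (metis eq_iff_diff_eq_0 mult_zero_right norm_le_zero_iff norm_zero)

abbreviation flow :: "real \<Rightarrow> 'a \<Rightarrow> 'a" where "flow \<equiv> ode_flow h"

lemma flow_eqI: "solves u \<Longrightarrow> u 0 = x \<Longrightarrow> flow t x = u t"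
  unfolding ode_flow_def
  by (rule arg_cong[where f="\<lambda>u. u t"], rule the_equality)
     (auto simp: solves_def[symmetric] intro: solution_unique)

lemma flow_solves: "solves (\<lambda>t. flow t x)" and flow_0 [simp]: "flow 0 x = x"
proof -
  obtain u where u: "u 0 = x" "solves u" using solution_exists by blast
  then have "(\<lambda>t. flow t x) = u" using flow_eqI by blast
  with u show "solves (\<lambda>t. flow t x)" "flow 0 x = x" by (auto simp: fun_eq_iff)
qed

lemma flow_derivative: "((\<lambda>t. flow t x) has_vector_derivative h (flow t x)) (at t)"
  using flow_solves unfolding solves_def by blast

lemma flow_add: "flow (s + t) x = flow s (flow t x)"
proof -
  have "solves (\<lambda>s. flow (s + t) x)"
    unfolding solves_def
  proof
    fix s
    have "((\<lambda>r. flow r x) \<circ> (\<lambda>s. s + t) has_vector_derivative 1 *\<^sub>R h (flow (s + t) x)) (at s)"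
      by (rule vector_diff_chain_at) (auto intro!: derivative_eq_intros flow_derivative)
    then show "((\<lambda>s. flow (s + t) x) has_vector_derivative h (flow (s + t) x)) (at s)"
      by (simp add: o_def)
  qed
  from flow_eqI[OF this, of "flow t x" s] show ?thesis by simp
qed

lemma flow_lipschitz: "norm (flow t x - flow t y) \<le> exp (L * \<bar>t\<bar>) * norm (x - y)"
  using solutions_separate[OF flow_solves flow_solves, of t x y] by simp

lemma flow_tendsto:
  assumes x: "(x \<longlongrightarrow> p) A" and s: "(s \<longlongrightarrow> t) A"
  shows "((\<lambda>i. flow (s i) (x i)) \<longlongrightarrow> flow t p) A"
proof -
  have "continuous (at t) (\<lambda>t. flow t p)"
    using flow_derivative has_vector_derivative_continuous by blast
  then have 1: "((\<lambda>i. flow (s i) p) \<longlongrightarrow> flow t p) A"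
    using isCont_tendsto_compose s by blast
  have "((\<lambda>i. exp (L * \<bar>s i\<bar>) * norm (x i - p)) \<longlongrightarrow> exp (L * \<bar>t\<bar>) * norm (p - p)) A"
    by (intro tendsto_intros x s)
  then have 0: "((\<lambda>i. exp (L * \<bar>s i\<bar>) * norm (x i - p)) \<longlongrightarrow> 0) A" by simp
  have "((\<lambda>i. flow (s i) (x i) - flow (s i) p) \<longlongrightarrow> 0) A"
    by (rule Lim_null_comparison[OF _ 0]) (simp add: flow_lipschitz)
  from tendsto_add[OF this 1] show ?thesis by simp
qed

lemma flow_bounded:
  fixes R T :: real
  obtains K where "0 < K" "\<And>(x::'a) t. norm x \<le> R \<Longrightarrow> \<bar>t\<bar> \<le> T \<Longrightarrow> norm (h (flow t x)) \<le> K"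
proof -
  have "compact ((\<lambda>t. flow t 0) ` {-T..T})"
    by (intro compact_continuous_image solves_continuous[OF flow_solves]) auto
  then obtain B where B: "\<And>t. \<bar>t\<bar> \<le> T \<Longrightarrow> norm (flow t 0) \<le> B"
    using compact_imp_bounded by (force simp: bounded_iff abs_le_iff)
  define K where "K = norm (h 0) + L * (B + exp (L * T) * \<bar>R\<bar>)"
  show thesis
  proof
    fix x :: 'a and t :: real assume x: "norm x \<le> R" and t: "\<bar>t\<bar> \<le> T"
    have "norm (flow t x - flow t 0) \<le> exp (L * \<bar>t\<bar>) * norm (x - 0)" by (rule flow_lipschitz)
    also have "\<dots> \<le> exp (L * T) * \<bar>R\<bar>"
      using x t L_pos by (intro mult_mono) auto
    finally have "norm (flow t x) \<le> B + exp (L * T) * \<bar>R\<bar>"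
      using B[OF t] norm_triangle_sub[of "flow t x" "flow t 0"] by linarith
    moreover have "norm (h (flow t x)) \<le> norm (h 0) + L * norm (flow t x)"
      using lipschitz[of "flow t x" 0] norm_triangle_sub[of "h (flow t x)" "h 0"] by simp
    ultimately show "norm (h (flow t x)) \<le> \<bar>K\<bar> + 1"
      using L_pos by (smt (verit) K_def mult_left_mono)
  qed simp
qed

text \<open>On \<open>{t..t + \<delta>}\<close> the solution moves by at most \<open>K * \<delta>\<close>, so its velocity varies by at most
  \<open>L * K * \<delta>\<close>: one Euler step is second order accurate.\<close>

lemma flow_euler_step:
  assumes K: "\<And>s. s \<in> {t..t + \<delta>} \<Longrightarrow> norm (h (flow s x)) \<le> K" and d: "0 \<le> \<delta>"
  shows "norm (flow (t + \<delta>) x - flow t x - \<delta> *\<^sub>R h (flow t x)) \<le> L * K * \<delta>\<^sup>2"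
proof -
  let ?S = "{t..t + \<delta>}"
  have D: "((\<lambda>s. flow s x) has_vector_derivative h (flow s x)) (at s within ?S)" for s
    by (rule has_vector_derivative_at_within[OF flow_derivative])
  have K0: "0 \<le> K" using K[of t] d norm_ge_zero order_trans by (metis atLeastAtMost_iff le_add_same_cancel1 order_refl)
  have near: "norm (flow s x - flow t x) \<le> K * \<delta>" if "s \<in> ?S" for s
  proof (cases "t < s")
    case True
    have "norm (flow s x - flow t x) \<le> K * s - K * t"
    proof (rule differentiable_bound_general[OF True, where f'="\<lambda>s. h (flow s x)" and \<phi>'="\<lambda>_. K"])
      show "((\<lambda>s. K * s) has_vector_derivative K) (at s)" for s
        unfolding has_real_derivative_iff_has_vector_derivative[symmetric]
        by (auto intro!: derivative_eq_intros)
    qed (use K that in \<open>auto intro!: continuous_intros flow_derivative solves_continuous flow_solves\<close>)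
    also have "\<dots> = K * (s - t)" by (simp add: algebra_simps)
    also have "\<dots> \<le> K * \<delta>" using that K0 by (intro mult_left_mono) auto
    finally show ?thesis .
  next
    case False
    then show ?thesis using that K0 d by auto
  qed
  have "norm (flow (t + \<delta>) x - flow t x - (t + \<delta> - t) *\<^sub>R h (flow t x)) \<le> norm (t + \<delta> - t) * (L * (K * \<delta>))"
  proof (rule vector_differentiable_bound_linearization[where S="?S"])
    show "norm (h (flow s x) - h (flow t x)) \<le> L * (K * \<delta>)" if "s \<in> ?S" for s
      using order_trans[OF lipschitz mult_left_mono[OF near[OF that]]] L_pos by auto
  qed (use D d in \<open>auto simp: closed_segment_eq_real_ivl\<close>)
  then show ?thesis using d by (simp add: power2_eq_square algebra_simps)
qed

end

section \<open>Limit sets of sequences\<close>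

lemma limit_set_frequently:
  fixes w :: "nat \<Rightarrow> 'a::metric_space"
  shows "l \<in> limit_set w \<longleftrightarrow> (\<forall>\<epsilon>>0. \<forall>N. \<exists>n\<ge>N. dist (w n) l < \<epsilon>)"
proof
  assume "l \<in> limit_set w"
  then obtain r where r: "strict_mono r" "(w \<circ> r) \<longlonglongrightarrow> l" by (auto simp: limit_set_def)
  show "\<forall>\<epsilon>>0. \<forall>N. \<exists>n\<ge>N. dist (w n) l < \<epsilon>"
  proof (intro allI impI)
    fix \<epsilon> :: real and N :: nat assume "0 < \<epsilon>"
    then obtain K where "\<And>k. k \<ge> K \<Longrightarrow> dist (w (r k)) l < \<epsilon>"
      using r(2) by (auto simp: lim_sequentially)
    then have "dist (w (r (max K N))) l < \<epsilon>" by simp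
    moreover have "N \<le> r (max K N)"
      using seq_suble[OF r(1), of "max K N"] by simp
    ultimately show "\<exists>n\<ge>N. dist (w n) l < \<epsilon>" by blast
  qed
next
  assume R: "\<forall>\<epsilon>>0. \<forall>N. \<exists>n\<ge>N. dist (w n) l < \<epsilon>"
  have "\<exists>r. \<forall>k. dist (w (r k)) l < inverse (real (Suc k)) \<and> r k < r (Suc k)"
  proof (rule dependent_nat_choice)
    show "\<exists>n. dist (w n) l < inverse (real (Suc 0))" using R[rule_format, of 1 0] by auto
    fix n k :: nat
    show "\<exists>m. dist (w m) l < inverse (real (Suc (Suc k))) \<and> n < m"
      using R[rule_format, of "inverse (real (Suc (Suc k)))" "Suc n"] by auto
  qed
  then obtain r where r: "\<And>k. dist (w (r k)) l < inverse (real (Suc k))" "strict_mono r"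
    by (auto simp: strict_mono_Suc_iff)
  have "(\<lambda>k. dist (w (r k)) l) \<longlonglongrightarrow> 0"
    by (rule tendsto_sandwich[OF _ _ tendsto_const LIMSEQ_inverse_real_of_nat])
       (intro always_eventually allI zero_le_dist less_imp_le r(1))+
  then have "(w \<circ> r) \<longlonglongrightarrow> l" by (subst tendsto_dist_iff) (simp add: o_def)
  with r(2) show "l \<in> limit_set w" by (auto simp: limit_set_def)
qed

lemma limit_set_filterlimI:
  fixes w :: "nat \<Rightarrow> 'a::metric_space"
  assumes m: "filterlim m at_top sequentially" and l: "(\<lambda>i. w (m i)) \<longlonglongrightarrow> l"
  shows "l \<in> limit_set w"
  unfolding limit_set_frequently
proof (intro allI impI)
  fix \<epsilon> :: real and N :: nat assume "0 < \<epsilon>"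
  then have "\<forall>\<^sub>F i in sequentially. dist (w (m i)) l < \<epsilon>" by (rule tendstoD[OF l])
  moreover have "\<forall>\<^sub>F i in sequentially. N \<le> m i" using m by (auto simp: filterlim_at_top)
  ultimately have "\<forall>\<^sub>F i in sequentially. N \<le> m i \<and> dist (w (m i)) l < \<epsilon>"
    by eventually_elim auto
  then show "\<exists>n\<ge>N. dist (w n) l < \<epsilon>"
    using eventually_happens'[OF sequentially_bot] by blast
qed

lemma limit_set_closed: "closed (limit_set (w :: nat \<Rightarrow> 'a::metric_space))"
  unfolding closed_sequential_limits
proof (intro allI impI)
  fix x l assume x: "(\<forall>n. x n \<in> limit_set w) \<and> x \<longlonglongrightarrow> l"
  show "l \<in> limit_set w"
    unfolding limit_set_frequently
  proof (intro allI impI)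
    fix \<epsilon> :: real and N :: nat assume e: "0 < \<epsilon>"
    with x obtain k where k: "dist (x k) l < \<epsilon> / 2"
      unfolding lim_sequentially by (meson half_gt_zero order_refl)
    obtain n where "n \<ge> N" "dist (w n) (x k) < \<epsilon> / 2"
      using x limit_set_frequently half_gt_zero[OF e] by metis
    with k show "\<exists>n\<ge>N. dist (w n) l < \<epsilon>"
      using dist_triangle_half_r dist_commute by metis
  qed
qed

context
  fixes w :: "nat \<Rightarrow> 'a::euclidean_space"
  assumes bdd: "bounded (range w)"
begin

text \<open>Boundedness enters here: the terms in \<open>C\<close> have a convergent subsequence. Its contraposition
  \<open>eventually_avoids\<close> gives attraction and connectedness.\<close>

lemma limit_point_of_closed_condition:
  assumes inf: "\<And>N. \<exists>n\<ge>N. w n \<in> C" and C: "closed C"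
  shows "\<exists>l\<in>limit_set w. l \<in> C"
proof -
  have "infinite {n. w n \<in> C}"
    using inf by (auto simp: infinite_nat_iff_unbounded_le)
  then obtain r :: "nat \<Rightarrow> nat" where r: "strict_mono r" "\<And>n. w (r n) \<in> C"
    using infinite_enumerate[of "{n. w n \<in> C}"] by auto
  have "bounded (range (w \<circ> r))" using bdd by (rule bounded_subset) auto
  then obtain l s where s: "strict_mono s" "(w \<circ> r \<circ> s) \<longlonglongrightarrow> l"
    using bounded_imp_convergent_subsequence by blast
  have "l \<in> C"
    by (rule closed_sequentially[OF C _ s(2)]) (simp add: r(2))
  moreover have "l \<in> limit_set w"
    using s(2) strict_mono_o[OF r(1) s(1)] by (auto simp: limit_set_def o_assoc)
  ultimately show ?thesis by blast
qed

lemma eventually_avoids: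
  assumes "closed C" "limit_set w \<inter> C = {}"
  obtains N where "\<And>n. n \<ge> N \<Longrightarrow> w n \<notin> C"
  using limit_point_of_closed_condition[OF _ assms(1)] assms(2) by blast

lemma limit_set_nonempty: "limit_set w \<noteq> {}"
  using limit_point_of_closed_condition[of UNIV] by auto

lemma limit_set_compact: "compact (limit_set w)"
proof -
  have "limit_set w \<subseteq> closure (range w)"
    by (force simp: closure_approachable limit_set_frequently)
  then have "bounded (limit_set w)" by (rule bounded_subset[OF bounded_closure[OF bdd]])
  with limit_set_closed show ?thesis by (simp add: compact_eq_bounded_closed)
qed

lemma limit_set_attracts: "converges_to_set w (limit_set w)"
  unfolding converges_to_set_def
proof
  show "(\<lambda>k. infdist (w k) (limit_set w)) \<longlonglongrightarrow> 0"
    unfolding lim_sequentially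
  proof (intro allI impI)
    fix \<epsilon> :: real assume "0 < \<epsilon>"
    then have "limit_set w \<inter> {x. \<epsilon> \<le> infdist x (limit_set w)} = {}" by auto
    moreover have "closed {x. \<epsilon> \<le> infdist x (limit_set w)}"
      by (intro closed_Collect_le continuous_intros)
    ultimately obtain N where "\<And>n. n \<ge> N \<Longrightarrow> w n \<notin> {x. \<epsilon> \<le> infdist x (limit_set w)}"
      using eventually_avoids by blast
    then show "\<exists>N. \<forall>n\<ge>N. dist (infdist (w n) (limit_set w)) 0 < \<epsilon>"
      by (auto simp: dist_real_def infdist_nonneg not_le)
  qed
qed (rule limit_set_nonempty)

text \<open>If the limit set split into two closed parts at distance \<open>d\<close>, a sequence with small steps
  could go from one part to the other only through the shell of points whose distance
  to the first part lies between \<open>d / 3\<close> and \<open>2 * d / 3\<close>. That shell contains no limit point, so the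
  sequence enters it finitely often and ends up near one part for ever.\<close>

lemma limit_set_connected:
  assumes slow: "(\<lambda>n. w (Suc n) - w n) \<longlonglongrightarrow> 0"
  shows "connected (limit_set w)"
  unfolding connected_closed_set[OF limit_set_closed]
proof
  assume "\<exists>A B. closed A \<and> closed B \<and> A \<noteq> {} \<and> B \<noteq> {} \<and> A \<union> B = limit_set w \<and> A \<inter> B = {}"
  then obtain A B where AB: "closed A" "closed B" "A \<noteq> {}" "B \<noteq> {}" "A \<union> B = limit_set w" "A \<inter> B = {}"
    by blast
  have "compact A" using AB limit_set_compact
    by (metis Un_upper1 compact_Int_closed inf.absorb_iff2 inf_commute)
  then obtain d where d: "0 < d" "\<And>x y. x \<in> A \<Longrightarrow> y \<in> B \<Longrightarrow> d \<le> dist x y"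
    using separate_compact_closed[of A B] AB by blast
  let ?f = "\<lambda>x. infdist x A"
  let ?C = "{x. d / 3 \<le> ?f x} \<inter> {x. ?f x \<le> 2 * d / 3}"
  have farB: "d \<le> ?f y" if "y \<in> B" for y
    using d(2) that AB(3) unfolding infdist_def by (auto intro!: cINF_greatest simp: dist_commute)
  have f_lip: "?f x \<le> ?f y + dist x y" for x y by (rule infdist_triangle)
  have "closed ?C" by (intro closed_Int closed_Collect_le continuous_intros)
  moreover have "limit_set w \<inter> ?C = {}"
  proof -
    have "x \<notin> ?C" if "x \<in> A \<union> B" for x
      using that farB[of x] d(1) by auto
    then show ?thesis using AB(5) by blast
  qed
  ultimately obtain N1 where N1: "\<And>n. n \<ge> N1 \<Longrightarrow> w n \<notin> ?C"
    by (rule eventually_avoids) blast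
  obtain N2 where N2: "\<And>n. n \<ge> N2 \<Longrightarrow> dist (w (Suc n)) (w n) < d / 3"
    using slow d(1) unfolding lim_sequentially by (metis dist_norm diff_zero zero_less_divide_iff zero_less_numeral)
  obtain a where "a \<in> A" using AB by blast
  then have "a \<in> limit_set w" using AB by blast
  then obtain n0 where n0: "n0 \<ge> max N1 N2" "dist (w n0) a < d / 3"
    using d(1) unfolding limit_set_frequently by (metis zero_less_divide_iff zero_less_numeral)
  have near: "?f (w n) < d / 3" if "n \<ge> n0" for n
    using that
  proof (induction n rule: dec_induct)
    case base
    have "?f (w n0) \<le> dist (w n0) a" by (rule infdist_le[OF \<open>a \<in> A\<close>])
    then show ?case using n0 by simp
  next
    case (step n)
    have "?f (w (Suc n)) \<le> 2 * d / 3"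
      using f_lip[of "w (Suc n)" "w n"] step N2[of n] n0 by simp
    then show ?case using N1[of "Suc n"] step n0 by auto
  qed
  obtain b where b: "b \<in> B" using AB by blast
  then have "b \<in> limit_set w" using AB by blast
  then obtain n where n: "n \<ge> n0" "dist (w n) b < d / 3"
    using d(1) unfolding limit_set_frequently by (metis zero_less_divide_iff zero_less_numeral)
  then have "d < d / 3 + d / 3"
    using near[OF n(1)] farB[OF b] f_lip[of b "w n"] by (simp add: dist_commute)
  then show False using d(1) by simp
qed

end

section \<open>Perturbed Euler schemes\<close>

text \<open>The right-hand side of the hypothesis grows by a factor \<open>1 + c j \<le> exp (c j)\<close> at each index.\<close>

lemma discrete_gronwall:
  fixes a c :: "nat \<Rightarrow> real"
  assumes a: "\<And>j. n \<le> j \<Longrightarrow> j \<le> m \<Longrightarrow> a j \<le> \<delta> + (\<Sum>i=n..<j. c i * a i)"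
    and c: "\<And>i. 0 \<le> c i" and "0 \<le> \<delta>" and nm: "n \<le> m"
  shows "a m \<le> \<delta> * exp (\<Sum>i=n..<m. c i)"
proof -
  have "j \<le> m \<longrightarrow> \<delta> + (\<Sum>i=n..<j. c i * a i) \<le> \<delta> * exp (\<Sum>i=n..<j. c i)" if "n \<le> j" for j
    using that
  proof (induction j rule: dec_induct)
    case (step j)
    show ?case
    proof
      assume jm: "Suc j \<le> m"
      define S where "S = \<delta> * exp (\<Sum>i=n..<j. c i)"
      have IH: "\<delta> + (\<Sum>i=n..<j. c i * a i) \<le> S" using step jm by (simp add: S_def)
      then have "a j \<le> S" using a[of j] step jm by simp
      then have "c j * a j \<le> c j * S" by (intro mult_left_mono c)
      then have "\<delta> + (\<Sum>i=n..<Suc j. c i * a i) \<le> S * (1 + c j)"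
        using IH step by (simp add: algebra_simps)
      also have "\<dots> \<le> S * exp (c j)"
        using \<open>0 \<le> \<delta>\<close> by (intro mult_left_mono exp_ge_add_one_self) (simp add: S_def)
      also have "\<dots> = \<delta> * exp (\<Sum>i=n..<Suc j. c i)"
        using step by (simp add: S_def exp_add)
      finally show "\<delta> + (\<Sum>i=n..<Suc j. c i * a i) \<le> \<delta> * exp (\<Sum>i=n..<Suc j. c i)" .
    qed
  qed simp
  from this[OF nm] a[OF nm] show ?thesis by simp
qed

text \<open>Two perturbations with different smallness are separated: \<open>b\<close> tends to \<open>0\<close>, while \<open>e\<close> need not
  but has convergent weighted sums. Either contributes little over a bounded stretch of time.\<close>

locale perturbed_euler = lipschitz_field h L for h :: "'a::euclidean_space \<Rightarrow> 'a" and L +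
  fixes w b e :: "nat \<Rightarrow> 'a" and \<gamma> :: "nat \<Rightarrow> real"
  assumes step: "w (Suc k) = w k + \<gamma> k *\<^sub>R (h (w k) + b k + e k)"
    and \<gamma>_pos: "0 < \<gamma> k" and \<gamma>_diverges: "\<not> summable \<gamma>" and \<gamma>_square: "summable (\<lambda>k. (\<gamma> k)\<^sup>2)"
    and bias_vanishes: "b \<longlonglongrightarrow> 0" and noise_summable: "summable (\<lambda>k. \<gamma> k *\<^sub>R e k)"
    and bounded_orbit: "bounded (range w)"
begin

definition time :: "nat \<Rightarrow> real" where "time n = (\<Sum>k<n. \<gamma> k)"

lemma time_Suc: "time (Suc n) = time n + \<gamma> n"
  by (simp add: time_def)

lemma time_diff: "n \<le> m \<Longrightarrow> time m - time n = (\<Sum>k=n..<m. \<gamma> k)"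
  by (induction m rule: dec_induct) (simp_all add: time_Suc)

lemma time_mono: "n \<le> m \<Longrightarrow> time n \<le> time m"
  unfolding time_def using \<gamma>_pos by (intro sum_mono2) (auto simp: less_imp_le)

lemma time_unbounded: "\<exists>m. s \<le> time m"
proof (rule ccontr)
  assume "\<nexists>m. s \<le> time m"
  then have "sum \<gamma> {..<n} \<le> s" for n by (auto simp: time_def not_le less_imp_le)
  from this[of "Suc _"] have "sum \<gamma> {..n} \<le> s" for n
    by (simp only: lessThan_Suc_atMost)
  then have "summable \<gamma>"
    using \<gamma>_pos by (intro bounded_imp_summable[where B=s]) (auto simp: less_imp_le)
  with \<gamma>_diverges show False by contradiction
qed

lemma \<gamma>_null: "\<gamma> \<longlonglongrightarrow> 0"
  using summable_LIMSEQ_zero[OF \<gamma>_square] by (simp add: power_tendsto_0_iff)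

definition index_at :: "real \<Rightarrow> nat" where "index_at s = (LEAST m. s \<le> time m)"

lemma index_at: "s \<le> time (index_at s)"
  unfolding index_at_def using time_unbounded by (rule LeastI_ex)

lemma before_index_at: "m < index_at s \<Longrightarrow> time m < s"
  unfolding index_at_def using not_less_Least by fastforce

text \<open>A prescribed time is hit up to the last step, and the steps tend to \<open>0\<close>.\<close>

lemma index_at_overshoot:
  assumes "0 < s"
  shows "0 < index_at s" "time (index_at s) < s + \<gamma> (index_at s - 1)"
proof -
  show *: "0 < index_at s"
    using index_at[of s] assms by (intro gr0I) (simp add: time_def)
  then show "time (index_at s) < s + \<gamma> (index_at s - 1)"
    using before_index_at[of "index_at s - 1" s] time_Suc[of "index_at s - 1"] by simp
qed

lemma index_at_at_top: "filterlim index_at at_top at_top"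
  unfolding filterlim_at_top
proof
  fix N
  show "\<forall>\<^sub>F s in at_top. N \<le> index_at s"
    using eventually_gt_at_top[of "time N"]
  proof eventually_elim
    case (elim s)
    then have "time N < time (index_at s)" using index_at[of s] by simp
    then show ?case using time_mono[of "index_at s" N] by linarith
  qed
qed

lemma time_at_top: "filterlim time at_top sequentially"
  unfolding filterlim_at_top
proof
  fix s
  obtain m where "s \<le> time m" using time_unbounded by blast
  then show "\<forall>\<^sub>F n in sequentially. s \<le> time n"
    unfolding eventually_sequentially by (meson order_trans time_mono)
qed

lemma steps_vanish: "(\<lambda>k. w (Suc k) - w k) \<longlonglongrightarrow> 0"
proof -
  have "bounded (h ` closure (range w))"
    using bounded_orbit by (intro compact_imp_bounded compact_continuous_image continuous_field)
      (simp add: compact_closure)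
  then have "bounded (h ` range w)"
    by (rule bounded_subset) (auto intro: closure_subset[THEN subsetD])
  then obtain B where B: "\<And>k. norm (h (w k)) \<le> B"
    by (auto simp: bounded_iff)
  have "(\<lambda>k. \<gamma> k *\<^sub>R h (w k)) \<longlonglongrightarrow> 0"
  proof (rule Lim_null_comparison)
    show "\<forall>\<^sub>F k in sequentially. norm (\<gamma> k *\<^sub>R h (w k)) \<le> \<gamma> k * B"
      using B \<gamma>_pos by (auto intro!: always_eventually mult_left_mono simp: less_imp_le)
    show "(\<lambda>k. \<gamma> k * B) \<longlonglongrightarrow> 0" by (rule tendsto_mult_left_zero[OF \<gamma>_null])
  qed
  moreover have "(\<lambda>k. \<gamma> k *\<^sub>R b k) \<longlonglongrightarrow> 0 *\<^sub>R 0"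
    by (intro tendsto_intros \<gamma>_null bias_vanishes)
  moreover have "(\<lambda>k. \<gamma> k *\<^sub>R e k) \<longlonglongrightarrow> 0"
    by (rule summable_LIMSEQ_zero[OF noise_summable])
  ultimately have "(\<lambda>k. \<gamma> k *\<^sub>R h (w k) + \<gamma> k *\<^sub>R b k + \<gamma> k *\<^sub>R e k) \<longlonglongrightarrow> 0 + 0 *\<^sub>R 0 + 0"
    by (intro tendsto_add)
  then show ?thesis by (simp add: step scaleR_add_right)
qed

text \<open>The scheme is an asymptotic pseudotrajectory of the flow: restarted from a late iterate, the
  flow stays close to the scheme for the time \<open>T\<close>. The error has four sources, namely the Lipschitz
  growth of earlier errors, absorbed by Gronwall; the bias, at most \<open>T\<close> times its supremum from \<open>n\<close> on;
  the noise, a Cauchy tail; and the discretization, a tail of \<open>\<Sum>j. (\<gamma> j)\<^sup>2\<close>.\<close>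

lemma tracking_forward:
  assumes T: "0 < T" and \<epsilon>: "0 < \<epsilon>"
  shows "\<exists>N. \<forall>n\<ge>N. \<forall>m\<ge>n. time m - time n \<le> T \<longrightarrow>
           norm (w m - flow (time m - time n) (w n)) \<le> \<epsilon>"
proof -
  obtain R where R: "\<And>n. norm (w n) \<le> R"
    using bounded_orbit by (auto simp: bounded_iff)
  obtain K where K: "0 < K" "\<And>(x::'a) t. norm x \<le> R \<Longrightarrow> \<bar>t\<bar> \<le> T \<Longrightarrow> norm (h (flow t x)) \<le> K"
    using flow_bounded by blast
  define \<delta> where "\<delta> = \<epsilon> / exp (L * T)"
  have \<delta>: "0 < \<delta>" using \<epsilon> by (simp add: \<delta>_def)
  obtain N1 where N1: "\<And>n m. n \<ge> N1 \<Longrightarrow> norm (\<Sum>j=n..<m. \<gamma> j *\<^sub>R e j) < \<delta> / 3"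
    using noise_summable \<delta> unfolding summable_Cauchy by (metis zero_less_divide_iff zero_less_numeral)
  obtain N2 where N2: "\<And>n. n \<ge> N2 \<Longrightarrow> norm (b n) < \<delta> / (3 * T)"
    using bias_vanishes \<delta> T unfolding LIMSEQ_iff by (metis diff_zero zero_less_divide_iff zero_less_mult_iff zero_less_numeral)
  obtain N3 where N3: "\<And>n m. n \<ge> N3 \<Longrightarrow> norm (\<Sum>j=n..<m. (\<gamma> j)\<^sup>2) < \<delta> / (3 * (L * K))"
    using \<gamma>_square \<delta> K L_pos unfolding summable_Cauchy by (metis zero_less_divide_iff zero_less_mult_iff zero_less_numeral)
  show ?thesis
  proof (intro exI[of _ "max N1 (max N2 N3)"] allI impI)
    fix n m assume n: "n \<ge> max N1 (max N2 N3)" and nm: "n \<le> m" and tT: "time m - time n \<le> T"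
    define z where "z j = flow (time j - time n) (w n)" for j
    define r where "r j = z (Suc j) - z j - \<gamma> j *\<^sub>R h (z j)" for j
    have r: "norm (r j) \<le> L * K * (\<gamma> j)\<^sup>2" if j: "n \<le> j" "j < m" for j
    proof -
      have "norm (flow ((time j - time n) + \<gamma> j) (w n) - flow (time j - time n) (w n)
              - \<gamma> j *\<^sub>R h (flow (time j - time n) (w n))) \<le> L * K * (\<gamma> j)\<^sup>2"
      proof (rule flow_euler_step)
        fix s assume s: "s \<in> {time j - time n..time j - time n + \<gamma> j}"
        have "time (Suc j) \<le> time m" "time n \<le> time j" using j by (auto intro!: time_mono)
        then have "\<bar>s\<bar> \<le> T" using s tT by (auto simp: time_Suc)
        then show "norm (h (flow s (w n))) \<le> K" using K(2) R by blast
      qed (simp add: \<gamma>_pos less_imp_le)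
      then show ?thesis by (simp add: r_def z_def time_Suc algebra_simps)
    qed
    define a where "a j = norm (w j - z j)" for j
    have "a j \<le> \<delta> + (\<Sum>i=n..<j. (L * \<gamma> i) * a i)" if j: "n \<le> j" "j \<le> m" for j
    proof -
      have "w j - z j = (w j - z j) - (w n - z n)" by (simp add: z_def)
      also have "\<dots> = (\<Sum>i=n..<j. (w (Suc i) - z (Suc i)) - (w i - z i))"
        by (rule sum_Suc_diff'[OF j(1), symmetric])
      also have "\<dots> = (\<Sum>i=n..<j. \<gamma> i *\<^sub>R (h (w i) - h (z i)) + \<gamma> i *\<^sub>R b i + \<gamma> i *\<^sub>R e i - r i)"
        by (rule sum.cong) (auto simp: step r_def algebra_simps)
      also have "\<dots> = (\<Sum>i=n..<j. \<gamma> i *\<^sub>R (h (w i) - h (z i))) + (\<Sum>i=n..<j. \<gamma> i *\<^sub>R b i)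
          + (\<Sum>i=n..<j. \<gamma> i *\<^sub>R e i) - (\<Sum>i=n..<j. r i)"
        by (simp add: sum.distrib sum_subtractf)
      finally have split: "a j \<le> norm (\<Sum>i=n..<j. \<gamma> i *\<^sub>R (h (w i) - h (z i)))
          + norm (\<Sum>i=n..<j. \<gamma> i *\<^sub>R b i) + norm (\<Sum>i=n..<j. \<gamma> i *\<^sub>R e i) + norm (\<Sum>i=n..<j. r i)"
        unfolding a_def by (smt (verit) norm_triangle_ineq norm_triangle_ineq4)
      have "norm (\<Sum>i=n..<j. \<gamma> i *\<^sub>R (h (w i) - h (z i))) \<le> (\<Sum>i=n..<j. (L * \<gamma> i) * a i)"
      proof (rule sum_norm_le)
        fix i
        have "\<gamma> i * norm (h (w i) - h (z i)) \<le> \<gamma> i * (L * norm (w i - z i))"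
          by (intro mult_left_mono lipschitz) (simp add: \<gamma>_pos less_imp_le)
        then show "norm (\<gamma> i *\<^sub>R (h (w i) - h (z i))) \<le> (L * \<gamma> i) * a i"
          using \<gamma>_pos[of i] by (simp add: a_def mult_ac)
      qed
      moreover have "norm (\<Sum>i=n..<j. \<gamma> i *\<^sub>R b i) \<le> \<delta> / 3"
      proof -
        have "norm (\<Sum>i=n..<j. \<gamma> i *\<^sub>R b i) \<le> (\<Sum>i=n..<j. \<gamma> i * (\<delta> / (3 * T)))"
        proof (rule sum_norm_le)
          fix i assume "i \<in> {n..<j}"
          then show "norm (\<gamma> i *\<^sub>R b i) \<le> \<gamma> i * (\<delta> / (3 * T))"
            using N2[of i] n \<gamma>_pos[of i] mult_left_mono[of "norm (b i)" "\<delta> / (3 * T)" "\<gamma> i"] by auto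
        qed
        also have "\<dots> = (time j - time n) * (\<delta> / (3 * T))"
          by (simp only: time_diff[OF j(1)] sum_distrib_right)
        also have "\<dots> \<le> T * (\<delta> / (3 * T))"
          using time_mono[OF j(2)] tT T \<delta> by (intro mult_right_mono) auto
        finally show ?thesis using T by simp
      qed
      moreover have "norm (\<Sum>i=n..<j. \<gamma> i *\<^sub>R e i) \<le> \<delta> / 3"
        using N1[of n j] n by simp
      moreover have "norm (\<Sum>i=n..<j. r i) \<le> \<delta> / 3"
      proof -
        have "norm (\<Sum>i=n..<j. r i) \<le> (\<Sum>i=n..<j. L * K * (\<gamma> i)\<^sup>2)"
          using r j by (intro sum_norm_le) auto
        also have "\<dots> = L * K * (\<Sum>i=n..<j. (\<gamma> i)\<^sup>2)" by (simp add: sum_distrib_left)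
        also have "\<dots> \<le> L * K * (\<delta> / (3 * (L * K)))"
          using N3[of n j] n K L_pos by (intro mult_left_mono) auto
        finally show ?thesis using K L_pos by simp
      qed
      ultimately show ?thesis using split by simp
    qed
    then have "a m \<le> \<delta> * exp (\<Sum>i=n..<m. L * \<gamma> i)"
      using \<delta> L_pos \<gamma>_pos nm by (intro discrete_gronwall) (auto simp: less_imp_le)
    also have "(\<Sum>i=n..<m. L * \<gamma> i) = L * (time m - time n)"
      by (simp add: time_diff[OF nm] sum_distrib_left)
    also have "\<delta> * exp (L * (time m - time n)) \<le> \<delta> * exp (L * T)"
      using \<delta> tT L_pos by simp
    also have "\<dots> = \<epsilon>" by (simp add: \<delta>_def)
    finally show "norm (w m - flow (time m - time n) (w n)) \<le> \<epsilon>"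
      by (simp add: a_def z_def)
  qed
qed

text \<open>Running the flow backwards is also Lipschitz, so the tracking extends to negative times. This gives
  invariance of the limit set under the flow in both directions with a single argument.\<close>

lemma tracking:
  assumes T: "0 < T" and \<epsilon>: "0 < \<epsilon>"
  shows "\<exists>N. \<forall>n\<ge>N. \<forall>m\<ge>N. \<bar>time m - time n\<bar> \<le> T \<longrightarrow>
           norm (w m - flow (time m - time n) (w n)) \<le> \<epsilon>"
proof -
  define \<eta> where "\<eta> = \<epsilon> / exp (L * T)"
  have \<eta>: "0 < \<eta>" "\<eta> \<le> \<epsilon>"
    using \<epsilon> T L_pos by (auto simp: \<eta>_def divide_le_eq)
  obtain N where N: "\<And>n m. n \<ge> N \<Longrightarrow> m \<ge> n \<Longrightarrow> time m - time n \<le> T \<Longrightarrow>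
      norm (w m - flow (time m - time n) (w n)) \<le> \<eta>"
    using tracking_forward[OF T \<eta>(1)] by blast
  show ?thesis
  proof (intro exI[of _ N] allI impI)
    fix n m assume nm: "n \<ge> N" "m \<ge> N" and tT: "\<bar>time m - time n\<bar> \<le> T"
    show "norm (w m - flow (time m - time n) (w n)) \<le> \<epsilon>"
    proof (cases "n \<le> m")
      case True
      then show ?thesis using N[of n m] nm tT \<eta> by (simp add: abs_le_iff)
    next
      case False
      let ?s = "time n - time m"
      have "flow (- ?s) (flow ?s (w m)) = w m"
        using flow_add[of "- ?s" ?s "w m"] by simp
      then have "norm (w m - flow (time m - time n) (w n))
          = norm (flow (- ?s) (flow ?s (w m)) - flow (- ?s) (w n))" by simp
      also have "\<dots> \<le> exp (L * \<bar>- ?s\<bar>) * norm (flow ?s (w m) - w n)" by (rule flow_lipschitz)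
      also have "\<dots> \<le> exp (L * T) * \<eta>"
        using N[of m n] False nm tT L_pos by (intro mult_mono) (auto simp: norm_minus_commute)
      also have "\<dots> = \<epsilon>" by (simp add: \<eta>_def)
      finally show ?thesis .
    qed
  qed
qed

text \<open>If \<open>w (r i)\<close> tends to \<open>p\<close>, then the iterates at the times \<open>time (r i) + T\<close> tend to \<open>flow T p\<close>.\<close>

lemma limit_set_invariant: "flow_invariant flow (limit_set w)"
  unfolding flow_invariant_def
proof (intro allI subsetI, elim imageE, hypsubst)
  fix T p assume "p \<in> limit_set w"
  then obtain r where r: "strict_mono r" "(\<lambda>i. w (r i)) \<longlonglongrightarrow> p"
    by (auto simp: limit_set_def o_def)
  define s where "s i = time (r i) + T" for i
  define m where "m i = index_at (s i)" for i
  have r_top: "filterlim r at_top sequentially" by (rule filterlim_subseq[OF r(1)])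
  have s_top: "filterlim s at_top sequentially"
    unfolding s_def
    using filterlim_tendsto_add_at_top[OF tendsto_const[of T] filterlim_compose[OF time_at_top r_top]]
    by (simp add: add.commute)
  have m_top: "filterlim m at_top sequentially"
    unfolding m_def by (rule filterlim_compose[OF index_at_at_top s_top])
  have "filterlim (\<lambda>i. m i - 1) at_top sequentially"
    using filterlim_compose[OF filterlim_minus_const_nat_at_top m_top] .
  then have g0: "(\<lambda>i. \<gamma> (m i - 1)) \<longlonglongrightarrow> 0"
    using filterlim_compose[OF \<gamma>_null] by blast
  have over: "\<forall>\<^sub>F i in sequentially. norm (time (m i) - time (r i) - T) \<le> \<gamma> (m i - 1)"
    using filterlim_at_top_dense[THEN iffD1, OF s_top, rule_format, of 0]
  proof eventually_elim
    case (elim i)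
    then show ?case
      using index_at[of "s i"] index_at_overshoot[of "s i"] by (auto simp: m_def s_def)
  qed
  have "(\<lambda>i. time (m i) - time (r i) - T) \<longlonglongrightarrow> 0"
    by (rule Lim_null_comparison[OF over g0])
  then have dt: "(\<lambda>i. time (m i) - time (r i)) \<longlonglongrightarrow> T"
    by (simp add: LIM_zero_iff)
  have "(\<lambda>i. w (m i) - flow (time (m i) - time (r i)) (w (r i))) \<longlonglongrightarrow> 0"
    unfolding tendsto_iff
  proof (intro allI impI)
    fix \<epsilon> :: real assume "0 < \<epsilon>"
    then obtain N where N: "\<And>n m. n \<ge> N \<Longrightarrow> m \<ge> N \<Longrightarrow> \<bar>time m - time n\<bar> \<le> \<bar>T\<bar> + 1 \<Longrightarrow>
        norm (w m - flow (time m - time n) (w n)) \<le> \<epsilon> / 2"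
      using tracking[of "\<bar>T\<bar> + 1" "\<epsilon> / 2"] by (metis abs_add_one_gt_zero add.commute half_gt_zero)
    have "\<forall>\<^sub>F i in sequentially. dist (time (m i) - time (r i)) T < 1"
      by (rule tendstoD[OF dt]) simp
    moreover have "\<forall>\<^sub>F i in sequentially. N \<le> m i" "\<forall>\<^sub>F i in sequentially. N \<le> r i"
      using m_top r_top by (auto simp: filterlim_at_top)
    ultimately show "\<forall>\<^sub>F i in sequentially. dist (w (m i) - flow (time (m i) - time (r i)) (w (r i))) 0 < \<epsilon>"
    proof eventually_elim
      case (elim i)
      then have "\<bar>time (m i) - time (r i)\<bar> \<le> \<bar>T\<bar> + 1" by (auto simp: dist_real_def)
      with N[of "r i" "m i"] elim \<open>0 < \<epsilon>\<close> show ?case by simp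
    qed
  qed
  from tendsto_add[OF this flow_tendsto[OF r(2) dt]]
  have "(\<lambda>i. w (m i)) \<longlonglongrightarrow> flow T p" by simp
  then show "flow T p \<in> limit_set w" by (rule limit_set_filterlimI[OF m_top])
qed

lemma pseudo_orbit_Cons:
  assumes po: "pseudo_orbit \<Phi> \<Lambda> \<delta> T y' q N y t" "y 0 = y'" and x: "x \<in> \<Lambda>" and s: "T \<le> s"
    and jump: "norm (\<Phi> s x - y') \<le> \<delta>" and \<delta>: "0 < \<delta>"
  shows "pseudo_orbit \<Phi> \<Lambda> \<delta> T x q (Suc N) (case_nat x y) (case_nat s t)"
  using assms unfolding pseudo_orbit_def
  by (auto split: nat.split simp: less_Suc_eq_0_disj)

text \<open>A pseudo-orbit follows the sequence: it jumps to points of the limit set that are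
  \<open>\<eta>\<close>-close to the iterates at times at least \<open>T\<close> and at most \<open>2 * T + 1\<close> apart. The
  upper bound keeps the flow Lipschitz with a constant that does not depend on the number of jumps.\<close>

lemma pseudo_orbit_along:
  assumes T: "0 < T" and \<delta>: "0 < \<delta>" and \<eta>: "0 < \<eta>" "exp (L * (2 * T + 1)) * \<eta> + \<eta> + \<eta> \<le> \<delta>"
    and track: "\<And>n m. N \<le> n \<Longrightarrow> n \<le> m \<Longrightarrow> time m - time n \<le> 2 * T + 1 \<Longrightarrow>
      norm (w m - flow (time m - time n) (w n)) \<le> \<eta>"
    and near: "\<And>n. N \<le> n \<Longrightarrow> \<exists>y\<in>limit_set w. norm (w n - y) \<le> \<eta>"
    and \<gamma>1: "\<And>n. N \<le> n \<Longrightarrow> \<gamma> n \<le> 1"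
    and q: "q \<in> limit_set w" "norm (w m - q) \<le> \<eta>"
    and n: "N \<le> n" "n \<le> m" "T \<le> time m - time n" and x: "x \<in> limit_set w" "norm (w n - x) \<le> \<eta>"
  shows "\<exists>K y t. y 0 = x \<and> y K = q \<and> pseudo_orbit flow (limit_set w) \<delta> T x q K y t"
  using n x
proof (induction "m - n" arbitrary: n x rule: less_induct)
  case less
  have jump: "norm (flow (time k - time n) x - y) \<le> \<delta>"
    if "n \<le> k" "time k - time n \<le> 2 * T + 1" "norm (w k - y) \<le> \<eta>" for k y
  proof -
    let ?s = "time k - time n"
    have "norm (flow ?s x - y) \<le> norm (flow ?s x - flow ?s (w n)) + norm (flow ?s (w n) - w k) + norm (w k - y)"
      using norm_triangle_ineq[of "flow ?s x - flow ?s (w n)" "flow ?s (w n) - w k"]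
        norm_triangle_ineq[of "flow ?s x - w k" "w k - y"] by simp
    also have "norm (flow ?s x - flow ?s (w n)) \<le> exp (L * \<bar>?s\<bar>) * norm (x - w n)" by (rule flow_lipschitz)
    also have "\<dots> \<le> exp (L * (2 * T + 1)) * \<eta>"
      using that time_mono[of n k] L_pos less.prems by (intro mult_mono) (auto simp: norm_minus_commute)
    also have "norm (flow ?s (w n) - w k) \<le> \<eta>"
      using track[of n k] less.prems that by (simp add: norm_minus_commute)
    finally show ?thesis using that \<eta> by linarith
  qed
  show ?case
  proof (cases "time m - time n \<le> 2 * T + 1")
    case True
    define y where "y = (\<lambda>j::nat. if j = 0 then x else q)"
    have "pseudo_orbit flow (limit_set w) \<delta> T x q 1 y (\<lambda>_. time m - time n)"
      using less.prems q \<delta> jump[of m q] True unfolding pseudo_orbit_def y_def by auto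
    then show ?thesis by (intro exI[of _ 1] exI[of _ y]) (auto simp: y_def)
  next
    case False
    define k where "k = index_at (time n + T)"
    have k1: "time n + T \<le> time k" unfolding k_def by (rule index_at)
    have nk: "n < k" using k1 T time_mono[of k n] by linarith
    have "time (k - 1) < time n + T"
      using before_index_at[of "k - 1" "time n + T"] nk by (simp add: k_def)
    moreover have "time k = time (k - 1) + \<gamma> (k - 1)" using time_Suc[of "k - 1"] nk by simp
    moreover have "\<gamma> (k - 1) \<le> 1" using \<gamma>1[of "k - 1"] nk less.prems by simp
    ultimately have k2: "time k \<le> time n + T + 1" by simp
    have km: "k \<le> m" using k2 False T time_mono[of m k] by linarith
    obtain x' where x': "x' \<in> limit_set w" "norm (w k - x') \<le> \<eta>"
      using near[of k] nk less.prems by auto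
    have "\<exists>K y t. y 0 = x' \<and> y K = q \<and> pseudo_orbit flow (limit_set w) \<delta> T x' q K y t"
    proof (rule less.hyps)
      show "T \<le> time m - time k" using k2 False by linarith
    qed (use nk km less.prems x' in auto)
    then obtain K y t where y: "y 0 = x'" "y K = q" "pseudo_orbit flow (limit_set w) \<delta> T x' q K y t"
      by blast
    have "pseudo_orbit flow (limit_set w) \<delta> T x q (Suc K) (case_nat x y) (case_nat (time k - time n) t)"
      using pseudo_orbit_Cons[OF y(3,1) less.prems(4) _ jump[of k x'] \<delta>] k1 k2 T nk x' by simp
    with y(2) show ?thesis
      by (intro exI[of _ "Suc K"] exI[of _ "case_nat x y"] exI conjI) auto
  qed
qed

text \<open>The sequence comes close to \<open>p\<close> infinitely often. Two such visits, late and at least \<open>T\<close> apart,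
  are the ends of the pseudo-orbit.\<close>

lemma limit_set_chain_recurrent:
  assumes p: "p \<in> limit_set w"
  shows "chain_recurrent_on flow (limit_set w) p"
  unfolding chain_recurrent_on_def
proof (intro allI impI)
  fix \<delta> T :: real assume \<delta>: "0 < \<delta>" and T: "0 < T"
  define \<eta> where "\<eta> = \<delta> / (exp (L * (2 * T + 1)) + 2)"
  have E: "0 < exp (L * (2 * T + 1)) + 2" by (simp add: add_pos_pos)
  have \<eta>: "0 < \<eta>" "exp (L * (2 * T + 1)) * \<eta> + \<eta> + \<eta> \<le> \<delta>"
  proof -
    show "0 < \<eta>" using \<delta> E by (simp add: \<eta>_def)
    have "(exp (L * (2 * T + 1)) + 2) * \<eta> = \<delta>" using E by (simp add: \<eta>_def)
    then show "exp (L * (2 * T + 1)) * \<eta> + \<eta> + \<eta> \<le> \<delta>" by (simp add: algebra_simps)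
  qed
  obtain N1 where N1: "\<And>n m. n \<ge> N1 \<Longrightarrow> m \<ge> n \<Longrightarrow> time m - time n \<le> 2 * T + 1 \<Longrightarrow>
      norm (w m - flow (time m - time n) (w n)) \<le> \<eta>"
    using tracking_forward[of "2 * T + 1" \<eta>] T \<eta> by auto
  obtain N2 where N2: "\<And>n. n \<ge> N2 \<Longrightarrow> infdist (w n) (limit_set w) < \<eta>"
    using limit_set_attracts[OF bounded_orbit] \<eta>(1) unfolding converges_to_set_def lim_sequentially
    by (auto simp: dist_real_def infdist_nonneg)
  obtain N3 where N3: "\<And>n. n \<ge> N3 \<Longrightarrow> \<gamma> n < 1"
    using order_tendstoD(2)[OF \<gamma>_null, of 1] by (auto simp: eventually_sequentially)
  have near: "\<exists>y\<in>limit_set w. norm (w n - y) \<le> \<eta>" if "n \<ge> N2" for n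
    using infdist_attains_inf[OF limit_set_closed limit_set_nonempty[OF bounded_orbit], of "w n"] N2[OF that]
    by (metis dist_norm less_imp_le)
  define N where "N = max N1 (max N2 N3)"
  obtain n where n: "n \<ge> N" "norm (w n - p) < \<eta>"
    using p \<eta>(1) unfolding limit_set_frequently dist_norm by blast
  obtain M where M: "time n + T \<le> time M" using time_unbounded by blast
  obtain m where m: "m \<ge> max n M" "norm (w m - p) < \<eta>"
    using p \<eta>(1) unfolding limit_set_frequently dist_norm by blast
  have "T \<le> time m - time n" using M m time_mono[of M m] by simp
  then have "\<exists>K y t. y 0 = p \<and> y K = p \<and> pseudo_orbit flow (limit_set w) \<delta> T p p K y t"
    using T \<delta> \<eta> p n m near N1 N3
    by (intro pseudo_orbit_along[of T \<delta> \<eta> N p m n p]) (auto simp: N_def less_imp_le)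
  then show "\<exists>N y t. pseudo_orbit flow (limit_set w) \<delta> T p p N y t" by blast
qed

theorem limit_set_internally_chain_recurrent: "internally_chain_recurrent flow (limit_set w)"
  unfolding internally_chain_recurrent_def
  using limit_set_nonempty[OF bounded_orbit] limit_set_compact[OF bounded_orbit]
    limit_set_invariant limit_set_chain_recurrent by blast

theorem connected_limit_set: "connected (limit_set w)"
  by (rule limit_set_connected[OF bounded_orbit steps_vanish])

end

text \<open>Along an orbit inside the limit set a convergent \<open>V (w k)\<close> forces \<open>V\<close> to be constant, so the
  derivative of \<open>V\<close> along the flow vanishes there.\<close>

lemma (in perturbed_euler) limit_set_stationary:
  assumes V: "\<And>v. GDERIV V v :> gradV v" and conv: "(\<lambda>k. V (w k)) \<longlonglongrightarrow> c" and p: "p \<in> limit_set w"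
  shows "gradV p \<bullet> h p = 0"
proof -
  have Vc: "V q = c" if q: "q \<in> limit_set w" for q
  proof -
    obtain r where r: "strict_mono r" "(\<lambda>i. w (r i)) \<longlonglongrightarrow> q"
      using q by (auto simp: limit_set_def o_def)
    have "isCont V q" using V[of q] unfolding gderiv_def by (rule has_derivative_continuous)
    then have "(\<lambda>i. V (w (r i))) \<longlonglongrightarrow> V q" using r(2) by (rule isCont_tendsto_compose)
    moreover have "(\<lambda>i. V (w (r i))) \<longlonglongrightarrow> c"
      using LIMSEQ_subseq_LIMSEQ[OF conv r(1)] by (simp add: o_def)
    ultimately show ?thesis by (rule LIMSEQ_unique)
  qed
  have const: "(\<lambda>t. V (flow t p)) = (\<lambda>_. c)"
    using limit_set_invariant p Vc unfolding flow_invariant_def by (intro ext) blast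
  have "((\<lambda>t. flow t p) has_derivative (\<lambda>t. t *\<^sub>R h p)) (at 0)"
    using flow_derivative[of p 0] by (simp add: has_vector_derivative_def)
  moreover have "(V has_derivative (\<lambda>v. v \<bullet> gradV p)) (at (flow 0 p))"
    using V[of p] by (simp add: gderiv_def)
  ultimately have "((\<lambda>t. V (flow t p)) has_derivative (\<lambda>t. (t *\<^sub>R h p) \<bullet> gradV p)) (at 0)"
    by (rule has_derivative_compose)
  then have "((\<lambda>_::real. c) has_derivative (\<lambda>t. (t *\<^sub>R h p) \<bullet> gradV p)) (at 0)" by (simp add: const)
  then have "(\<lambda>t. (t *\<^sub>R h p) \<bullet> gradV p) = (\<lambda>t. 0)"
    by (rule has_derivative_unique) (rule has_derivative_const)
  from fun_cong[OF this, of 1] show ?thesis by (simp add: inner_commute)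
qed

section \<open>Maximal inequality and square-integrable martingales\<close>

locale filtered_prob_space = prob_space M for M :: "'a measure" +
  fixes F :: "nat \<Rightarrow> 'a measure"
  assumes subalg: "subalgebra M (F k)" and subalg_Suc: "subalgebra (F (Suc k)) (F k)"
begin

lemma subalg_mono: "j \<le> k \<Longrightarrow> subalgebra (F k) (F j)"
proof (induction k rule: dec_induct)
  case base then show ?case by (simp add: subalgebra_def)
next
  case (step k) then show ?case using subalg_Suc[of k] by (auto simp: subalgebra_def)
qed

lemma space_F [simp]: "space (F k) = space M"
  using subalg[of k] by (simp add: subalgebra_def)

lemma sets_F: "A \<in> sets (F k) \<Longrightarrow> A \<in> sets M"
  using subalg[of k] by (auto simp: subalgebra_def)

lemma sets_F_mono: "A \<in> sets (F j) \<Longrightarrow> j \<le> k \<Longrightarrow> A \<in> sets (F k)"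
  using subalg_mono[of j k] by (auto simp: subalgebra_def)

lemma measurable_F: "f \<in> measurable (F k) N \<Longrightarrow> f \<in> measurable M N"
  by (rule measurable_from_subalg[OF subalg])

lemma measurable_F_mono: "f \<in> measurable (F j) N \<Longrightarrow> j \<le> k \<Longrightarrow> f \<in> measurable (F k) N"
  by (rule measurable_from_subalg[OF subalg_mono])

sublocale cond: sigma_finite_subalgebra M "F k" for k
proof -
  interpret finite_measure_subalgebra M "F k"
    by unfold_locales (rule subalg)
  show "sigma_finite_subalgebra M (F k)" by unfold_locales
qed

text \<open>Samples that drop out from \<open>G\<close> to \<open>G'\<close> take mass at least \<open>R\<close> per unit of probability with them.\<close>

lemma stopped_integral_le:
  fixes Z :: "'a \<Rightarrow> ennreal"
  assumes [measurable]: "G \<in> sets M" "G' \<in> sets M" "Z \<in> borel_measurable M"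
    and sub: "G' \<subseteq> G" and R: "\<And>\<omega>. \<omega> \<in> G - G' \<Longrightarrow> R \<le> Z \<omega>"
  shows "R * emeasure M (G - G') + (\<integral>\<^sup>+\<omega>. Z \<omega> * indicator G' \<omega> \<partial>M) \<le> (\<integral>\<^sup>+\<omega>. Z \<omega> * indicator G \<omega> \<partial>M)"
proof -
  have "R * emeasure M (G - G') + (\<integral>\<^sup>+\<omega>. Z \<omega> * indicator G' \<omega> \<partial>M)
      = (\<integral>\<^sup>+\<omega>. R * indicator (G - G') \<omega> + Z \<omega> * indicator G' \<omega> \<partial>M)"
    by (subst nn_integral_add) (auto simp: nn_integral_cmult_indicator)
  also have "\<dots> \<le> (\<integral>\<^sup>+\<omega>. Z \<omega> * indicator G \<omega> \<partial>M)"
    using sub R by (intro nn_integral_mono) (auto split: split_indicator)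
  finally show ?thesis .
qed

text \<open>The event of not yet having reached \<open>R\<close> is known at each index, so the drift bound applies on it,
  and each crossing of the level takes away mass \<open>R\<close>. The hypothesis speaks of integrals over events of
  \<open>F k\<close> instead of conditional expectations; this covers nonnegative \<open>Z\<close> that are not integrable. With
  \<open>Z\<close> the Lyapunov function it gives stability, with \<open>Z\<close> the square of a martingale it gives convergence.\<close>

proposition maximal_inequality:
  fixes Z :: "nat \<Rightarrow> 'a \<Rightarrow> ennreal" and a :: "nat \<Rightarrow> ennreal"
  assumes Z: "\<And>k. m \<le> k \<Longrightarrow> Z k \<in> borel_measurable (F k)" and B: "B \<in> sets (F m)"
    and drift: "\<And>k A. m \<le> k \<Longrightarrow> A \<in> sets (F k) \<Longrightarrow> A \<subseteq> B \<Longrightarrow>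
      (\<integral>\<^sup>+\<omega>. Z (Suc k) \<omega> * indicator A \<omega> \<partial>M) \<le> (\<integral>\<^sup>+\<omega>. Z k \<omega> * indicator A \<omega> \<partial>M) + a k"
  shows "R * emeasure M {\<omega>\<in>B. \<exists>k\<ge>m. R \<le> Z k \<omega>}
           \<le> (\<integral>\<^sup>+\<omega>. Z m \<omega> * indicator B \<omega> \<partial>M) + (\<Sum>k. a (k + m))"
proof -
  define G where "G n = {\<omega>\<in>B. \<forall>k\<in>{m..n}. Z k \<omega> < R}" for n
  have BM: "B \<in> sets M" using sets_F[OF B] .
  have G_F: "G n \<in> sets (F n)" if "m \<le> n" for n
  proof -
    have 1: "{\<omega>\<in>space (F n). Z k \<omega> < R} \<in> sets (F n)" if "k \<in> {m..n}" for k
    proof -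
      have [measurable]: "Z k \<in> borel_measurable (F n)"
        using that by (intro measurable_F_mono[OF Z]) auto
      show ?thesis by measurable
    qed
    have 2: "G n = B \<inter> (\<Inter>k\<in>{m..n}. {\<omega>\<in>space (F n). Z k \<omega> < R})"
      using sets.sets_into_space[OF BM] that by (auto simp: G_def)
    show ?thesis
      unfolding 2 using that by (intro sets.Int sets.finite_INT sets_F_mono[OF B that] 1) auto
  qed
  have G_M: "G n \<in> sets M" if "m \<le> n" for n using sets_F[OF G_F[OF that]] .
  have ZM: "Z k \<in> borel_measurable M" if "m \<le> k" for k using measurable_F[OF Z[OF that]] .
  define I where "I n = (\<integral>\<^sup>+\<omega>. Z n \<omega> * indicator (G n) \<omega> \<partial>M)" for n
  define I0 where "I0 = (\<integral>\<^sup>+\<omega>. Z m \<omega> * indicator B \<omega> \<partial>M)"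
  have main: "R * emeasure M (B - G n) + I n \<le> I0 + (\<Sum>k=m..<n. a k)" if "m \<le> n" for n
    using that
  proof (induction n rule: dec_induct)
    case base
    show ?case unfolding I_def I0_def
      using stopped_integral_le[OF BM G_M[of m] ZM[of m], of R] by (auto simp: G_def not_less)
  next
    case (step n)
    have "B - G (Suc n) = (B - G n) \<union> (G n - G (Suc n))" "(B - G n) \<inter> (G n - G (Suc n)) = {}"
      by (auto simp: G_def)
    then have "emeasure M (B - G (Suc n)) = emeasure M (B - G n) + emeasure M (G n - G (Suc n))"
      using plus_emeasure[of "B - G n" M "G n - G (Suc n)"] BM G_M step by auto
    then have "R * emeasure M (B - G (Suc n)) + I (Suc n)
        = R * emeasure M (B - G n) + (R * emeasure M (G n - G (Suc n)) + I (Suc n))"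
      by (simp add: distrib_left add.assoc)
    also have "R * emeasure M (G n - G (Suc n)) + I (Suc n) \<le> (\<integral>\<^sup>+\<omega>. Z (Suc n) \<omega> * indicator (G n) \<omega> \<partial>M)"
      unfolding I_def using step
      by (intro stopped_integral_le G_M ZM) (auto simp: G_def not_less atLeastAtMostSuc_conv)
    also have "\<dots> \<le> I n + a n"
      unfolding I_def using step by (intro drift G_F) (auto simp: G_def)
    also have "R * emeasure M (B - G n) + (I n + a n) \<le> (I0 + (\<Sum>k=m..<n. a k)) + a n"
      using add_right_mono[OF step.IH, of "a n"] by (simp add: add.assoc)
    also have "\<dots> = I0 + (\<Sum>k=m..<Suc n. a k)" using step by (simp add: add.assoc)
    finally show ?case by (simp add: add_left_mono)
  qed
  have "(SUP n. emeasure M (B - G (n + m))) = emeasure M (\<Union>n. B - G (n + m))"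
    using BM G_M by (intro SUP_emeasure_incseq) (auto simp: incseq_def G_def)
  also have "(\<Union>n. B - G (n + m)) = {\<omega>\<in>B. \<exists>k\<ge>m. R \<le> Z k \<omega>}"
  proof (intro set_eqI iffI)
    fix \<omega> assume "\<omega> \<in> {\<omega>\<in>B. \<exists>k\<ge>m. R \<le> Z k \<omega>}"
    then obtain k where "\<omega> \<in> B" "m \<le> k" "R \<le> Z k \<omega>" by blast
    then have "\<omega> \<in> B - G ((k - m) + m)" by (auto simp: G_def not_less intro!: bexI[of _ k])
    then show "\<omega> \<in> (\<Union>n. B - G (n + m))" by blast
  qed (auto simp: G_def not_less)
  finally have "R * emeasure M {\<omega>\<in>B. \<exists>k\<ge>m. R \<le> Z k \<omega>} = (SUP n. R * emeasure M (B - G (n + m)))"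
    by (simp add: SUP_mult_left_ennreal[symmetric])
  also have "\<dots> \<le> I0 + (\<Sum>k. a (k + m))"
  proof (rule SUP_least)
    fix n
    have "R * emeasure M (B - G (n + m)) \<le> I0 + (\<Sum>k=m..<n + m. a k)"
      by (rule order_trans[OF add_increasing2[OF zero_le order_refl] main]) simp
    also have "(\<Sum>k=m..<n + m. a k) = (\<Sum>k<n. a (k + m))"
      using sum.shift_bounds_nat_ivl[of a 0 m n] by (simp add: atLeast0LessThan)
    also have "\<dots> \<le> (\<Sum>k. a (k + m))" by (intro sum_le_suminf) auto
    finally show "R * emeasure M (B - G (n + m)) \<le> I0 + (\<Sum>k. a (k + m))" by (simp add: add_left_mono)
  qed
  finally show ?thesis by (simp add: I0_def)
qed

end

lemma integrable_inner_square:
  fixes f g :: "'a \<Rightarrow> 'b::euclidean_space"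
  assumes [measurable]: "f \<in> borel_measurable M" "g \<in> borel_measurable M"
    and fg: "integrable M (\<lambda>\<omega>. (norm (f \<omega>))\<^sup>2)" "integrable M (\<lambda>\<omega>. (norm (g \<omega>))\<^sup>2)"
  shows "integrable M (\<lambda>\<omega>. f \<omega> \<bullet> g \<omega>)"
proof (rule Bochner_Integration.integrable_bound[OF Bochner_Integration.integrable_add[OF fg]])
  have "\<bar>x \<bullet> y\<bar> \<le> (norm x)\<^sup>2 + (norm y)\<^sup>2" for x y :: 'b
  proof -
    have "\<bar>x \<bullet> y\<bar> \<le> norm x * norm y" by (rule Cauchy_Schwarz_ineq2)
    also have "2 * (norm x * norm y) \<le> (norm x)\<^sup>2 + (norm y)\<^sup>2"
      using sum_squares_bound[of "norm x" "norm y"] by (simp add: mult.assoc)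
    then have "norm x * norm y \<le> (norm x)\<^sup>2 + (norm y)\<^sup>2"
      using mult_nonneg_nonneg[OF norm_ge_zero[of x] norm_ge_zero[of y]] by linarith
    finally show ?thesis .
  qed
  then show "AE \<omega> in M. norm (f \<omega> \<bullet> g \<omega>) \<le> norm ((norm (f \<omega>))\<^sup>2 + (norm (g \<omega>))\<^sup>2)"
    by auto
qed simp

lemma integrable_square_add:
  fixes f g :: "'a \<Rightarrow> 'b::euclidean_space"
  assumes [measurable]: "f \<in> borel_measurable M" "g \<in> borel_measurable M"
    and fg: "integrable M (\<lambda>\<omega>. (norm (f \<omega>))\<^sup>2)" "integrable M (\<lambda>\<omega>. (norm (g \<omega>))\<^sup>2)"
  shows "integrable M (\<lambda>\<omega>. (norm (f \<omega> + g \<omega>))\<^sup>2)"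
proof -
  have "(norm (x + y))\<^sup>2 = (norm x)\<^sup>2 + 2 * (x \<bullet> y) + (norm y)\<^sup>2" for x y :: 'b
    by (simp add: power2_norm_eq_inner inner_add_left inner_add_right inner_commute)
  then show ?thesis
    using fg integrable_inner_square[OF assms] by simp
qed

context filtered_prob_space
begin

text \<open>By orthogonality \<open>(\<Sum>j=m..<n. D j)\<^sup>2\<close> drifts upwards by the variance of \<open>D n\<close> only, so the maximal
  inequality bounds the probability that the partial sums move by \<open>\<epsilon>\<close> after \<open>m\<close> by the variance tail
  divided by \<open>\<epsilon>\<^sup>2\<close>.\<close>

proposition square_integrable_martingale_converges:
  fixes D :: "nat \<Rightarrow> 'a \<Rightarrow> real"
  assumes D: "\<And>k. D k \<in> borel_measurable (F (Suc k))"
    and D2: "\<And>k. integrable M (\<lambda>\<omega>. (D k \<omega>)\<^sup>2)"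
    and orth: "\<And>k f. f \<in> borel_measurable (F k) \<Longrightarrow> integrable M (\<lambda>\<omega>. (f \<omega>)\<^sup>2) \<Longrightarrow> (\<integral>\<omega>. f \<omega> * D k \<omega> \<partial>M) = 0"
    and sum: "summable (\<lambda>k. \<integral>\<omega>. (D k \<omega>)\<^sup>2 \<partial>M)"
  shows "AE \<omega> in M. summable (\<lambda>k. D k \<omega>)"
proof -
  define v where "v k = (\<integral>\<omega>. (D k \<omega>)\<^sup>2 \<partial>M)" for k
  have v0: "0 \<le> v k" for k by (simp add: v_def)
  define S where "S m n \<omega> = (\<Sum>j=m..<n. D j \<omega>)" for m n \<omega>
  have S_F: "S m n \<in> borel_measurable (F n)" for m n
    unfolding S_def using measurable_F_mono[OF D] by (intro borel_measurable_sum) auto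
  have DM [measurable]: "D k \<in> borel_measurable M" for k by (rule measurable_F[OF D])
  have SM [measurable]: "S m n \<in> borel_measurable M" for m n by (rule measurable_F[OF S_F])
  have S2: "integrable M (\<lambda>\<omega>. (S m n \<omega>)\<^sup>2)" for m n
  proof (induction n)
    case 0 then show ?case by (simp add: S_def)
  next
    case (Suc n)
    show ?case
    proof (cases "m \<le> n")
      case True
      then have "S m (Suc n) = (\<lambda>\<omega>. S m n \<omega> + D n \<omega>)" by (auto simp: S_def)
      then show ?thesis using integrable_square_add[of "S m n" M "D n"] Suc D2 by simp
    next
      case False
      then show ?thesis by (simp add: S_def)
    qed
  qed
  have maxi: "ennreal (\<epsilon>\<^sup>2) * emeasure M {\<omega>\<in>space M. \<exists>n\<ge>m. \<epsilon>\<^sup>2 \<le> (S m n \<omega>)\<^sup>2} \<le> (\<Sum>k. ennreal (v (k + m)))" for \<epsilon> m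
  proof -
    have "ennreal (\<epsilon>\<^sup>2) * emeasure M {\<omega>\<in>space M. \<exists>n\<ge>m. ennreal (\<epsilon>\<^sup>2) \<le> ennreal ((S m n \<omega>)\<^sup>2)}
        \<le> (\<integral>\<^sup>+\<omega>. ennreal ((S m m \<omega>)\<^sup>2) * indicator (space M) \<omega> \<partial>M) + (\<Sum>k. ennreal (v (k + m)))"
    proof (rule maximal_inequality)
      show "(\<lambda>\<omega>. ennreal ((S m k \<omega>)\<^sup>2)) \<in> borel_measurable (F k)" for k
        using S_F[of m k] by measurable
      show "space M \<in> sets (F m)" using sets.top[of "F m"] by simp
      fix k A assume k: "m \<le> k" and A: "A \<in> sets (F k)"
      note [measurable] = A sets_F[OF A] S_F[of m k]
      have iS: "integrable M (\<lambda>\<omega>. (indicator A \<omega> * S m k \<omega>)\<^sup>2)"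
        by (rule Bochner_Integration.integrable_bound[OF S2[of m k]]) (auto split: split_indicator)
      have iS': "integrable M (\<lambda>\<omega>. (indicator A \<omega> * S m k \<omega>) * D k \<omega>)"
        using integrable_inner_square[of "\<lambda>\<omega>. indicator A \<omega> * S m k \<omega>" M "D k"] iS D2 by simp
      have iD: "integrable M (\<lambda>\<omega>. (D k \<omega>)\<^sup>2 * indicator A \<omega>)"
        by (rule Bochner_Integration.integrable_bound[OF D2[of k]]) (auto split: split_indicator)
      have "(\<integral>\<omega>. (indicator A \<omega> * S m k \<omega>) * D k \<omega> \<partial>M) = 0"
        using iS by (intro orth) auto
      moreover have "(indicator A \<omega> * S m (Suc k) \<omega>)\<^sup>2 =
          (indicator A \<omega> * S m k \<omega>)\<^sup>2 + 2 * ((indicator A \<omega> * S m k \<omega>) * D k \<omega>) + (D k \<omega>)\<^sup>2 * indicator A \<omega>" for \<omega>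
        using k by (auto simp: S_def power2_eq_square algebra_simps split: split_indicator)
      ultimately have "(\<integral>\<omega>. (indicator A \<omega> * S m (Suc k) \<omega>)\<^sup>2 \<partial>M)
          = (\<integral>\<omega>. (indicator A \<omega> * S m k \<omega>)\<^sup>2 \<partial>M) + (\<integral>\<omega>. (D k \<omega>)\<^sup>2 * indicator A \<omega> \<partial>M)"
        using iS iS' iD by simp
      also have "(\<integral>\<omega>. (D k \<omega>)\<^sup>2 * indicator A \<omega> \<partial>M) \<le> v k"
        unfolding v_def using iD D2 by (intro integral_mono) (auto split: split_indicator)
      finally have le: "(\<integral>\<omega>. (indicator A \<omega> * S m (Suc k) \<omega>)\<^sup>2 \<partial>M)
          \<le> (\<integral>\<omega>. (indicator A \<omega> * S m k \<omega>)\<^sup>2 \<partial>M) + v k" by simp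
      have conv: "(\<integral>\<^sup>+\<omega>. ennreal ((S m n \<omega>)\<^sup>2) * indicator A \<omega> \<partial>M)
          = ennreal (\<integral>\<omega>. (indicator A \<omega> * S m n \<omega>)\<^sup>2 \<partial>M)" for n
      proof -
        have "integrable M (\<lambda>\<omega>. (indicator A \<omega> * S m n \<omega>)\<^sup>2)"
          by (rule Bochner_Integration.integrable_bound[OF S2[of m n]]) (auto split: split_indicator)
        then have "(\<integral>\<^sup>+\<omega>. ennreal ((indicator A \<omega> * S m n \<omega>)\<^sup>2) \<partial>M) = ennreal (\<integral>\<omega>. (indicator A \<omega> * S m n \<omega>)\<^sup>2 \<partial>M)"
          by (rule nn_integral_eq_integral) simp
        moreover have "ennreal ((indicator A \<omega> * S m n \<omega>)\<^sup>2) = ennreal ((S m n \<omega>)\<^sup>2) * indicator A \<omega>" for \<omega>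
          by (simp split: split_indicator)
        ultimately show ?thesis by simp
      qed
      show "(\<integral>\<^sup>+\<omega>. ennreal ((S m (Suc k) \<omega>)\<^sup>2) * indicator A \<omega> \<partial>M)
          \<le> (\<integral>\<^sup>+\<omega>. ennreal ((S m k \<omega>)\<^sup>2) * indicator A \<omega> \<partial>M) + ennreal (v k)"
        unfolding conv using le v0 by (simp add: ennreal_plus[symmetric] del: ennreal_plus)
    qed
    then show ?thesis by (simp add: S_def)
  qed
  have tail0: "(\<lambda>m. \<Sum>k. ennreal (v (k + m))) \<longlonglongrightarrow> 0"
  proof -
    have sv: "summable v" using sum unfolding v_def .
    have "(\<Sum>k. ennreal (v (k + m))) = ennreal (\<Sum>k. v (k + m))" for m
      using v0 sv by (intro suminf_ennreal2) (auto simp: summable_iff_shift)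
    moreover have "(\<lambda>m. ennreal (\<Sum>k. v (k + m))) \<longlonglongrightarrow> ennreal 0"
      by (intro tendsto_ennrealI suminf_exist_split2[OF sv])
    ultimately show ?thesis by simp
  qed
  have settles: "AE \<omega> in M. \<exists>m. \<forall>n\<ge>m. (S m n \<omega>)\<^sup>2 < \<epsilon>\<^sup>2" if e: "0 < \<epsilon>" for \<epsilon>
  proof -
    let ?E = "\<lambda>m. {\<omega>\<in>space M. \<exists>n\<ge>m. \<epsilon>\<^sup>2 \<le> (S m n \<omega>)\<^sup>2}"
    have E [measurable]: "?E m \<in> sets M" for m by measurable
    have "ennreal (\<epsilon>\<^sup>2) * emeasure M (\<Inter>m. ?E m) \<le> (\<Sum>k. ennreal (v (k + m)))" for m
      by (rule order_trans[OF mult_left_mono[OF emeasure_mono] maxi]) auto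
    then have "ennreal (\<epsilon>\<^sup>2) * emeasure M (\<Inter>m. ?E m) \<le> 0"
      by (intro LIMSEQ_le_const[OF tail0]) auto
    then have "emeasure M (\<Inter>m. ?E m) = 0" using e by simp
    then have "(\<Inter>m. ?E m) \<in> null_sets M" by (intro null_setsI) auto
    then show ?thesis
      by (rule AE_I') (auto simp: not_less)
  qed
  have "AE \<omega> in M. \<forall>r::nat. \<exists>m. \<forall>n\<ge>m. (S m n \<omega>)\<^sup>2 < (inverse (real (Suc r)))\<^sup>2"
    unfolding AE_all_countable using settles by auto
  then show ?thesis
  proof (rule AE_mp, intro AE_I2 impI)
    fix \<omega> assume *: "\<forall>r::nat. \<exists>m. \<forall>n\<ge>m. (S m n \<omega>)\<^sup>2 < (inverse (real (Suc r)))\<^sup>2"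
    show "summable (\<lambda>k. D k \<omega>)"
      unfolding summable_Cauchy
    proof (intro allI impI)
      fix \<epsilon> :: real assume e: "0 < \<epsilon>"
      obtain r where r: "inverse (real (Suc r)) < \<epsilon> / 2"
        using reals_Archimedean[of "\<epsilon> / 2"] e by auto
      obtain m where m: "\<And>n. n \<ge> m \<Longrightarrow> (S m n \<omega>)\<^sup>2 < (inverse (real (Suc r)))\<^sup>2" using * by blast
      have m': "\<bar>S m n \<omega>\<bar> < \<epsilon> / 2" if "n \<ge> m" for n
        using power2_less_imp_less[of "\<bar>S m n \<omega>\<bar>" "inverse (real (Suc r))"] m[OF that] r by simp
      show "\<exists>N. \<forall>p\<ge>N. \<forall>n. norm (\<Sum>k=p..<n. D k \<omega>) < \<epsilon>"
      proof (intro exI[of _ m] allI impI)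
        fix p n assume p: "m \<le> p"
        show "norm (\<Sum>k=p..<n. D k \<omega>) < \<epsilon>"
        proof (cases "p \<le> n")
          case True
          then have "(\<Sum>k=p..<n. D k \<omega>) = S m n \<omega> - S m p \<omega>"
            using sum.atLeastLessThan_concat[OF p True, of "\<lambda>k. D k \<omega>"] by (simp add: S_def)
          then show ?thesis using m'[of n] m'[of p] True p abs_triangle_ineq4[of "S m n \<omega>" "S m p \<omega>"] by simp
        next
          case False then show ?thesis using e by simp
        qed
      qed
    qed
  qed
qed

lemma component_square_le: "((x :: real ^ 'n) $ i)\<^sup>2 \<le> (norm x)\<^sup>2"
  using component_le_norm_cart[of x i] by (simp add: abs_le_square_iff[symmetric])

section \<open>Conditional expectation of square-integrable vectors\<close>

context
  fixes Y :: "'a \<Rightarrow> real ^ 'n"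
  assumes Y [measurable]: "Y \<in> borel_measurable M" and Y2: "integrable M (\<lambda>\<omega>. (norm (Y \<omega>))\<^sup>2)"
begin

lemma component_integrable:
  "integrable M (\<lambda>\<omega>. Y \<omega> $ i)" "integrable M (\<lambda>\<omega>. (Y \<omega> $ i)\<^sup>2)"
proof -
  have [measurable]: "(\<lambda>\<omega>. Y \<omega> $ i) \<in> borel_measurable M"
    unfolding cart_eq_inner_axis by measurable
  show *: "integrable M (\<lambda>\<omega>. (Y \<omega> $ i)\<^sup>2)"
    by (rule Bochner_Integration.integrable_bound[OF Y2]) (auto simp: component_square_le)
  show "integrable M (\<lambda>\<omega>. Y \<omega> $ i)"
    using integrable_inner_square[of "\<lambda>\<omega>. Y \<omega> $ i" M "\<lambda>_. 1"] * by simp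
qed

lemma vec_cond_exp_measurable: "vec_cond_exp M (F k) Y \<in> borel_measurable (F k)"
proof (subst borel_measurable_euclidean_space, intro ballI)
  fix b :: "real ^ 'n" assume "b \<in> Basis"
  then obtain i where "b = axis i 1" by (auto simp: Basis_vec_def)
  then show "(\<lambda>\<omega>. vec_cond_exp M (F k) Y \<omega> \<bullet> b) \<in> borel_measurable (F k)"
    by (simp add: cart_eq_inner_axis[symmetric] vec_cond_exp_def)
qed

text \<open>Jensen's inequality in each coordinate.\<close>

lemma vec_cond_exp_square_integrable: "integrable M (\<lambda>\<omega>. (norm (vec_cond_exp M (F k) Y \<omega>))\<^sup>2)"
proof -
  have "integrable M (\<lambda>\<omega>. (real_cond_exp M (F k) (\<lambda>\<omega>. Y \<omega> $ i) \<omega>)\<^sup>2)" for i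
    using cond.integrable_convex_cond_exp[where q="power2" and I=UNIV and X="\<lambda>\<omega>. Y \<omega> $ i"] component_integrable
      convex_power2 by auto
  moreover have "(norm (vec_cond_exp M (F k) Y \<omega>))\<^sup>2 = (\<Sum>i\<in>UNIV. (real_cond_exp M (F k) (\<lambda>\<omega>. Y \<omega> $ i) \<omega>)\<^sup>2)" for \<omega>
    unfolding power2_norm_eq_inner by (simp add: inner_vec_def vec_cond_exp_def power2_eq_square)
  ultimately show ?thesis by simp
qed

lemma vec_cond_exp_orthogonal:
  assumes f: "f \<in> borel_measurable (F k)" and f2: "integrable M (\<lambda>\<omega>. (norm (f \<omega>))\<^sup>2)"
  shows "(\<integral>\<omega>. f \<omega> \<bullet> (Y \<omega> - vec_cond_exp M (F k) Y \<omega>) \<partial>M) = 0"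
proof -
  let ?m = "\<lambda>i. real_cond_exp M (F k) (\<lambda>\<omega>. Y \<omega> $ i)"
  note [measurable] = f measurable_F[OF f]
  have fi [measurable]: "(\<lambda>\<omega>. f \<omega> $ i) \<in> borel_measurable (F k)" for i
    unfolding cart_eq_inner_axis by measurable
  have [measurable]: "(\<lambda>\<omega>. f \<omega> $ i) \<in> borel_measurable M" "(\<lambda>\<omega>. Y \<omega> $ i) \<in> borel_measurable M" for i
    unfolding cart_eq_inner_axis by measurable
  have f2i: "integrable M (\<lambda>\<omega>. (f \<omega> $ i)\<^sup>2)" for i
    by (rule Bochner_Integration.integrable_bound[OF f2]) (auto simp: component_square_le)
  have fY: "integrable M (\<lambda>\<omega>. f \<omega> $ i * Y \<omega> $ i)" for i
    using integrable_inner_square[of "\<lambda>\<omega>. f \<omega> $ i" M "\<lambda>\<omega>. Y \<omega> $ i"] f2i component_integrable by simp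
  note rc = cond.real_cond_exp_intg[OF fY fi]
  have "(\<integral>\<omega>. f \<omega> \<bullet> (Y \<omega> - vec_cond_exp M (F k) Y \<omega>) \<partial>M)
      = (\<integral>\<omega>. (\<Sum>i\<in>UNIV. f \<omega> $ i * Y \<omega> $ i - f \<omega> $ i * ?m i \<omega>) \<partial>M)"
    by (simp add: inner_vec_def vec_cond_exp_def algebra_simps)
  also have "\<dots> = (\<Sum>i\<in>UNIV. (\<integral>\<omega>. f \<omega> $ i * Y \<omega> $ i \<partial>M) - (\<integral>\<omega>. f \<omega> $ i * ?m i \<omega> \<partial>M))"
    using fY rc(1) by simp
  also have "\<dots> = 0" using rc(2) by simp
  finally show ?thesis .
qed

end

end

section \<open>Stochastic approximation with a Lyapunov function\<close>

text \<open>Subtracting the partial sums of \<open>c\<close> turns \<open>u\<close> into a sequence that eventually decreases. The sum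
  of \<open>c\<close> may converge conditionally only, as for martingale increments.\<close>

lemma almost_decreasing_convergent:
  fixes u c :: "nat \<Rightarrow> real"
  assumes le: "\<And>k. k0 \<le> k \<Longrightarrow> u (Suc k) \<le> u k + c k" and c: "summable c" and u0: "\<And>k. 0 \<le> u k"
  shows "convergent u"
proof -
  define s where "s n = (\<Sum>k<n. c k)" for n
  have s: "convergent s" unfolding s_def using c summable_iff_convergent by blast
  obtain K where K: "\<And>n. \<bar>s n\<bar> \<le> K"
    using convergent_imp_Bseq[OF s] by (auto simp: Bseq_def)
  define v where "v n = u (n + k0) - s (n + k0)" for n
  have "decseq v"
    unfolding decseq_Suc_iff using le by (auto simp: v_def s_def algebra_simps)
  moreover have "- K \<le> v n" for n
    using u0[of "n + k0"] K[of "n + k0"] by (simp add: v_def abs_le_iff)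
  ultimately have "convergent v" using decseq_convergent convergentI by metis
  then have "convergent (\<lambda>n. v n + s (n + k0))"
    using s convergent_ignore_initial_segment[of s k0] by (intro convergent_add) auto
  then have "convergent (\<lambda>n. u (n + k0))" by (simp add: v_def)
  then show ?thesis using convergent_ignore_initial_segment by blast
qed

lemma norm_add_square_le: "(norm (x + y))\<^sup>2 \<le> 2 * (norm x)\<^sup>2 + 2 * (norm (y :: 'a::real_inner))\<^sup>2"
proof -
  have "(norm (x + y))\<^sup>2 + (norm (x - y))\<^sup>2 = 2 * (norm x)\<^sup>2 + 2 * (norm y)\<^sup>2"
    by (simp add: power2_norm_eq_inner inner_add_left inner_add_right inner_diff_left inner_diff_right inner_commute)
  then show ?thesis using zero_le_power2[of "norm (x - y)"] by linarith
qed

text \<open>The part of the problem in which the filtration is arbitrary and the Lyapunov function \<open>U\<close> is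
  nonnegative. Step \<open>k\<close> here leads from \<open>w k\<close> to \<open>w (Suc k)\<close>. The bias enters twice: \<open>bias_le\<close> is a crude
  bound for second moments, \<open>bias_drift_le\<close> the bound on its effect on \<open>U\<close>. The hypothesis \<open>absorbed\<close> says
  that from \<open>k0\<close> on all terms proportional to \<open>W\<close> are dominated by the dissipation \<open>\<rho> * W\<close>.\<close>

locale stochastic_approximation = filtered_prob_space M F
  for M :: "'a measure" and F :: "nat \<Rightarrow> 'a measure" +
  fixes w Y :: "nat \<Rightarrow> 'a \<Rightarrow> real ^ 'n" and \<gamma> :: "nat \<Rightarrow> real"
    and h gradU :: "real ^ 'n \<Rightarrow> real ^ 'n" and U W :: "real ^ 'n \<Rightarrow> real"
    and \<rho> l C c0 c1 B s0 s1 :: real and \<beta> \<theta> :: "nat \<Rightarrow> real" and k0 :: nat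
  assumes w_adapted: "w k \<in> borel_measurable (F k)"
    and Y_adapted: "Y k \<in> borel_measurable (F (Suc k))"
    and Y_square: "integrable M (\<lambda>\<omega>. (norm (Y k \<omega>))\<^sup>2)"
    and recursion: "\<omega> \<in> space M \<Longrightarrow> w (Suc k) \<omega> = w k \<omega> + \<gamma> k *\<^sub>R Y k \<omega>"
    and \<gamma>_pos: "0 < \<gamma> k" and \<gamma>_square: "summable (\<lambda>k. (\<gamma> k)\<^sup>2)"
    and U_borel [measurable]: "U \<in> borel_measurable borel"
    and W_borel [measurable]: "W \<in> borel_measurable borel"
    and gradU_borel [measurable]: "gradU \<in> borel_measurable borel"
    and U_nonneg: "0 \<le> U x" and W_nonneg: "0 \<le> W x"
    and constants_nonneg: "0 < l" "0 \<le> C" "0 \<le> c0" "0 \<le> c1" "0 \<le> B" "0 \<le> s0" "0 \<le> s1"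
    and descent: "U y \<le> U x + gradU x \<bullet> (y - x) + l * (norm (y - x))\<^sup>2"
    and gradU_le: "(norm (gradU x))\<^sup>2 \<le> 4 * l * U x"
    and W_le: "W x \<le> 1 + C * U x"
    and field_le: "(norm (h x))\<^sup>2 \<le> c0 + c1 * W x"
    and drift_le: "gradU x \<bullet> h x \<le> - \<rho> * W x"
    and variance_le: "AE \<omega> in M. real_cond_exp M (F k)
        (\<lambda>\<omega>'. (norm (Y k \<omega>' - vec_cond_exp M (F k) (Y k) \<omega>'))\<^sup>2) \<omega> \<le> s0 + s1 * W (w k \<omega>)"
    and bias_le: "AE \<omega> in M. (norm (vec_cond_exp M (F k) (Y k) \<omega> - h (w k \<omega>)))\<^sup>2 \<le> B * (1 + W (w k \<omega>))"
    and bias_drift_le: "k0 \<le> k \<Longrightarrow> AE \<omega> in M.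
        gradU (w k \<omega>) \<bullet> (vec_cond_exp M (F k) (Y k) \<omega> - h (w k \<omega>)) \<le> \<beta> k + \<theta> k * W (w k \<omega>)"
    and \<beta>_nonneg: "0 \<le> \<beta> k" and \<beta>_summable: "summable (\<lambda>k. \<gamma> k * \<beta> k)"
    and absorbed: "k0 \<le> k \<Longrightarrow> \<theta> k + l * \<gamma> k * (2 * s1 + 4 * c1 + 4 * B) \<le> \<rho>"
begin

abbreviation mean :: "nat \<Rightarrow> 'a \<Rightarrow> real ^ 'n" where "mean k \<equiv> vec_cond_exp M (F k) (Y k)"

abbreviation noise :: "nat \<Rightarrow> 'a \<Rightarrow> real ^ 'n" where "noise k \<omega> \<equiv> Y k \<omega> - mean k \<omega>"

abbreviation U_at :: "nat \<Rightarrow> 'a \<Rightarrow> real" where "U_at k \<omega> \<equiv> U (w k \<omega>)"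

abbreviation W_at :: "nat \<Rightarrow> 'a \<Rightarrow> real" where "W_at k \<omega> \<equiv> W (w k \<omega>)"

definition K0 :: real where "K0 = 2 * s0 + 4 * c0 + 4 * B"

definition K1 :: real where "K1 = 2 * s1 + 4 * c1 + 4 * B"

lemma K_nonneg: "0 \<le> K0" "0 \<le> K1"
  using constants_nonneg by (auto simp: K0_def K1_def)

declare w_adapted [measurable]

lemma w_measurable [measurable]: "w k \<in> borel_measurable M"
  by (rule measurable_F[OF w_adapted])

lemma Y_measurable [measurable]: "Y k \<in> borel_measurable M"
  by (rule measurable_F[OF Y_adapted])

lemma mean_adapted [measurable]: "mean k \<in> borel_measurable (F k)"
  by (rule vec_cond_exp_measurable[OF Y_measurable Y_square])

lemma mean_measurable [measurable]: "mean k \<in> borel_measurable M"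
  by (rule measurable_F[OF mean_adapted])

lemma noise_adapted: "noise k \<in> borel_measurable (F (Suc k))"
  using measurable_F_mono[OF mean_adapted, of k "Suc k"] Y_adapted[of k] by measurable

lemma noise_square: "integrable M (\<lambda>\<omega>. (norm (noise k \<omega>))\<^sup>2)"
  using integrable_square_add[of "Y k" M "\<lambda>\<omega>. - mean k \<omega>"] Y_square
    vec_cond_exp_square_integrable[OF Y_measurable Y_square] by simp

lemma W_integrable_on:
  assumes A: "A \<in> sets M" and UA: "integrable M (\<lambda>\<omega>. indicator A \<omega> * U_at k \<omega>)"
  shows "integrable M (\<lambda>\<omega>. indicator A \<omega> * W_at k \<omega>)"
proof (rule Bochner_Integration.integrable_bound)
  show "integrable M (\<lambda>\<omega>. indicator A \<omega> + C * (indicator A \<omega> * U_at k \<omega>))"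
    using A UA by (intro Bochner_Integration.integrable_add integrable_mult_right) (auto simp: emeasure_eq_measure)
  show "AE \<omega> in M. norm (indicator A \<omega> * W_at k \<omega>) \<le> norm (indicator A \<omega> + C * (indicator A \<omega> * U_at k \<omega>))"
    using W_le W_nonneg U_nonneg constants_nonneg by (auto split: split_indicator)
qed (use A in measurable)

lemma noise_second_moment:
  assumes A: "A \<in> sets (F k)" and WA: "integrable M (\<lambda>\<omega>. indicator A \<omega> * W_at k \<omega>)"
  shows "(\<integral>\<omega>. indicator A \<omega> * (norm (noise k \<omega>))\<^sup>2 \<partial>M) \<le> (\<integral>\<omega>. indicator A \<omega> * (s0 + s1 * W_at k \<omega>) \<partial>M)"
proof -
  note [measurable] = A sets_F[OF A]
  have int: "integrable M (\<lambda>\<omega>. indicator A \<omega> * (norm (noise k \<omega>))\<^sup>2)"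
    using integrable_mult_indicator[OF sets_F[OF A] noise_square[of k]] by simp
  note rc = cond.real_cond_exp_intg[OF int, of k]
  have "(\<integral>\<omega>. indicator A \<omega> * (norm (noise k \<omega>))\<^sup>2 \<partial>M)
      = (\<integral>\<omega>. indicator A \<omega> * real_cond_exp M (F k) (\<lambda>\<omega>. (norm (noise k \<omega>))\<^sup>2) \<omega> \<partial>M)"
    by (rule rc(2)[symmetric]) measurable
  also have "\<dots> \<le> (\<integral>\<omega>. indicator A \<omega> * (s0 + s1 * W_at k \<omega>) \<partial>M)"
  proof (rule integral_mono_AE)
    show "integrable M (\<lambda>\<omega>. indicator A \<omega> * real_cond_exp M (F k) (\<lambda>\<omega>. (norm (noise k \<omega>))\<^sup>2) \<omega>)"
      by (rule rc(1)) measurable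
    have "integrable M (\<lambda>\<omega>. s0 * indicator A \<omega> + s1 * (indicator A \<omega> * W_at k \<omega>))"
      using WA by (intro Bochner_Integration.integrable_add integrable_mult_right) (auto simp: emeasure_eq_measure)
    then show "integrable M (\<lambda>\<omega>. indicator A \<omega> * (s0 + s1 * W_at k \<omega>))"
      by (simp add: algebra_simps)
    show "AE \<omega> in M. indicator A \<omega> * real_cond_exp M (F k) (\<lambda>\<omega>. (norm (noise k \<omega>))\<^sup>2) \<omega>
        \<le> indicator A \<omega> * (s0 + s1 * W_at k \<omega>)"
      using variance_le[of k] by eventually_elim (auto split: split_indicator)
  qed
  finally show ?thesis .
qed

text \<open>The oracle is the sum of noise, bias and mean field, each with a second moment affine in \<open>W\<close>.\<close>

lemma oracle_second_moment:
  assumes A: "A \<in> sets (F k)" and WA: "integrable M (\<lambda>\<omega>. indicator A \<omega> * W_at k \<omega>)"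
  shows "(\<integral>\<omega>. indicator A \<omega> * (norm (Y k \<omega>))\<^sup>2 \<partial>M) \<le> (\<integral>\<omega>. indicator A \<omega> * (K0 + K1 * W_at k \<omega>) \<partial>M)"
proof -
  note [measurable] = A sets_F[OF A]
  have iA: "integrable M (indicator A :: 'a \<Rightarrow> real)" by (auto simp: emeasure_eq_measure)
  have lin: "integrable M (\<lambda>\<omega>. indicator A \<omega> * (a + b * W_at k \<omega>))" for a b
  proof -
    have "integrable M (\<lambda>\<omega>. a * indicator A \<omega> + b * (indicator A \<omega> * W_at k \<omega>))"
      using WA iA by (intro Bochner_Integration.integrable_add integrable_mult_right)
    then show ?thesis by (simp add: algebra_simps)
  qed
  have iN: "integrable M (\<lambda>\<omega>. indicator A \<omega> * (norm (noise k \<omega>))\<^sup>2)"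
    using integrable_mult_indicator[OF sets_F[OF A] noise_square[of k]] by simp
  let ?a = "4 * c0 + 4 * B" and ?b = "4 * c1 + 4 * B"
  have "(\<integral>\<omega>. indicator A \<omega> * (norm (Y k \<omega>))\<^sup>2 \<partial>M)
      \<le> (\<integral>\<omega>. 2 * (indicator A \<omega> * (norm (noise k \<omega>))\<^sup>2) + indicator A \<omega> * (?a + ?b * W_at k \<omega>) \<partial>M)"
  proof (rule integral_mono_AE)
    show "integrable M (\<lambda>\<omega>. indicator A \<omega> * (norm (Y k \<omega>))\<^sup>2)"
      using integrable_mult_indicator[OF sets_F[OF A] Y_square[of k]] by simp
    show "AE \<omega> in M. indicator A \<omega> * (norm (Y k \<omega>))\<^sup>2
        \<le> 2 * (indicator A \<omega> * (norm (noise k \<omega>))\<^sup>2) + indicator A \<omega> * (?a + ?b * W_at k \<omega>)"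
      using bias_le[of k]
    proof eventually_elim
      case (elim \<omega>)
      have "(norm (Y k \<omega>))\<^sup>2 \<le> 2 * (norm (noise k \<omega>))\<^sup>2 + 2 * (norm (mean k \<omega>))\<^sup>2"
        using norm_add_square_le[of "noise k \<omega>" "mean k \<omega>"] by simp
      moreover have "(norm (mean k \<omega>))\<^sup>2 \<le> 2 * (norm (mean k \<omega> - h (w k \<omega>)))\<^sup>2 + 2 * (norm (h (w k \<omega>)))\<^sup>2"
        using norm_add_square_le[of "mean k \<omega> - h (w k \<omega>)" "h (w k \<omega>)"] by simp
      ultimately have "(norm (Y k \<omega>))\<^sup>2 \<le> 2 * (norm (noise k \<omega>))\<^sup>2 + (?a + ?b * W_at k \<omega>)"
        using elim field_le[of "w k \<omega>"] by (simp add: algebra_simps)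
      then show ?case by (auto split: split_indicator)
    qed
  qed (use iN lin in auto)
  also have "\<dots> = 2 * (\<integral>\<omega>. indicator A \<omega> * (norm (noise k \<omega>))\<^sup>2 \<partial>M) + (\<integral>\<omega>. indicator A \<omega> * (?a + ?b * W_at k \<omega>) \<partial>M)"
    using iN lin by simp
  also have "\<dots> \<le> 2 * (\<integral>\<omega>. indicator A \<omega> * (s0 + s1 * W_at k \<omega>) \<partial>M) + (\<integral>\<omega>. indicator A \<omega> * (?a + ?b * W_at k \<omega>) \<partial>M)"
    using noise_second_moment[OF A WA] by simp
  also have "\<dots> = (\<integral>\<omega>. 2 * (indicator A \<omega> * (s0 + s1 * W_at k \<omega>)) + indicator A \<omega> * (?a + ?b * W_at k \<omega>) \<partial>M)"
    using lin by simp
  also have "\<dots> = (\<integral>\<omega>. indicator A \<omega> * (K0 + K1 * W_at k \<omega>) \<partial>M)"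
    by (intro Bochner_Integration.integral_cong) (auto simp: K0_def K1_def algebra_simps)
  finally show ?thesis .
qed

text \<open>One step of the Lyapunov function, in expectation over an event of the past. The first-order term
  sees only the conditional mean, whose mean-field part dissipates \<open>\<rho> * W\<close>. For \<open>k \<ge> k0\<close> this pays for
  every other multiple of \<open>W\<close>, and only a deterministic summable increment is left: up to that
  increment \<open>U_at\<close> is a supermartingale.\<close>

lemma
  assumes A: "A \<in> sets (F k)" and UA: "integrable M (\<lambda>\<omega>. indicator A \<omega> * U_at k \<omega>)"
  shows U_integrable_step: "integrable M (\<lambda>\<omega>. indicator A \<omega> * U_at (Suc k) \<omega>)"
    and U_drift: "k0 \<le> k \<Longrightarrow> (\<integral>\<omega>. indicator A \<omega> * U_at (Suc k) \<omega> \<partial>M)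
      \<le> (\<integral>\<omega>. indicator A \<omega> * U_at k \<omega> \<partial>M) + (\<gamma> k * \<beta> k + l * K0 * (\<gamma> k)\<^sup>2)"
proof -
  note [measurable] = A sets_F[OF A]
  let ?\<chi> = "indicator A :: 'a \<Rightarrow> real"
  have iA: "integrable M ?\<chi>" by (auto simp: emeasure_eq_measure)
  have WA: "integrable M (\<lambda>\<omega>. ?\<chi> \<omega> * W_at k \<omega>)" by (rule W_integrable_on[OF sets_F[OF A] UA])
  define f where "f \<omega> = ?\<chi> \<omega> *\<^sub>R gradU (w k \<omega>)" for \<omega>
  have f_F [measurable]: "f \<in> borel_measurable (F k)" unfolding f_def by measurable
  have f_M [measurable]: "f \<in> borel_measurable M" by (rule measurable_F[OF f_F])
  have f2: "integrable M (\<lambda>\<omega>. (norm (f \<omega>))\<^sup>2)"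
  proof (rule Bochner_Integration.integrable_bound[OF integrable_mult_right[OF UA, of "4 * l"]])
    show "AE \<omega> in M. norm ((norm (f \<omega>))\<^sup>2) \<le> norm (4 * l * (?\<chi> \<omega> * U_at k \<omega>))"
      using gradU_le U_nonneg constants_nonneg by (auto simp: f_def split: split_indicator)
  qed measurable
  have fY: "integrable M (\<lambda>\<omega>. f \<omega> \<bullet> Y k \<omega>)"
    by (rule integrable_inner_square[OF f_M Y_measurable f2 Y_square])
  have fm: "integrable M (\<lambda>\<omega>. f \<omega> \<bullet> mean k \<omega>)"
    by (rule integrable_inner_square[OF f_M mean_measurable f2 vec_cond_exp_square_integrable[OF Y_measurable Y_square]])
  have "(\<integral>\<omega>. f \<omega> \<bullet> noise k \<omega> \<partial>M) = 0"
    by (rule vec_cond_exp_orthogonal[OF Y_measurable Y_square f_F f2])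
  then have swap: "(\<integral>\<omega>. f \<omega> \<bullet> Y k \<omega> \<partial>M) = (\<integral>\<omega>. f \<omega> \<bullet> mean k \<omega> \<partial>M)"
    using fY fm by (simp add: inner_diff_right)
  have YA: "integrable M (\<lambda>\<omega>. ?\<chi> \<omega> * (norm (Y k \<omega>))\<^sup>2)"
    using integrable_mult_indicator[OF sets_F[OF A] Y_square[of k]] by simp
  define R where "R \<omega> = ?\<chi> \<omega> * U_at k \<omega> + \<gamma> k * (f \<omega> \<bullet> Y k \<omega>) + l * (\<gamma> k)\<^sup>2 * (?\<chi> \<omega> * (norm (Y k \<omega>))\<^sup>2)" for \<omega>
  have R: "integrable M R"
    unfolding R_def using UA fY YA by (intro Bochner_Integration.integrable_add integrable_mult_right)
  have le_R: "?\<chi> \<omega> * U_at (Suc k) \<omega> \<le> R \<omega>" if "\<omega> \<in> space M" for \<omega>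
    using descent[of "w (Suc k) \<omega>" "w k \<omega>"] recursion[OF that, of k]
    by (auto simp: R_def f_def power_mult_distrib algebra_simps split: split_indicator)
  show int: "integrable M (\<lambda>\<omega>. ?\<chi> \<omega> * U_at (Suc k) \<omega>)"
  proof (rule Bochner_Integration.integrable_bound[OF R])
    show "AE \<omega> in M. norm (?\<chi> \<omega> * U_at (Suc k) \<omega>) \<le> norm (R \<omega>)"
    proof (rule AE_I2)
      fix \<omega> assume "\<omega> \<in> space M"
      moreover have "0 \<le> ?\<chi> \<omega> * U_at (Suc k) \<omega>" using U_nonneg by (simp split: split_indicator)
      ultimately show "norm (?\<chi> \<omega> * U_at (Suc k) \<omega>) \<le> norm (R \<omega>)" using le_R by fastforce
    qed
  qed measurable
  have lin: "integrable M (\<lambda>\<omega>. ?\<chi> \<omega> * (a + b * W_at k \<omega>))" for a b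
  proof -
    have "integrable M (\<lambda>\<omega>. a * ?\<chi> \<omega> + b * (?\<chi> \<omega> * W_at k \<omega>))"
      using WA iA by (intro Bochner_Integration.integrable_add integrable_mult_right)
    then show ?thesis by (simp add: algebra_simps)
  qed
  assume k: "k0 \<le> k"
  let ?a = "\<beta> k" and ?b = "\<theta> k - \<rho>"
  have "(\<integral>\<omega>. ?\<chi> \<omega> * U_at (Suc k) \<omega> \<partial>M) \<le> (\<integral>\<omega>. R \<omega> \<partial>M)"
    using le_R by (intro integral_mono int R)
  also have "\<dots> = (\<integral>\<omega>. ?\<chi> \<omega> * U_at k \<omega> \<partial>M) + \<gamma> k * (\<integral>\<omega>. f \<omega> \<bullet> mean k \<omega> \<partial>M)
      + l * (\<gamma> k)\<^sup>2 * (\<integral>\<omega>. ?\<chi> \<omega> * (norm (Y k \<omega>))\<^sup>2 \<partial>M)"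
    unfolding R_def using UA fY YA by (simp add: swap)
  also have "(\<integral>\<omega>. f \<omega> \<bullet> mean k \<omega> \<partial>M) \<le> (\<integral>\<omega>. ?\<chi> \<omega> * (?a + ?b * W_at k \<omega>) \<partial>M)"
  proof (rule integral_mono_AE[OF fm lin])
    show "AE \<omega> in M. f \<omega> \<bullet> mean k \<omega> \<le> ?\<chi> \<omega> * (?a + ?b * W_at k \<omega>)"
      using bias_drift_le[OF k]
    proof eventually_elim
      case (elim \<omega>)
      then show ?case using drift_le[of "w k \<omega>"]
        by (auto simp: f_def inner_diff_right algebra_simps split: split_indicator)
    qed
  qed
  also have "(\<integral>\<omega>. ?\<chi> \<omega> * (norm (Y k \<omega>))\<^sup>2 \<partial>M) \<le> (\<integral>\<omega>. ?\<chi> \<omega> * (K0 + K1 * W_at k \<omega>) \<partial>M)"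
    by (rule oracle_second_moment[OF A WA])
  finally have "(\<integral>\<omega>. ?\<chi> \<omega> * U_at (Suc k) \<omega> \<partial>M) \<le> (\<integral>\<omega>. ?\<chi> \<omega> * U_at k \<omega> \<partial>M)
      + (\<gamma> k * (\<integral>\<omega>. ?\<chi> \<omega> * (?a + ?b * W_at k \<omega>) \<partial>M)
      + l * (\<gamma> k)\<^sup>2 * (\<integral>\<omega>. ?\<chi> \<omega> * (K0 + K1 * W_at k \<omega>) \<partial>M))"
    using \<gamma>_pos[of k] constants_nonneg by (simp add: mult_left_mono)
  also have "\<gamma> k * (\<integral>\<omega>. ?\<chi> \<omega> * (?a + ?b * W_at k \<omega>) \<partial>M)
      + l * (\<gamma> k)\<^sup>2 * (\<integral>\<omega>. ?\<chi> \<omega> * (K0 + K1 * W_at k \<omega>) \<partial>M)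
      = (\<integral>\<omega>. \<gamma> k * (?\<chi> \<omega> * (?a + ?b * W_at k \<omega>)) + l * (\<gamma> k)\<^sup>2 * (?\<chi> \<omega> * (K0 + K1 * W_at k \<omega>)) \<partial>M)"
    using lin by simp
  also have "\<dots> \<le> (\<integral>\<omega>. \<gamma> k * \<beta> k + l * K0 * (\<gamma> k)\<^sup>2 \<partial>M)"
  proof (rule integral_mono)
    fix \<omega>
    have c: "0 \<le> \<gamma> k * \<beta> k + l * K0 * (\<gamma> k)\<^sup>2"
      using \<gamma>_pos[of k] \<beta>_nonneg[of k] K_nonneg constants_nonneg by simp
    have "\<theta> k - \<rho> + l * \<gamma> k * K1 \<le> 0" using absorbed[OF k] by (simp add: K1_def)
    then have "\<gamma> k * W_at k \<omega> * (\<theta> k - \<rho> + l * \<gamma> k * K1) \<le> 0"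
      using \<gamma>_pos[of k] W_nonneg by (intro mult_nonneg_nonpos) auto
    then show "\<gamma> k * (?\<chi> \<omega> * (?a + ?b * W_at k \<omega>)) + l * (\<gamma> k)\<^sup>2 * (?\<chi> \<omega> * (K0 + K1 * W_at k \<omega>))
        \<le> \<gamma> k * \<beta> k + l * K0 * (\<gamma> k)\<^sup>2"
      using c by (auto simp: power2_eq_square algebra_simps split: split_indicator)
  qed (use lin in auto)
  also have "\<dots> = \<gamma> k * \<beta> k + l * K0 * (\<gamma> k)\<^sup>2" by (simp add: prob_space)
  finally show "(\<integral>\<omega>. ?\<chi> \<omega> * U_at (Suc k) \<omega> \<partial>M)
      \<le> (\<integral>\<omega>. ?\<chi> \<omega> * U_at k \<omega> \<partial>M) + (\<gamma> k * \<beta> k + l * K0 * (\<gamma> k)\<^sup>2)" by simp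
qed

definition excess :: "nat \<Rightarrow> real" where "excess k = \<gamma> k * \<beta> k + l * K0 * (\<gamma> k)\<^sup>2"

lemma excess_nonneg: "0 \<le> excess k"
  using \<gamma>_pos[of k] \<beta>_nonneg[of k] K_nonneg constants_nonneg by (simp add: excess_def)

lemma excess_summable: "summable excess"
  unfolding excess_def using \<beta>_summable \<gamma>_square by (intro summable_add summable_mult)

text \<open>The expectations obey the recursion of \<open>almost_decreasing_convergent\<close>, so they even converge. Before
  the index \<open>k0\<close> only their finiteness is used.\<close>

theorem expectation_bounded:
  assumes "integrable M (U_at 0)"
  shows "integrable M (U_at k)" "bdd_above (range (\<lambda>k. \<integral>\<omega>. U_at k \<omega> \<partial>M))"
proof -
  have sp: "space M \<in> sets (F k)" for k using sets.top[of "F k"] by simp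
  have drop: "integrable M (\<lambda>\<omega>. indicator (space M) \<omega> * U_at k \<omega>) \<longleftrightarrow> integrable M (U_at k)"
    "(\<integral>\<omega>. indicator (space M) \<omega> * U_at k \<omega> \<partial>M) = (\<integral>\<omega>. U_at k \<omega> \<partial>M)" for k
    by (auto intro!: Bochner_Integration.integrable_cong Bochner_Integration.integral_cong)
  show int: "integrable M (U_at k)" for k
  proof (induction k)
    case (Suc k) then show ?case using U_integrable_step[OF sp, of k] by (simp add: drop)
  qed (rule assms)
  define u where "u k = (\<integral>\<omega>. U_at k \<omega> \<partial>M)" for k
  have "u (Suc k) \<le> u k + excess k" if "k0 \<le> k" for k
    using U_drift[OF sp _ that] int by (simp add: drop u_def excess_def)
  moreover have "0 \<le> u k" for k unfolding u_def using U_nonneg by simp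
  ultimately have "convergent u" by (rule almost_decreasing_convergent[OF _ excess_summable])
  then have "Bseq u" by (rule convergent_imp_Bseq)
  then show "bdd_above (range (\<lambda>k. \<integral>\<omega>. U_at k \<omega> \<partial>M))"
    unfolding u_def[symmetric] Bseq_def bdd_above_def by (auto simp: abs_le_iff)
qed

text \<open>The maximal inequality is applied on the events \<open>U_at k0 \<omega> \<le> N\<close>, on each of which the integral of
  \<open>U_at k0\<close> is at most \<open>N\<close>. These events exhaust the space.\<close>

lemma U_at_bounded: "AE \<omega> in M. \<exists>R::nat. \<forall>k. U_at k \<omega> \<le> real R"
proof -
  define T where "T = (\<Sum>k. excess (k + k0))"
  have T: "(\<Sum>k. ennreal (excess (k + k0))) = ennreal T"
    unfolding T_def using excess_summable excess_nonneg by (intro suminf_ennreal2) (auto simp: summable_iff_shift)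
  have T0: "0 \<le> T" unfolding T_def using excess_summable excess_nonneg
    by (intro suminf_nonneg) (auto simp: summable_iff_shift)
  have maxi: "ennreal (real R) * emeasure M {\<omega>\<in>{\<omega>\<in>space M. U_at k0 \<omega> \<le> real N}. \<exists>k\<ge>k0. ennreal (real R) \<le> ennreal (U_at k \<omega>)}
      \<le> ennreal (real N + T)" for R N :: nat
  proof -
    let ?B = "{\<omega>\<in>space M. U_at k0 \<omega> \<le> real N}"
    have B: "?B \<in> sets (F k0)"
    proof -
      have "{\<omega>\<in>space (F k0). U_at k0 \<omega> \<le> real N} \<in> sets (F k0)" by measurable
      then show ?thesis by simp
    qed
    have "ennreal (real R) * emeasure M {\<omega>\<in>?B. \<exists>k\<ge>k0. ennreal (real R) \<le> ennreal (U_at k \<omega>)}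
        \<le> (\<integral>\<^sup>+\<omega>. ennreal (U_at k0 \<omega>) * indicator ?B \<omega> \<partial>M) + (\<Sum>k. ennreal (excess (k + k0)))"
    proof (rule maximal_inequality[OF _ B])
      fix k A assume k: "k0 \<le> k" and A: "A \<in> sets (F k)"
      note [measurable] = sets_F[OF A]
      have eq: "ennreal (U_at j \<omega>) * indicator A \<omega> = ennreal (indicator A \<omega> * U_at j \<omega>)" for j \<omega>
        by (simp split: split_indicator)
      show "(\<integral>\<^sup>+\<omega>. ennreal (U_at (Suc k) \<omega>) * indicator A \<omega> \<partial>M)
          \<le> (\<integral>\<^sup>+\<omega>. ennreal (U_at k \<omega>) * indicator A \<omega> \<partial>M) + ennreal (excess k)"
      proof (cases "(\<integral>\<^sup>+\<omega>. ennreal (U_at k \<omega>) * indicator A \<omega> \<partial>M) = \<infinity>")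
        case False
        have nn: "0 \<le> indicator A \<omega> * U_at j \<omega>" for j \<omega>
          using U_nonneg by (simp split: split_indicator)
        have int: "integrable M (\<lambda>\<omega>. indicator A \<omega> * U_at k \<omega>)"
          using False nn by (intro integrableI_nonneg) (auto simp: eq less_top)
        have "(\<integral>\<^sup>+\<omega>. ennreal (U_at j \<omega>) * indicator A \<omega> \<partial>M) = ennreal (\<integral>\<omega>. indicator A \<omega> * U_at j \<omega> \<partial>M)"
          if "integrable M (\<lambda>\<omega>. indicator A \<omega> * U_at j \<omega>)" for j
          unfolding eq using that nn by (intro nn_integral_eq_integral) auto
        with int U_integrable_step[OF A int] U_drift[OF A int k] excess_nonneg[of k] nn show ?thesis
          by (simp add: excess_def ennreal_plus[symmetric] del: ennreal_plus)
      qed simp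
    qed measurable
    also have "(\<integral>\<^sup>+\<omega>. ennreal (U_at k0 \<omega>) * indicator ?B \<omega> \<partial>M) \<le> (\<integral>\<^sup>+\<omega>. ennreal (real N) \<partial>M)"
      by (intro nn_integral_mono) (auto split: split_indicator intro!: ennreal_leI)
    finally show ?thesis using T T0 by (simp add: emeasure_space_1 ennreal_plus add_right_mono)
  qed
  have "AE \<omega> in M. U_at k0 \<omega> \<le> real N \<longrightarrow> (\<exists>R::nat. \<forall>k\<ge>k0. U_at k \<omega> < real R)" for N :: nat
  proof -
    let ?E = "\<lambda>R::nat. {\<omega>\<in>{\<omega>\<in>space M. U_at k0 \<omega> \<le> real N}. \<exists>k\<ge>k0. ennreal (real R) \<le> ennreal (U_at k \<omega>)}"
    have E [measurable]: "?E R \<in> sets M" for R by measurable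
    define p where "p = measure M (\<Inter>R. ?E R)"
    have p_le: "real R * p \<le> real N + T" for R
    proof -
      have "ennreal (real R) * ennreal p \<le> ennreal (real R) * emeasure M (?E R)"
        unfolding p_def emeasure_eq_measure[symmetric] by (intro mult_left_mono emeasure_mono) auto
      also have "\<dots> \<le> ennreal (real N + T)" by (rule maxi)
      finally have "ennreal (real R * p) \<le> ennreal (real N + T)"
        by (simp add: ennreal_mult' del: ennreal_plus)
      then show ?thesis using T0 by (simp del: ennreal_plus)
    qed
    have "p = 0"
    proof -
      have "\<not> 0 < p"
      proof
        assume "0 < p"
        then obtain R :: nat where "real N + T < real R * p" using reals_Archimedean3 by blast
        with p_le[of R] show False by simp
      qed
      then show ?thesis unfolding p_def by (simp add: zero_less_measure_iff)
    qed
    then have "(\<Inter>R. ?E R) \<in> null_sets M"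
      by (intro null_setsI) (auto simp: p_def emeasure_eq_measure)
    then show ?thesis
      by (rule AE_I') (use U_nonneg in \<open>auto simp: not_less ennreal_le_iff\<close>)
  qed
  then have "AE \<omega> in M. \<forall>N::nat. U_at k0 \<omega> \<le> real N \<longrightarrow> (\<exists>R::nat. \<forall>k\<ge>k0. U_at k \<omega> < real R)"
    unfolding AE_all_countable by blast
  then show ?thesis
  proof eventually_elim
    case (elim \<omega>)
    obtain N :: nat where "U_at k0 \<omega> \<le> real N" using real_arch_simple by blast
    with elim obtain R :: nat where R: "\<And>k. k0 \<le> k \<Longrightarrow> U_at k \<omega> < real R" by blast
    obtain R' :: nat where R': "(\<Sum>k<k0. U_at k \<omega>) \<le> real R'" using real_arch_simple by blast
    have "U_at k \<omega> \<le> real (R + R')" for k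
    proof (cases "k0 \<le> k")
      case True then show ?thesis using R[of k] by simp
    next
      case False
      then have "U_at k \<omega> \<le> (\<Sum>k<k0. U_at k \<omega>)" using U_nonneg by (intro member_le_sum) auto
      with R' show ?thesis by simp
    qed
    then show ?case by blast
  qed
qed

text \<open>The event that \<open>U_at\<close> has not exceeded \<open>R\<close> so far. On it \<open>W_at\<close> and the gradient are bounded, so
  the noise has bounded variance; almost every path stays in it for ever for some \<open>R\<close>.\<close>

definition confined :: "nat \<Rightarrow> nat \<Rightarrow> 'a set" where
  "confined R k = {\<omega>\<in>space M. \<forall>j\<le>k. U_at j \<omega> \<le> real R}"

lemma confined_sets: "confined R k \<in> sets (F k)"
proof -
  have 1: "{\<omega>\<in>space (F k). U_at j \<omega> \<le> real R} \<in> sets (F k)" if "j \<le> k" for j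
  proof -
    have [measurable]: "w j \<in> borel_measurable (F k)" by (rule measurable_F_mono[OF w_adapted that])
    show ?thesis by measurable
  qed
  have 2: "confined R k = (\<Inter>j\<in>{..k}. {\<omega>\<in>space (F k). U_at j \<omega> \<le> real R})"
    by (auto simp: confined_def)
  show ?thesis unfolding 2 using 1 by (intro sets.finite_INT) auto
qed

lemma confined_integrable: "integrable M (\<lambda>\<omega>. indicator (confined R k) \<omega> * U_at k \<omega>)"
proof (rule Bochner_Integration.integrable_bound)
  note [measurable] = sets_F[OF confined_sets[of R k]]
  show "integrable M (\<lambda>\<omega>. real R)" by simp
  show "AE \<omega> in M. norm (indicator (confined R k) \<omega> * U_at k \<omega>) \<le> norm (real R)"
    using U_nonneg by (auto simp: confined_def split: split_indicator)
  show "(\<lambda>\<omega>. indicator (confined R k) \<omega> * U_at k \<omega>) \<in> borel_measurable M" by measurable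
qed

lemma confined_W_integral:
  assumes "0 \<le> a" "0 \<le> b"
  shows "(\<integral>\<omega>. indicator (confined R k) \<omega> * (a + b * W_at k \<omega>) \<partial>M) \<le> a + b * (1 + C * real R)"
proof -
  have "(\<integral>\<omega>. indicator (confined R k) \<omega> * (a + b * W_at k \<omega>) \<partial>M) \<le> (\<integral>\<omega>. a + b * (1 + C * real R) \<partial>M)"
  proof (rule integral_mono_AE')
    show "AE \<omega> in M. indicator (confined R k) \<omega> * (a + b * W_at k \<omega>) \<le> a + b * (1 + C * real R)"
    proof (rule AE_I2)
      fix \<omega>
      show "indicator (confined R k) \<omega> * (a + b * W_at k \<omega>) \<le> a + b * (1 + C * real R)"
      proof (cases "\<omega> \<in> confined R k")
        case True
        then have "C * U_at k \<omega> \<le> C * real R"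
          using constants_nonneg by (intro mult_left_mono) (auto simp: confined_def)
        with W_le[of "w k \<omega>"] have "b * W_at k \<omega> \<le> b * (1 + C * real R)"
          using assms by (intro mult_left_mono) auto
        with True show ?thesis by simp
      qed (use assms constants_nonneg in auto)
    qed
    show "AE \<omega> in M. 0 \<le> a + b * (1 + C * real R)"
      using assms constants_nonneg by auto
  qed simp
  then show ?thesis by (simp add: prob_space)
qed

text \<open>The weight \<open>\<xi> k\<close> and the event \<open>confined R k\<close> are known at index \<open>k\<close>, so the weighted noise is still
  orthogonal to the past, and its variance is at most a constant multiple of \<open>(\<gamma> k)\<^sup>2\<close>.\<close>

lemma confined_noise_summable:
  fixes \<xi> :: "nat \<Rightarrow> 'a \<Rightarrow> real ^ 'n"
  assumes \<xi>: "\<And>k. \<xi> k \<in> borel_measurable (F k)"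
    and le: "\<And>k \<omega>. \<omega> \<in> confined R k \<Longrightarrow> (norm (\<xi> k \<omega>))\<^sup>2 \<le> K"
  shows "AE \<omega> in M. summable (\<lambda>k. indicator (confined R k) \<omega> * (\<gamma> k * (\<xi> k \<omega> \<bullet> noise k \<omega>)))"
proof -
  define D where "D k \<omega> = indicator (confined R k) \<omega> * (\<gamma> k * (\<xi> k \<omega> \<bullet> noise k \<omega>))" for k \<omega>
  define K' where "K' = max K 0"
  have K': "0 \<le> K'" "\<And>k \<omega>. \<omega> \<in> confined R k \<Longrightarrow> (norm (\<xi> k \<omega>))\<^sup>2 \<le> K'"
    using le by (auto simp: K'_def le_max_iff_disj)
  note confined_F [measurable] = confined_sets[of R]
  note [measurable] = sets_F[OF confined_sets[of R]]
  note [measurable] = \<xi> measurable_F[OF \<xi>]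
  have D_F: "D k \<in> borel_measurable (F (Suc k))" for k
  proof -
    have [measurable]: "\<xi> k \<in> borel_measurable (F (Suc k))" "confined R k \<in> sets (F (Suc k))"
      using measurable_F_mono[OF \<xi>, of k "Suc k"] sets_F_mono[OF confined_sets, of k "Suc k"] by auto
    note [measurable] = noise_adapted
    show ?thesis unfolding D_def by measurable
  qed
  have [measurable]: "D k \<in> borel_measurable M" for k by (rule measurable_F[OF D_F])
  have iN: "integrable M (\<lambda>\<omega>. indicator (confined R k) \<omega> * (norm (noise k \<omega>))\<^sup>2)" for k
    using integrable_mult_indicator[OF sets_F[OF confined_sets] noise_square[of k]] by simp
  have D2_le: "(D k \<omega>)\<^sup>2 \<le> (\<gamma> k)\<^sup>2 * K' * (indicator (confined R k) \<omega> * (norm (noise k \<omega>))\<^sup>2)" for k \<omega>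
  proof (cases "\<omega> \<in> confined R k")
    case True
    have "(\<xi> k \<omega> \<bullet> noise k \<omega>)\<^sup>2 \<le> (norm (\<xi> k \<omega>))\<^sup>2 * (norm (noise k \<omega>))\<^sup>2"
      using Cauchy_Schwarz_ineq[of "\<xi> k \<omega>" "noise k \<omega>"] by (simp add: power2_norm_eq_inner)
    also have "\<dots> \<le> K' * (norm (noise k \<omega>))\<^sup>2" using K' True by (intro mult_right_mono) auto
    finally show ?thesis using True by (simp add: D_def power_mult_distrib mult_left_mono mult.assoc)
  qed (simp add: D_def)
  have D2: "integrable M (\<lambda>\<omega>. (D k \<omega>)\<^sup>2)" for k
    by (rule Bochner_Integration.integrable_bound[OF integrable_mult_right[OF iN[of k], of "(\<gamma> k)\<^sup>2 * K'"]])
       (use D2_le in \<open>auto intro!: AE_I2 order_trans[OF D2_le]\<close>)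
  define Q where "Q = K' * (s0 + s1 * (1 + C * real R))"
  have D2_int: "(\<integral>\<omega>. (D k \<omega>)\<^sup>2 \<partial>M) \<le> (\<gamma> k)\<^sup>2 * Q" for k
  proof -
    have "(\<integral>\<omega>. (D k \<omega>)\<^sup>2 \<partial>M) \<le> (\<integral>\<omega>. (\<gamma> k)\<^sup>2 * K' * (indicator (confined R k) \<omega> * (norm (noise k \<omega>))\<^sup>2) \<partial>M)"
      using D2 iN D2_le by (intro integral_mono) auto
    also have "\<dots> = (\<gamma> k)\<^sup>2 * K' * (\<integral>\<omega>. indicator (confined R k) \<omega> * (norm (noise k \<omega>))\<^sup>2 \<partial>M)" by simp
    also have "\<dots> \<le> (\<gamma> k)\<^sup>2 * K' * (s0 + s1 * (1 + C * real R))"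
      using order_trans[OF noise_second_moment[OF confined_sets W_integrable_on[OF sets_F[OF confined_sets] confined_integrable]]
          confined_W_integral] K' constants_nonneg
      by (intro mult_left_mono) auto
    finally show ?thesis by (simp add: Q_def mult.assoc)
  qed
  have "AE \<omega> in M. summable (\<lambda>k. D k \<omega>)"
  proof (rule square_integrable_martingale_converges[OF D_F D2])
    fix k and f :: "'a \<Rightarrow> real" assume f: "f \<in> borel_measurable (F k)" and f2: "integrable M (\<lambda>\<omega>. (f \<omega>)\<^sup>2)"
    note [measurable] = f measurable_F[OF f]
    define g where "g \<omega> = (f \<omega> * (indicator (confined R k) \<omega> * \<gamma> k)) *\<^sub>R \<xi> k \<omega>" for \<omega>
    have g: "g \<in> borel_measurable (F k)" unfolding g_def by measurable
    have "integrable M (\<lambda>\<omega>. (norm (g \<omega>))\<^sup>2)"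
    proof (rule Bochner_Integration.integrable_bound[OF integrable_mult_right[OF f2, of "(\<gamma> k)\<^sup>2 * K'"]])
      have "(norm (g \<omega>))\<^sup>2 \<le> (\<gamma> k)\<^sup>2 * K' * (f \<omega>)\<^sup>2" for \<omega>
      proof (cases "\<omega> \<in> confined R k")
        case True
        then have "(norm (g \<omega>))\<^sup>2 = ((\<gamma> k)\<^sup>2 * (f \<omega>)\<^sup>2) * (norm (\<xi> k \<omega>))\<^sup>2"
          by (simp add: g_def power_mult_distrib)
        also have "\<dots> \<le> ((\<gamma> k)\<^sup>2 * (f \<omega>)\<^sup>2) * K'" using K' True by (intro mult_left_mono) auto
        finally show ?thesis by (simp add: mult_ac)
      qed (use K' in \<open>simp add: g_def\<close>)
      then show "AE \<omega> in M. norm ((norm (g \<omega>))\<^sup>2) \<le> norm ((\<gamma> k)\<^sup>2 * K' * (f \<omega>)\<^sup>2)"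
        using K' by (auto intro!: AE_I2)
      show "(\<lambda>\<omega>. (norm (g \<omega>))\<^sup>2) \<in> borel_measurable M"
        using measurable_F[OF g] by measurable
    qed
    from vec_cond_exp_orthogonal[OF Y_measurable Y_square g this]
    show "(\<integral>\<omega>. f \<omega> * D k \<omega> \<partial>M) = 0" by (simp add: g_def D_def mult.assoc)
  next
    show "summable (\<lambda>k. \<integral>\<omega>. (D k \<omega>)\<^sup>2 \<partial>M)"
      using D2_int by (intro summable_comparison_test'[OF summable_mult2[OF \<gamma>_square, of Q]]) auto
  qed
  then show ?thesis by (simp add: D_def)
qed

lemma confined_square_summable:
  "AE \<omega> in M. summable (\<lambda>k. indicator (confined R k) \<omega> * ((\<gamma> k)\<^sup>2 * (norm (Y k \<omega>))\<^sup>2))"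
proof -
  note [measurable] = sets_F[OF confined_sets[of R]]
  define q where "q k \<omega> = (\<gamma> k)\<^sup>2 * (indicator (confined R k) \<omega> * (norm (Y k \<omega>))\<^sup>2)" for k \<omega>
  have [measurable]: "q k \<in> borel_measurable M" for k unfolding q_def by measurable
  define Q where "Q = K0 + K1 * (1 + C * real R)"
  have Q0: "0 \<le> Q" using K_nonneg constants_nonneg by (simp add: Q_def)
  have iq: "integrable M (q k)" for k
    unfolding q_def using integrable_mult_indicator[OF sets_F[OF confined_sets] Y_square[of k]] by simp
  have le: "(\<integral>\<omega>. q k \<omega> \<partial>M) \<le> (\<gamma> k)\<^sup>2 * Q" for k
  proof -
    have "(\<integral>\<omega>. q k \<omega> \<partial>M) = (\<gamma> k)\<^sup>2 * (\<integral>\<omega>. indicator (confined R k) \<omega> * (norm (Y k \<omega>))\<^sup>2 \<partial>M)"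
      by (simp add: q_def)
    also have "\<dots> \<le> (\<gamma> k)\<^sup>2 * Q"
      using order_trans[OF oracle_second_moment[OF confined_sets W_integrable_on[OF sets_F[OF confined_sets] confined_integrable]]
          confined_W_integral] K_nonneg
      by (intro mult_left_mono) (auto simp: Q_def)
    finally show ?thesis .
  qed
  have "(\<integral>\<^sup>+\<omega>. (\<Sum>k. ennreal (q k \<omega>)) \<partial>M) = (\<Sum>k. \<integral>\<^sup>+\<omega>. ennreal (q k \<omega>) \<partial>M)"
    by (rule nn_integral_suminf) measurable
  also have "\<dots> \<le> (\<Sum>k. ennreal ((\<gamma> k)\<^sup>2 * Q))"
  proof (intro suminf_le allI)
    fix k
    have "(\<integral>\<^sup>+\<omega>. ennreal (q k \<omega>) \<partial>M) = ennreal (\<integral>\<omega>. q k \<omega> \<partial>M)"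
      by (rule nn_integral_eq_integral[OF iq]) (simp add: q_def)
    then show "(\<integral>\<^sup>+\<omega>. ennreal (q k \<omega>) \<partial>M) \<le> ennreal ((\<gamma> k)\<^sup>2 * Q)" using le by (simp add: ennreal_leI)
  qed auto
  also have "\<dots> = ennreal (\<Sum>k. (\<gamma> k)\<^sup>2 * Q)"
    using Q0 summable_mult2[OF \<gamma>_square] by (intro suminf_ennreal2) auto
  also have "\<dots> < \<infinity>" by simp
  finally have "AE \<omega> in M. (\<Sum>k. ennreal (q k \<omega>)) \<noteq> \<infinity>"
    by (intro nn_integral_PInf_AE) auto
  then show ?thesis
  proof eventually_elim
    case (elim \<omega>)
    then have "summable (\<lambda>k. q k \<omega>)"
      by (intro summable_suminf_not_top) (auto simp: q_def)
    then show ?case by (simp add: q_def mult_ac)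
  qed
qed

text \<open>A path with \<open>U_at k \<omega> \<le> R\<close> for all \<open>k\<close> does not notice the confinement, so the confined sums are
  the actual ones. The convergence of \<open>U_at\<close> follows pathwise: the descent inequality bounds its
  increments by terms whose sums converge.\<close>

theorem almost_sure_behaviour:
  "AE \<omega> in M. (\<exists>R. \<forall>k. U_at k \<omega> \<le> R) \<and> summable (\<lambda>k. \<gamma> k *\<^sub>R noise k \<omega>) \<and> convergent (\<lambda>k. U_at k \<omega>)"
proof -
  \<comment> \<open>Convergence of the vector sums is obtained from the coordinate directions \<open>axis i 1\<close>.\<close>
  have 1: "AE \<omega> in M. \<forall>R i. summable (\<lambda>k. indicator (confined R k) \<omega> * (\<gamma> k * (axis i 1 \<bullet> noise k \<omega>)))"
  proof -
    have "AE \<omega> in M. \<forall>i\<in>UNIV. summable (\<lambda>k. indicator (confined R k) \<omega> * (\<gamma> k * (axis i 1 \<bullet> noise k \<omega>)))" for R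
      by (intro AE_finite_allI confined_noise_summable[where K=1]) auto
    then show ?thesis by (simp add: AE_all_countable)
  qed
  have 2: "AE \<omega> in M. \<forall>R. summable (\<lambda>k. indicator (confined R k) \<omega> * (\<gamma> k * (gradU (w k \<omega>) \<bullet> noise k \<omega>)))"
  proof -
    have "AE \<omega> in M. summable (\<lambda>k. indicator (confined R k) \<omega> * (\<gamma> k * (gradU (w k \<omega>) \<bullet> noise k \<omega>)))" for R
    proof (rule confined_noise_summable[where K="4 * l * real R"])
      fix k \<omega> assume "\<omega> \<in> confined R k"
      then have "4 * l * U_at k \<omega> \<le> 4 * l * real R"
        using constants_nonneg by (intro mult_left_mono) (auto simp: confined_def)
      then show "(norm (gradU (w k \<omega>)))\<^sup>2 \<le> 4 * l * real R" using gradU_le order_trans by blast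
    qed measurable
    then show ?thesis by (simp add: AE_all_countable)
  qed
  have 3: "AE \<omega> in M. \<forall>R. summable (\<lambda>k. indicator (confined R k) \<omega> * ((\<gamma> k)\<^sup>2 * (norm (Y k \<omega>))\<^sup>2))"
    using confined_square_summable by (simp add: AE_all_countable)
  have 4: "AE \<omega> in M. \<forall>k. k0 \<le> k \<longrightarrow> gradU (w k \<omega>) \<bullet> (mean k \<omega> - h (w k \<omega>)) \<le> \<beta> k + \<theta> k * W_at k \<omega>"
    using bias_drift_le by (simp add: AE_all_countable)
  show ?thesis
    using 1 2 3 4 U_at_bounded AE_space
  proof eventually_elim
    case (elim \<omega>)
    then obtain R :: nat where R: "\<And>k. U_at k \<omega> \<le> real R" by blast
    with elim have conf [simp]: "\<omega> \<in> confined R k" for k by (simp add: confined_def)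
    have s1: "summable (\<lambda>k. \<gamma> k * noise k \<omega> $ i)" for i
      using elim(1)[rule_format, of R i] by (simp add: inner_axis')
    have s2: "summable (\<lambda>k. \<gamma> k * (gradU (w k \<omega>) \<bullet> noise k \<omega>))"
      using elim(2)[rule_format, of R] by simp
    have s3: "summable (\<lambda>k. (\<gamma> k)\<^sup>2 * (norm (Y k \<omega>))\<^sup>2)"
      using elim(3)[rule_format, of R] by simp
    have "convergent (\<lambda>n. \<Sum>k<n. \<gamma> k *\<^sub>R noise k \<omega>)"
    proof -
      have "(\<lambda>n. \<Sum>k<n. \<gamma> k *\<^sub>R noise k \<omega>) \<longlonglongrightarrow> (\<chi> i. \<Sum>k. \<gamma> k * noise k \<omega> $ i)"
        using summable_LIMSEQ[OF s1] by (intro vec_tendstoI) (simp add: sum_component)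
      then show ?thesis by (rule convergentI)
    qed
    then have noise: "summable (\<lambda>k. \<gamma> k *\<^sub>R noise k \<omega>)" by (simp add: summable_iff_convergent)
    define c where "c k = \<gamma> k * \<beta> k + \<gamma> k * (gradU (w k \<omega>) \<bullet> noise k \<omega>) + l * ((\<gamma> k)\<^sup>2 * (norm (Y k \<omega>))\<^sup>2)" for k
    have "convergent (\<lambda>k. U_at k \<omega>)"
    proof (rule almost_decreasing_convergent)
      show "summable c" unfolding c_def by (intro summable_add summable_mult \<beta>_summable s2 s3)
      fix k assume k: "k0 \<le> k"
      let ?g = "gradU (w k \<omega>)"
      have "?g \<bullet> Y k \<omega> = ?g \<bullet> h (w k \<omega>) + ?g \<bullet> (mean k \<omega> - h (w k \<omega>)) + ?g \<bullet> noise k \<omega>"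
        by (simp add: inner_diff_right)
      also have "\<dots> \<le> - \<rho> * W_at k \<omega> + (\<beta> k + \<theta> k * W_at k \<omega>) + ?g \<bullet> noise k \<omega>"
        using drift_le[of "w k \<omega>"] elim(4) k by (intro add_mono) auto
      also have "\<dots> \<le> \<beta> k + ?g \<bullet> noise k \<omega>"
      proof -
        have "0 \<le> l * \<gamma> k * (2 * s1 + 4 * c1 + 4 * B)"
          using constants_nonneg \<gamma>_pos[of k] by simp
        then have "\<theta> k \<le> \<rho>" using absorbed[OF k] by linarith
        then have "\<theta> k * W_at k \<omega> \<le> \<rho> * W_at k \<omega>" using W_nonneg by (rule mult_right_mono)
        then show ?thesis by simp
      qed
      finally have "\<gamma> k * (?g \<bullet> Y k \<omega>) \<le> \<gamma> k * (\<beta> k + ?g \<bullet> noise k \<omega>)"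
        using \<gamma>_pos[of k] by simp
      then show "U_at (Suc k) \<omega> \<le> U_at k \<omega> + c k"
        using descent[of "w (Suc k) \<omega>" "w k \<omega>"] recursion[of \<omega> k] elim(6)
        by (simp add: c_def power_mult_distrib distrib_left)
    qed (rule U_nonneg)
    with noise R show ?case by blast
  qed
qed

end

section \<open>Functions with Lipschitz gradient\<close>

lemma lipschitz_positive_constant:
  fixes f :: "'a::real_normed_vector \<Rightarrow> 'b::real_normed_vector"
  assumes "\<exists>K. K-lipschitz_on UNIV f"
  obtains L where "0 < L" "\<And>x y. norm (f x - f y) \<le> L * norm (x - y)"
proof -
  obtain K where K: "K-lipschitz_on UNIV f" using assms by blast
  have "norm (f x - f y) \<le> (K + 1) * norm (x - y)" for x y
    using lipschitz_on_normD[OF K, of x y, OF UNIV_I UNIV_I] norm_ge_zero[of "x - y"]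
    unfolding distrib_right mult_1_left by linarith
  then show thesis using that[of "K + 1"] lipschitz_on_nonneg[OF K] by simp
qed

text \<open>The constant \<open>l\<close> in place of the optimal \<open>l / 2\<close> lets the mean value theorem suffice.\<close>

lemma descent_lemma:
  fixes V :: "'a::real_inner \<Rightarrow> real"
  assumes V: "\<And>v. GDERIV V v :> gradV v" and lip: "\<And>x y. norm (gradV x - gradV y) \<le> l * norm (x - y)"
  shows "V y \<le> V x + gradV x \<bullet> (y - x) + l * (norm (y - x))\<^sup>2"
proof -
  define \<phi> where "\<phi> s = V (x + s *\<^sub>R (y - x))" for s :: real
  have d: "(\<phi> has_real_derivative gradV (x + s *\<^sub>R (y - x)) \<bullet> (y - x)) (at s)" for s
  proof -
    have "((\<lambda>s. x + s *\<^sub>R (y - x)) has_derivative (\<lambda>r. r *\<^sub>R (y - x))) (at s)"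
      by (auto intro!: derivative_eq_intros)
    moreover have "(V has_derivative (\<lambda>v. v \<bullet> gradV (x + s *\<^sub>R (y - x)))) (at (x + s *\<^sub>R (y - x)))"
      using V by (simp add: gderiv_def)
    ultimately have "(\<phi> has_derivative (\<lambda>r. (r *\<^sub>R (y - x)) \<bullet> gradV (x + s *\<^sub>R (y - x)))) (at s)"
      unfolding \<phi>_def by (rule has_derivative_compose)
    then show ?thesis
      by (simp add: has_field_derivative_def inner_commute mult_commute_abs)
  qed
  obtain s where s: "0 < s" "s < 1" and mv: "\<phi> 1 - \<phi> 0 = (1 - 0) * (gradV (x + s *\<^sub>R (y - x)) \<bullet> (y - x))"
    using MVT2[of 0 1 \<phi>, OF _ d] by auto
  have "(gradV (x + s *\<^sub>R (y - x)) - gradV x) \<bullet> (y - x) \<le> norm (gradV (x + s *\<^sub>R (y - x)) - gradV x) * norm (y - x)"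
    by (rule norm_cauchy_schwarz)
  also have "\<dots> \<le> (l * norm (s *\<^sub>R (y - x))) * norm (y - x)"
    using lip[of "x + s *\<^sub>R (y - x)" x] by (intro mult_right_mono) auto
  also have "\<dots> = s * (l * (norm (y - x))\<^sup>2)" using s by (simp add: power2_eq_square)
  also have "\<dots> \<le> l * (norm (y - x))\<^sup>2"
  proof -
    have "0 \<le> l * norm (y - x)" using order_trans[OF norm_ge_zero lip[of y x]] .
    then have "0 \<le> l * norm (y - x) * norm (y - x)" by simp
    then show ?thesis using s by (simp add: power2_eq_square mult_left_le_one_le mult.assoc)
  qed
  finally show ?thesis using mv by (simp add: \<phi>_def inner_diff_left)
qed

text \<open>A step of length \<open>1 / (2 * l)\<close> against the gradient cannot lead below the lower bound.\<close>

lemma gradient_square_le: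
  fixes V :: "'a::real_inner \<Rightarrow> real"
  assumes V: "\<And>v. GDERIV V v :> gradV v" and lip: "\<And>x y. norm (gradV x - gradV y) \<le> l * norm (x - y)"
    and l: "0 < l" and low: "\<And>v. v0 \<le> V v"
  shows "(norm (gradV x))\<^sup>2 \<le> 4 * l * (V x - v0)"
proof -
  let ?g = "gradV x"
  define y where "y = x - (1 / (2 * l)) *\<^sub>R ?g"
  have "v0 \<le> V x + ?g \<bullet> (y - x) + l * (norm (y - x))\<^sup>2"
    using descent_lemma[OF V lip, of y x] low[of y] by linarith
  also have "\<dots> = V x - (norm ?g)\<^sup>2 / (4 * l)"
    using l power2_norm_eq_inner[of ?g, unfolded power2_eq_square]
    by (simp add: y_def power2_norm_eq_inner power_mult_distrib field_simps power2_eq_square)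
  finally show ?thesis using l by (simp add: field_simps)
qed

text \<open>The dissipation is at most linear in the Lyapunov function, because
  \<open>(\<rho> * W)\<^sup>2 \<le> (norm g * norm u)\<^sup>2 \<le> 4 * l * U * (c0 + c1 * W)\<close>. It is therefore integrable together with
  \<open>U\<close> and bounded where \<open>U\<close> is.\<close>

lemma dissipation_le:
  fixes g u :: "'a::real_inner"
  assumes g: "(norm g)\<^sup>2 \<le> 4 * l * U" and u: "(norm u)\<^sup>2 \<le> c0 + c1 * W" and drift: "g \<bullet> u \<le> - \<rho> * W"
    and pos: "0 < \<rho>" "0 \<le> W" "0 \<le> c0" "0 \<le> c1" "0 \<le> l" "0 \<le> U"
  shows "W \<le> 1 + 4 * l * (c0 + c1) / \<rho>\<^sup>2 * U"
proof (cases "W \<le> 1")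
  case True
  have "0 \<le> 4 * l * (c0 + c1) / \<rho>\<^sup>2 * U" using pos by simp
  with True show ?thesis by linarith
next
  case False
  have "\<rho> * W \<le> \<bar>g \<bullet> u\<bar>" using drift by simp
  then have "(\<rho> * W)\<^sup>2 \<le> (g \<bullet> u)\<^sup>2" using pos by (simp add: abs_le_square_iff[symmetric])
  also have "\<dots> \<le> (norm g)\<^sup>2 * (norm u)\<^sup>2" using Cauchy_Schwarz_ineq[of g u] by (simp add: power2_norm_eq_inner)
  also have "\<dots> \<le> (4 * l * U) * (c0 + c1 * W)" using g u pos by (intro mult_mono) auto
  also have "\<dots> \<le> (4 * l * U) * ((c0 + c1) * W)"
  proof -
    have "c0 * 1 \<le> c0 * W" using False pos by (intro mult_left_mono) auto
    then show ?thesis using pos by (intro mult_left_mono) (auto simp: algebra_simps)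
  qed
  finally have "W * (\<rho>\<^sup>2 * W) \<le> W * (4 * l * (c0 + c1) * U)" by (simp add: power2_eq_square mult_ac)
  then have "\<rho>\<^sup>2 * W \<le> 4 * l * (c0 + c1) * U" using False by simp
  then have "W \<le> 4 * l * (c0 + c1) / \<rho>\<^sup>2 * U" using pos by (simp add: field_simps)
  then show ?thesis by simp
qed

section \<open>Weights that may be infinite\<close>

text \<open>Comparison with the finite positive weight \<open>min c 1\<close>; an infinite weight moreover allows only
  the products \<open>0\<close> and \<open>\<infinity>\<close>.\<close>

lemma weighted_null:
  fixes c :: ennreal and \<tau> :: "nat \<Rightarrow> real"
  assumes lim: "(\<lambda>k. c * ennreal (\<tau> k)) \<longlonglongrightarrow> 0" and c: "0 < c" and \<tau>: "\<And>k. 0 \<le> \<tau> k"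
  shows "\<tau> \<longlonglongrightarrow> 0" and "\<forall>\<^sub>F k in sequentially. c = \<infinity> \<longrightarrow> \<tau> k = 0"
proof -
  define d where "d = enn2real (min c 1)"
  have fin: "min c 1 < \<infinity>" by (simp add: min_less_iff_disj)
  have d: "0 < d" "ennreal d \<le> c"
    using c fin by (auto simp: d_def enn2real_positive_iff)
  have "(\<lambda>k. ennreal (d * \<tau> k)) \<longlonglongrightarrow> 0"
  proof (rule tendsto_sandwich[OF _ _ tendsto_const lim])
    have "ennreal (d * \<tau> k) \<le> c * ennreal (\<tau> k)" for k
      using d \<tau> by (simp add: ennreal_mult mult_right_mono)
    then show "\<forall>\<^sub>F k in sequentially. ennreal (d * \<tau> k) \<le> c * ennreal (\<tau> k)" by simp
  qed simp
  then have "(\<lambda>k. ennreal (d * \<tau> k)) \<longlonglongrightarrow> ennreal 0" by simp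
  then have "(\<lambda>k. d * \<tau> k) \<longlonglongrightarrow> 0"
    using d \<tau> by (subst (asm) tendsto_ennreal_iff) auto
  from tendsto_mult_left[OF this, of "1 / d"] show "\<tau> \<longlonglongrightarrow> 0" using d by simp
  have "\<forall>\<^sub>F k in sequentially. c * ennreal (\<tau> k) < 1"
    by (rule order_tendstoD(2)[OF lim]) simp
  then show "\<forall>\<^sub>F k in sequentially. c = \<infinity> \<longrightarrow> \<tau> k = 0"
  proof eventually_elim
    case (elim k)
    show ?case
    proof
      assume "c = \<infinity>"
      then have "ennreal (\<tau> k) = 0" using elim by (cases "ennreal (\<tau> k) = 0") (auto simp: ennreal_top_mult)
      then show "\<tau> k = 0" using \<tau>[of k] by simp
    qed
  qed
qed

lemma weighted_summable:
  fixes c :: ennreal and g r :: "nat \<Rightarrow> real"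
  assumes fin: "(\<Sum>k. ennreal (g k) * c * ennreal (r k)) < \<infinity>" and g: "\<And>k. 0 \<le> g k" and r: "\<And>k. 0 \<le> r k"
  shows "summable (\<lambda>k. g k * (enn2real c * r k))"
proof (rule summable_suminf_not_top)
  have c: "ennreal (enn2real c) \<le> c" by (cases c) auto
  have "ennreal (g k * (enn2real c * r k)) \<le> ennreal (g k) * c * ennreal (r k)" for k
  proof -
    have "ennreal (g k * (enn2real c * r k)) = ennreal (g k) * ennreal (enn2real c) * ennreal (r k)"
      using g r by (simp add: ennreal_mult mult.assoc)
    also have "\<dots> \<le> ennreal (g k) * c * ennreal (r k)" by (intro mult_mono c) auto
    finally show ?thesis .
  qed
  then have "(\<Sum>k. ennreal (g k * (enn2real c * r k))) \<le> (\<Sum>k. ennreal (g k) * c * ennreal (r k))"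
    by (intro suminf_le) auto
  then show "(\<Sum>k. ennreal (g k * (enn2real c * r k))) \<noteq> \<top>" using fin by (auto simp: top_unique)
qed (use g r in simp)

text \<open>The mixed term \<open>sqrt \<tau> * sqrt W\<close> is split by \<open>sqrt W \<le> 1 + W\<close> into a part without \<open>W\<close>, which will be
  summable, and a small multiple of \<open>W\<close>.\<close>

lemma bias_inner_le:
  fixes g d :: "'a::real_inner"
  assumes g: "norm g \<le> c * sqrt W" and d: "(norm d)\<^sup>2 \<le> \<tau> + \<tau>' * W"
    and pos: "0 \<le> c" "0 \<le> W" "0 \<le> \<tau>" "0 \<le> \<tau>'"
  shows "g \<bullet> d \<le> c * sqrt \<tau> + c * (sqrt \<tau> + sqrt \<tau>') * W"
proof -
  have "norm d \<le> sqrt (\<tau> + \<tau>' * W)" using real_le_rsqrt[OF d] .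
  also have "\<dots> \<le> sqrt \<tau> + sqrt (\<tau>' * W)" using pos by (intro sqrt_add_le_add_sqrt) auto
  finally have d': "norm d \<le> sqrt \<tau> + sqrt \<tau>' * sqrt W" by (simp add: real_sqrt_mult)
  have "g \<bullet> d \<le> norm g * norm d" by (rule norm_cauchy_schwarz)
  also have "\<dots> \<le> (c * sqrt W) * (sqrt \<tau> + sqrt \<tau>' * sqrt W)"
    using g d' pos by (intro mult_mono) auto
  also have "\<dots> = c * sqrt \<tau> * sqrt W + c * sqrt \<tau>' * W"
    using pos by (simp add: algebra_simps)
  also have "sqrt W \<le> 1 + W"
    using pos by (intro real_le_lsqrt) (auto simp: power2_eq_square algebra_simps)
  then have "c * sqrt \<tau> * sqrt W \<le> c * sqrt \<tau> * (1 + W)"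
    using pos by (intro mult_left_mono) auto
  finally show ?thesis by (simp add: algebra_simps)
qed

section \<open>The filtration generated by the data\<close>

lemma history_generators:
  assumes w0: "w0 \<in> borel_measurable M" and X: "\<forall>i\<ge>1. X i \<in> measurable M S"
  shows "space (history_algebra M S w0 X k) = space M"
    and "subalgebra M (history_algebra M S w0 X k)"
    and "subalgebra (history_algebra M S w0 X (Suc k)) (history_algebra M S w0 X k)"
    and "w0 \<in> borel_measurable (history_algebra M S w0 X k)"
    and "1 \<le> i \<Longrightarrow> i \<le> k \<Longrightarrow> X i \<in> measurable (history_algebra M S w0 X k) S"
proof -
  define G where "G k = {w0 -` A \<inter> space M | A. A \<in> sets borel} \<union>
        (\<Union>i\<in>{1..k}. {X i -` A \<inter> space M | A. A \<in> sets S})" for k :: nat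
  have H: "history_algebra M S w0 X k = sigma (space M) (G k)" for k
    by (simp add: history_algebra_def G_def)
  have G_M: "G k \<subseteq> sets M" for k
    unfolding G_def using measurable_sets[OF w0] measurable_sets[OF X[rule_format]] by auto
  have G_Pow: "G k \<subseteq> Pow (space M)" for k
    using G_M sets.sets_into_space by blast
  show sp: "space (history_algebra M S w0 X k) = space M" for k
    unfolding H by (rule space_measure_of[OF G_Pow])
  have st: "sets (history_algebra M S w0 X k) = sigma_sets (space M) (G k)" for k
    unfolding H by (rule sets_measure_of[OF G_Pow])
  show "subalgebra M (history_algebra M S w0 X k)"
    unfolding subalgebra_def sp st using sets.sigma_sets_subset[OF G_M] by simp
  have "G k \<subseteq> G (Suc k)" unfolding G_def by (intro Un_mono UN_mono order_refl) auto
  then show "subalgebra (history_algebra M S w0 X (Suc k)) (history_algebra M S w0 X k)"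
    unfolding subalgebra_def sp st using sigma_sets_mono' by simp
  have "w0 -` A \<inter> space M \<in> G k" if "A \<in> sets borel" for A
    using that by (auto simp: G_def)
  then show "w0 \<in> borel_measurable (history_algebra M S w0 X k)"
    unfolding measurable_def sp st by (auto intro: sigma_sets.Basic)
  assume i: "1 \<le> i" "i \<le> k"
  have "X i -` A \<inter> space M \<in> G k" if "A \<in> sets S" for A
    using that i by (auto simp: G_def)
  then show "X i \<in> measurable (history_algebra M S w0 X k) S"
    unfolding measurable_def sp st using measurable_space[OF X[rule_format, OF i(1)]] by (auto intro: sigma_sets.Basic)
qed

section \<open>Convergence of stochastic approximation\<close>

theorem theorem4:
  fixes M :: "'a measure" and S :: "'x measure"
    and h :: "real ^ 'n \<Rightarrow> real ^ 'n" and H :: "real ^ 'n \<Rightarrow> 'x \<Rightarrow> real ^ 'n"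
    and W V :: "real ^ 'n \<Rightarrow> real" and gradV :: "real ^ 'n \<Rightarrow> real ^ 'n"
    and X :: "nat \<Rightarrow> 'a \<Rightarrow> 'x" and w :: "nat \<Rightarrow> 'a \<Rightarrow> real ^ 'n"
    and \<gamma> \<tau>0 \<tau>1 :: "nat \<Rightarrow> real" and ch0 ch1 \<sigma>0 \<sigma>1 \<rho> :: real and cV :: ennreal
  defines "F \<equiv> history_algebra M S (w 0) X"
    and "Y \<equiv> (\<lambda>k \<omega>. H (w k \<omega>) (X (Suc k) \<omega>))"
    and "\<Phi> \<equiv> ode_flow h"
    and "\<Lambda>V \<equiv> {v. gradV v \<bullet> h v = 0}"
  assumes "prob_space M"
    and "h \<in> borel_measurable borel"
    and "(\<lambda>(v, x). H v x) \<in> borel_measurable (borel \<Otimes>\<^sub>M S)"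
    and "W \<in> borel_measurable borel" and "\<forall>v. 0 \<le> W v"
    and "\<forall>k\<ge>1. X k \<in> measurable M S"
    and "w 0 \<in> borel_measurable M"
    and "\<forall>k. \<forall>\<omega>\<in>space M. w (Suc k) \<omega> = w k \<omega> + \<gamma> (Suc k) *\<^sub>R H (w k \<omega>) (X (Suc k) \<omega>)"
    and "\<forall>k\<ge>1. 0 < \<gamma> k" and "\<forall>k\<ge>1. \<gamma> (Suc k) \<le> \<gamma> k"
    and "\<not> summable (\<lambda>k. \<gamma> (Suc k))" and "summable (\<lambda>k. (\<gamma> (Suc k))\<^sup>2)"
    and "\<exists>L. L-lipschitz_on UNIV h"
    \<comment> \<open>assumption (i)\<close>
    and "\<forall>k. integrable M (\<lambda>\<omega>. (norm (Y k \<omega>))\<^sup>2)"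
    and "0 \<le> ch0" and "0 \<le> ch1" and "\<forall>v. (norm (h v))\<^sup>2 \<le> ch0 + ch1 * W v"
    and "\<forall>k. 0 \<le> \<tau>0 k" and "\<forall>k. 0 \<le> \<tau>1 k"
    and "\<forall>k. AE \<omega> in M. (norm (vec_cond_exp M (F k) (Y k) \<omega> - h (w k \<omega>)))\<^sup>2
                          \<le> \<tau>0 k + \<tau>1 k * W (w k \<omega>)"
    and "\<forall>k. AE \<omega> in M.
           real_cond_exp M (F k) (\<lambda>\<omega>'. (norm (Y k \<omega>' - vec_cond_exp M (F k) (Y k) \<omega>'))\<^sup>2) \<omega>
             \<le> \<sigma>0\<^sup>2 + \<sigma>1\<^sup>2 * W (w k \<omega>)"
    and "0 < cV"
    and "cV \<noteq> \<infinity> \<longrightarrow> (\<forall>v. norm (gradV v) \<le> enn2real cV * sqrt (W v))"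
    and "(\<lambda>k. cV * ennreal (\<tau>0 k)) \<longlonglongrightarrow> 0" and "(\<lambda>k. cV * ennreal (\<tau>1 k)) \<longlonglongrightarrow> 0"
    and "(\<Sum>k. ennreal (\<gamma> (Suc k)) * cV * ennreal (sqrt (\<tau>0 (Suc k)))) < \<infinity>"
    \<comment> \<open>assumption (ii)\<close>
    and "\<forall>v. GDERIV V v :> gradV v" and "continuous_on UNIV gradV"
    and "bdd_below (range V)"
    and "\<exists>L. L-lipschitz_on UNIV gradV"
    and "0 < \<rho>" and "\<forall>v. gradV v \<bullet> h v \<le> - \<rho> * W v"
    and "filterlim V at_top at_infinity"
  shows "(AE \<omega> in M.
            converges_to_set (\<lambda>k. w k \<omega>) (limit_set (\<lambda>k. w k \<omega>)) \<and>
            convergent (\<lambda>k. V (w k \<omega>)) \<and>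
            connected (limit_set (\<lambda>k. w k \<omega>)) \<and>
            internally_chain_recurrent \<Phi> (limit_set (\<lambda>k. w k \<omega>))) \<and>
         (compact \<Lambda>V \<and> flow_invariant \<Phi> \<Lambda>V \<and> interior (V ` \<Lambda>V) = {} \<longrightarrow>
            (AE \<omega> in M. limit_set (\<lambda>k. w k \<omega>) \<subseteq> \<Lambda>V)) \<and>
         (integrable M (\<lambda>\<omega>. V (w 0 \<omega>)) \<longrightarrow>
            (\<forall>k. integrable M (\<lambda>\<omega>. V (w k \<omega>))) \<and>
            bdd_above (range (\<lambda>k. \<integral>\<omega>. V (w k \<omega>) \<partial>M)))"
proof -
  \<comment> \<open>The hypotheses in the order of the statement; the first four are the definitions.\<close>
  note probM = assms(5) and H_borel = assms(7) and W_borel = assms(8)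
    and W_nonneg = assms(9)[rule_format] and X = assms(10) and w0 = assms(11)
    and rec = assms(12)[rule_format] and gpos = assms(13)[rule_format] and gdec = assms(14)[rule_format]
    and gdiv = assms(15) and gsq = assms(16) and hlip = assms(17) and Y2 = assms(18)[rule_format]
    and ch0 = assms(19) and ch1 = assms(20) and hle = assms(21)[rule_format]
    and t0 = assms(22)[rule_format] and t1 = assms(23)[rule_format]
    and bias = assms(24)[rule_format] and variance = assms(25)[rule_format]
    and cV = assms(26) and gradW = assms(27) and t0lim = assms(28) and t1lim = assms(29)
    and t0sum = assms(30) and V = assms(31)[rule_format] and gcont = assms(32) and Vbdd = assms(33)
    and glip = assms(34) and rho = assms(35) and drift = assms(36)[rule_format] and coercive = assms(37)
  interpret prob_space M by (rule probM)

  obtain L where L: "0 < L" "\<And>x y. norm (h x - h y) \<le> L * norm (x - y)"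
    using lipschitz_positive_constant[OF hlip] by blast
  obtain l where l: "0 < l" "\<And>x y. norm (gradV x - gradV y) \<le> l * norm (x - y)"
    using lipschitz_positive_constant[OF glip] by blast
  obtain v0 where v0: "\<And>v. v0 \<le> V v" using Vbdd by (auto simp: bdd_below_def)
  define U where "U v = V v - v0" for v
  define C where "C = 4 * l * (ch0 + ch1) / \<rho>\<^sup>2"
  have gradU_le: "(norm (gradV x))\<^sup>2 \<le> 4 * l * U x" for x
    unfolding U_def by (rule gradient_square_le[OF V l(2) l(1) v0])
  have U_nonneg: "0 \<le> U x" for x using v0 by (simp add: U_def)
  have W_le: "W x \<le> 1 + C * U x" for x
    unfolding C_def using dissipation_le[OF gradU_le hle drift rho W_nonneg ch0 ch1 _ U_nonneg] l by simp

  note hist = history_generators[where M=M and S=S and ?w0.0="w 0" and X=X, OF w0 X, folded F_def]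
  interpret filtered_prob_space M F
    by unfold_locales (rule hist(2,3))+
  have w_F: "w k \<in> borel_measurable (F k)" and Y_F: "Y k \<in> borel_measurable (F (Suc k))" for k
  proof -
    have Y: "Y k \<in> borel_measurable (F (Suc k))" if [measurable]: "w k \<in> borel_measurable (F k)" for k
    proof -
      have [measurable]: "w k \<in> borel_measurable (F (Suc k))" by (rule measurable_F_mono[OF that]) simp
      have [measurable]: "X (Suc k) \<in> measurable (F (Suc k)) S" by (rule hist(5)) auto
      have "(\<lambda>\<omega>. (w k \<omega>, X (Suc k) \<omega>)) \<in> measurable (F (Suc k)) (borel \<Otimes>\<^sub>M S)" by measurable
      from measurable_compose[OF this H_borel] show ?thesis by (simp add: Y_def)
    qed
    show w: "w k \<in> borel_measurable (F k)" for k
    proof (induction k)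
      case 0 show ?case by (rule hist(4))
    next
      case (Suc k)
      have [measurable]: "w k \<in> borel_measurable (F (Suc k))" by (rule measurable_F_mono[OF Suc]) simp
      note [measurable] = Y[OF Suc]
      have "(\<lambda>\<omega>. w k \<omega> + \<gamma> (Suc k) *\<^sub>R Y k \<omega>) \<in> borel_measurable (F (Suc k))" by measurable
      then show ?case
        by (rule measurable_cong[THEN iffD2, rotated]) (use rec in \<open>simp add: Y_def\<close>)
    qed
    show "Y k \<in> borel_measurable (F (Suc k))" by (rule Y[OF w])
  qed

  \<comment> \<open>An infinite \<open>cV\<close> becomes \<open>c = 0\<close>; the bounds \<open>\<beta>\<close> and \<open>\<theta>\<close> then vanish, which is correct from
    the index \<open>k0\<close> on, where the bias itself is zero.\<close>
  define c where "c = enn2real cV"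
  have c: "0 \<le> c" by (simp add: c_def)
  define \<beta> where "\<beta> k = c * sqrt (\<tau>0 k)" for k
  define \<theta> where "\<theta> k = c * (sqrt (\<tau>0 k) + sqrt (\<tau>1 k))" for k
  note t0_null = weighted_null[OF t0lim cV t0] and t1_null = weighted_null[OF t1lim cV t1]
  obtain B0 where B0: "\<And>k. \<tau>0 k \<le> B0"
    using convergent_imp_Bseq[OF convergentI[OF t0_null(1)]] by (auto simp: Bseq_def abs_le_iff)
  obtain B1 where B1: "\<And>k. \<tau>1 k \<le> B1"
    using convergent_imp_Bseq[OF convergentI[OF t1_null(1)]] by (auto simp: Bseq_def abs_le_iff)
  define B where "B = max B0 B1"
  have B: "\<tau>0 k \<le> B" "\<tau>1 k \<le> B" "0 \<le> B" for k
    using B0[of k] B1[of k] t0[of k] by (auto simp: B_def)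
  have g_null: "(\<lambda>k. \<gamma> (Suc k)) \<longlonglongrightarrow> 0"
    using summable_LIMSEQ_zero[OF gsq] by (simp add: power_tendsto_0_iff)
  have \<theta>_null: "\<theta> \<longlonglongrightarrow> 0"
  proof -
    have "\<theta> \<longlonglongrightarrow> c * (sqrt 0 + sqrt 0)"
      unfolding \<theta>_def by (intro tendsto_intros t0_null(1) t1_null(1))
    then show ?thesis by simp
  qed
  define K where "K = 2 * \<sigma>1\<^sup>2 + 4 * ch1 + 4 * B"
  have "(\<lambda>k. \<theta> k + l * \<gamma> (Suc k) * K) \<longlonglongrightarrow> 0 + l * 0 * K"
    by (intro tendsto_intros \<theta>_null g_null)
  then have "\<forall>\<^sub>F k in sequentially. \<theta> k + l * \<gamma> (Suc k) * K < \<rho>"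
    using rho by (intro order_tendstoD(2)) auto
  with t0_null(2) t1_null(2)
  have "\<forall>\<^sub>F k in sequentially. \<theta> k + l * \<gamma> (Suc k) * K < \<rho> \<and> (cV = \<infinity> \<longrightarrow> \<tau>0 k = 0 \<and> \<tau>1 k = 0)"
    by eventually_elim auto
  then obtain k0 where k0: "\<And>k. k0 \<le> k \<Longrightarrow> \<theta> k + l * \<gamma> (Suc k) * K < \<rho>"
    "\<And>k. k0 \<le> k \<Longrightarrow> cV = \<infinity> \<Longrightarrow> \<tau>0 k = 0 \<and> \<tau>1 k = 0"
    by (auto simp: eventually_sequentially)
  have \<beta>_summable: "summable (\<lambda>k. \<gamma> (Suc k) * \<beta> k)"
  proof -
    have "summable (\<lambda>k. \<gamma> (Suc k) * (c * sqrt (\<tau>0 (Suc k))))"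
      unfolding c_def by (rule weighted_summable[OF t0sum]) (use gpos t0 in \<open>auto simp: less_imp_le\<close>)
    \<comment> \<open>The bias at index \<open>k\<close> is met with the step \<open>\<gamma> (Suc k)\<close>, whereas the hypothesis pairs equal
      indices; monotonicity of the steps makes up for the shift.\<close>
    then have "summable (\<lambda>k. \<gamma> (Suc (Suc k)) * \<beta> (Suc k))"
    proof (rule summable_comparison_test')
      fix k
      have "\<gamma> (Suc (Suc k)) * \<beta> (Suc k) \<le> \<gamma> (Suc k) * \<beta> (Suc k)"
        using gdec[of "Suc k"] c t0 by (intro mult_right_mono) (auto simp: \<beta>_def)
      moreover have "0 \<le> \<gamma> (Suc (Suc k)) * \<beta> (Suc k)"
        using gpos[of "Suc (Suc k)"] c t0 by (simp add: \<beta>_def)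
      ultimately show "norm (\<gamma> (Suc (Suc k)) * \<beta> (Suc k)) \<le> \<gamma> (Suc k) * (c * sqrt (\<tau>0 (Suc k)))"
        by (simp add: \<beta>_def)
    qed
    then show ?thesis using summable_Suc_iff[of "\<lambda>k. \<gamma> (Suc k) * \<beta> k"] by simp
  qed

  interpret sa: stochastic_approximation M F w Y "\<lambda>k. \<gamma> (Suc k)" h gradV U W \<rho> l C ch0 ch1 B "\<sigma>0\<^sup>2" "\<sigma>1\<^sup>2" \<beta> \<theta> k0
  proof
    show "w (Suc k) \<omega> = w k \<omega> + \<gamma> (Suc k) *\<^sub>R Y k \<omega>" if "\<omega> \<in> space M" for k \<omega>
      using rec that by (simp add: Y_def)
    have "isCont V x" for x
      using V[of x] unfolding gderiv_def by (rule has_derivative_continuous)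
    then have "continuous_on UNIV V" by (simp add: continuous_at_imp_continuous_on)
    then show "U \<in> borel_measurable borel"
      unfolding U_def by (intro borel_measurable_diff borel_measurable_continuous_onI) auto
    show "gradV \<in> borel_measurable borel" by (rule borel_measurable_continuous_onI[OF gcont])
    show "U y \<le> U x + gradV x \<bullet> (y - x) + l * (norm (y - x))\<^sup>2" for x y
      using descent_lemma[OF V l(2), of y x] by (simp add: U_def)
    show "AE \<omega> in M. (norm (vec_cond_exp M (F k) (Y k) \<omega> - h (w k \<omega>)))\<^sup>2 \<le> B * (1 + W (w k \<omega>))" for k
      using bias[of k]
    proof eventually_elim
      case (elim \<omega>)
      have "\<tau>1 k * W (w k \<omega>) \<le> B * W (w k \<omega>)" by (rule mult_right_mono[OF B(2) W_nonneg])
      with elim B(1)[of k] show ?case by (simp add: distrib_left)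
    qed
    show "AE \<omega> in M. gradV (w k \<omega>) \<bullet> (vec_cond_exp M (F k) (Y k) \<omega> - h (w k \<omega>)) \<le> \<beta> k + \<theta> k * W (w k \<omega>)"
      if k: "k0 \<le> k" for k
      using bias[of k]
    proof eventually_elim
      case (elim \<omega>)
      show ?case
      proof (cases "cV = \<infinity>")
        case True
        with elim k0(2)[OF k] show ?thesis by (simp add: \<beta>_def \<theta>_def)
      next
        case False
        then have "norm (gradV (w k \<omega>)) \<le> c * sqrt (W (w k \<omega>))" using gradW by (simp add: c_def)
        from bias_inner_le[OF this elim c W_nonneg t0 t1] show ?thesis by (simp add: \<beta>_def \<theta>_def)
      qed
    qed
    show "\<theta> k + l * \<gamma> (Suc k) * (2 * \<sigma>1\<^sup>2 + 4 * ch1 + 4 * B) \<le> \<rho>" if "k0 \<le> k" for k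
      using k0(1)[OF that] by (simp add: K_def)
    show "0 \<le> C" unfolding C_def using l rho ch0 ch1 by simp
    show "0 \<le> \<beta> k" for k using c t0 by (simp add: \<beta>_def)
  qed (use w_F Y_F Y2 gpos gsq W_borel U_nonneg W_nonneg l ch0 ch1 B gradU_le W_le hle drift variance \<beta>_summable in auto)

  have bias_all: "AE \<omega> in M. \<forall>k. (norm (sa.mean k \<omega> - h (w k \<omega>)))\<^sup>2 \<le> \<tau>0 k + \<tau>1 k * W (w k \<omega>)"
    unfolding AE_all_countable using bias by blast
  have main: "AE \<omega> in M. converges_to_set (\<lambda>k. w k \<omega>) (limit_set (\<lambda>k. w k \<omega>)) \<and>
            convergent (\<lambda>k. V (w k \<omega>)) \<and>
            connected (limit_set (\<lambda>k. w k \<omega>)) \<and>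
            internally_chain_recurrent \<Phi> (limit_set (\<lambda>k. w k \<omega>)) \<and>
            limit_set (\<lambda>k. w k \<omega>) \<subseteq> \<Lambda>V"
    using sa.almost_sure_behaviour bias_all AE_space
  proof eventually_elim
    case (elim \<omega>)
    then obtain R where R: "\<And>k. U (w k \<omega>) \<le> R" by blast
    define b where "b k = sa.mean k \<omega> - h (w k \<omega>)" for k
    have bounded: "bounded (range (\<lambda>k. w k \<omega>))"
    proof -
      have "\<forall>\<^sub>F x in at_infinity. R + v0 < V x"
        using coercive by (auto simp: filterlim_at_top_dense)
      then obtain r where r: "\<And>x. r \<le> norm x \<Longrightarrow> R + v0 < V x"
        by (auto simp: eventually_at_infinity)
      have "norm (w k \<omega>) \<le> r" for k
        using r[of "w k \<omega>"] R[of k] unfolding U_def by linarith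
      then show ?thesis by (auto simp: bounded_iff)
    qed
    have "b \<longlonglongrightarrow> 0"
    proof -
      have "(\<lambda>k. (norm (b k))\<^sup>2) \<longlonglongrightarrow> 0"
      proof (rule tendsto_sandwich[OF _ _ tendsto_const])
        have "(norm (b k))\<^sup>2 \<le> \<tau>0 k + \<tau>1 k * (1 + C * R)" for k
        proof -
          have "C * U (w k \<omega>) \<le> C * R" using R sa.constants_nonneg by (intro mult_left_mono) auto
          then have "\<tau>1 k * W (w k \<omega>) \<le> \<tau>1 k * (1 + C * R)"
            using W_le[of "w k \<omega>"] t1 by (intro mult_left_mono) auto
          then show ?thesis using elim(2) unfolding b_def by (meson add_left_mono order_trans)
        qed
        then show "\<forall>\<^sub>F k in sequentially. (norm (b k))\<^sup>2 \<le> \<tau>0 k + \<tau>1 k * (1 + C * R)" by simp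
        have "(\<lambda>k. \<tau>0 k + \<tau>1 k * (1 + C * R)) \<longlonglongrightarrow> 0 + 0 * (1 + C * R)"
          by (intro tendsto_intros t0_null(1) t1_null(1))
        then show "(\<lambda>k. \<tau>0 k + \<tau>1 k * (1 + C * R)) \<longlonglongrightarrow> 0" by simp
      qed simp
      then have "(\<lambda>k. norm (b k)) \<longlonglongrightarrow> 0" by (simp add: power_tendsto_0_iff)
      then show ?thesis by (rule tendsto_norm_zero_cancel)
    qed
    interpret pe: perturbed_euler h L "\<lambda>k. w k \<omega>" b "\<lambda>k. sa.noise k \<omega>" "\<lambda>k. \<gamma> (Suc k)"
    proof
      show "w (Suc k) \<omega> = w k \<omega> + \<gamma> (Suc k) *\<^sub>R (h (w k \<omega>) + b k + sa.noise k \<omega>)" for k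
        using sa.recursion[OF elim(3), of k] by (simp add: b_def)
      show "summable (\<lambda>k. \<gamma> (Suc k) *\<^sub>R sa.noise k \<omega>)" using elim(1) by blast
    qed (fact L gdiv gsq \<open>b \<longlonglongrightarrow> 0\<close> bounded | simp add: gpos)+
    have Vconv: "convergent (\<lambda>k. V (w k \<omega>))"
      using elim(1) convergent_add[of "\<lambda>k. U (w k \<omega>)" "\<lambda>_. v0"] by (simp add: U_def convergent_const)
    then obtain v where "(\<lambda>k. V (w k \<omega>)) \<longlonglongrightarrow> v" by (auto simp: convergent_def)
    then have "limit_set (\<lambda>k. w k \<omega>) \<subseteq> \<Lambda>V"
      using pe.limit_set_stationary[OF V] by (auto simp: \<Lambda>V_def)
    then show ?case
      using limit_set_attracts[OF bounded] Vconv pe.connected_limit_set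
        pe.limit_set_internally_chain_recurrent by (simp add: \<Phi>_def)
  qed

  have "(\<forall>k. integrable M (\<lambda>\<omega>. V (w k \<omega>))) \<and> bdd_above (range (\<lambda>k. \<integral>\<omega>. V (w k \<omega>) \<partial>M))"
    if "integrable M (\<lambda>\<omega>. V (w 0 \<omega>))"
  proof -
    have "integrable M (\<lambda>\<omega>. U (w 0 \<omega>))" using that by (simp add: U_def)
    note U = sa.expectation_bounded[OF this]
    have int: "integrable M (\<lambda>\<omega>. V (w k \<omega>))" for k
      using Bochner_Integration.integrable_add[OF U(1)[of k] integrable_const[of v0]] by (simp add: U_def)
    have "(\<integral>\<omega>. V (w k \<omega>) \<partial>M) = (\<integral>\<omega>. U (w k \<omega>) \<partial>M) + v0" for k
      using int by (simp add: U_def prob_space)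
    moreover obtain K where "\<And>k. (\<integral>\<omega>. U (w k \<omega>) \<partial>M) \<le> K"
      using U(2) by (auto simp: bdd_above_def)
    ultimately have "(\<integral>\<omega>. V (w k \<omega>) \<partial>M) \<le> K + v0" for k by simp
    with int show ?thesis by (auto simp: bdd_above_def)
  qed
  moreover have "AE \<omega> in M. limit_set (\<lambda>k. w k \<omega>) \<subseteq> \<Lambda>V"
    using main by eventually_elim blast
  moreover have "AE \<omega> in M. converges_to_set (\<lambda>k. w k \<omega>) (limit_set (\<lambda>k. w k \<omega>)) \<and>
            convergent (\<lambda>k. V (w k \<omega>)) \<and>
            connected (limit_set (\<lambda>k. w k \<omega>)) \<and>
            internally_chain_recurrent \<Phi> (limit_set (\<lambda>k. w k \<omega>))"
    using main by eventually_elim blast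
  ultimately show ?thesis by blast
qed

end
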